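(* Assume that $\lim_{m\to\infty}\alpha_m^{\mathbf a}=\alpha$ and $\lim_{n\to\infty}\beta_n^{\mathbf b}=\beta$ in the vague topology, and $\lim_{m\to\infty}\min\mathbf a_m=\mathfrak a$ and $\lim_{n\to\infty}\min\mathbf b_n=\mathfrak b$, for some subprobability measures $\alpha,\beta$ on $\mathbb R$ and some $\mathfrak a,\mathfrak b\in\mathbb R\cup\{\infty\}$ with $\mathfrak a+\mathfrak b>0$. Let $C>0$ and let $S$ be the set of all $(x,y)\in\mathbb R_{\ge0}^2$ such that - $x\le C$ if $\alpha=0$ or $\mathfrak b=\infty$ (no restriction on $x$ otherwise), and - $y\le C$ if $\beta=0$ or $\mathfrak a=\infty$ (no restriction on $y$ otherwise). Let $\mathfrak A=\sup_{m\in\mathbb Z_{>0}}\min\mathbf a_m$ and $\mathfrak B=\sup_{n\in\mathbb Z_{>0}}\min\mathbf b_n$. Then, $\mathbf P$-almost surely, $$\lim_{t\to\infty}\mathrm d_{\mathrm H}\Big(S\cap\overline{t^{-1}\mathrm R^{\mathbf a,\mathbf b}_t},\ S\cap(\mathcal R\cup\mathcal I)\Big)=0,$$ where $$\mathcal R=\{(x,y)\in\mathbb R_{>0}^2:\gamma(x,y)\le1\},$$ $$\mathcal I=\Big\{(x,0):x\ge0,\ x\int_{\mathbb R}\frac{\alpha(\mathrm da)}{a+\mathfrak B}\le1\Big\}\cup\Big\{(0,y):y\ge0,\ y\int_{\mathbb R}\frac{\beta(\mathrm db)}{b+\mathfrak A}\le1\Big\}.$$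
   Context: $[n]=\{1,\dots,n\}$; $\mathrm{Exp}(\lambda)$ is the exponential distribution with rate $\lambda$ (mean $1/\lambda$). Fix two collections of real parameters $\mathbf a=\{\mathbf a_m(i):m\in\mathbb Z_{>0},i\in[m]\}$ and $\mathbf b=\{\mathbf b_n(j):n\in\mathbb Z_{>0},j\in[n]\}$ such that $\mathbf a_m(i)+\mathbf b_n(j)>0$ for all $m,n\in\mathbb Z_{>0}$, $i\in[m]$, $j\in[n]$. Write $\min\mathbf a_m=\min_{i\in[m]}\mathbf a_m(i)$ and $\min\mathbf b_n=\min_{j\in[n]}\mathbf b_n(j)$. Let $\alpha_m^{\mathbf a}=\frac1m\sum_{i=1}^m\delta_{\mathbf a_m(i)}$ and $\beta_n^{\mathbf b}=\frac1n\sum_{j=1}^n\delta_{\mathbf b_n(j)}$ be the empirical distributions. Vague convergence $\mu_n\to\mu$ of finite Borel measures on $\mathbb R$ means $\int f\,\mathrm d\mu_n\to\int f\,\mathrm d\mu$ for every continuous $f:\mathbb R\to\mathbb R$ vanishing at infinity. A subprobability measure is a nonnegative Borel measure of total mass at most $1$ (the zero measure is allowed). For $x,y>0$, $$\gamma(x,y)=\inf_{z\in(-\mathfrak a,\mathfrak b)}\Big\{x\int_{\mathbb R}\frac{\alpha(\mathrm da)}{a+z}+y\int_{\mathbb R}\frac{\beta(\mathrm db)}{b-z}\Big\}.$$ Convention: integrals of $1/(a+\infty)$ or $1/(b+\infty)$ are $0$. Let $(\Omega,\mathbf P)$ be $\Omega=\mathbb R^{\mathbb Z_{>0}^2}$ with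 the product measure under which the coordinates are i.i.d. $\mathrm{Exp}(1)$. For each $m,n\in\mathbb Z_{>0}$ let $\{\omega_{m,n}^{\mathbf a,\mathbf b}(i,j): i\in[m],j\in[n]\}$ be independent random variables on $(\Omega,\mathbf P)$ with $\omega_{m,n}^{\mathbf a,\mathbf b}(i,j)\sim\mathrm{Exp}(\mathbf a_m(i)+\mathbf b_n(j))$; no assumption is made about the joint distribution of these collections for different $(m,n)$. The last-passage time is $\mathrm G^{\mathbf a,\mathbf b}(m,n)=\max_{\pi}\sum_{(i,j)\in\pi}\omega^{\mathbf a,\mathbf b}_{m,n}(i,j)$, the maximum over all up-right lattice paths $\pi$ from $(1,1)$ to $(m,n)$ (steps $(1,0)$ or $(0,1)$). The growing cluster is $$\mathrm R_t^{\mathbf a,\mathbf b}=\{(x,y)\in\mathbb R_{>0}^2:\mathrm G^{\mathbf a,\mathbf b}(\lceil x\rceil,\lceil y\rceil)\le t\},\quad t\ge0,$$ the overline denotes closure in $\mathbb R_{\ge0}^2$, and $\mathrm d_{\mathrm H}$ is the Hausdorff metric on nonempty bounded closed subsets of $\mathbb R_{\ge0}^2$ (with the Euclidean metric): $\mathrm d_{\mathrm H}(A,B)=\inf\{\epsilon>0:A\subset B^\epsilon,\ B\subset A^\epsilon\}$ with $A^\epsilon$ the open $\epsilon$-neighborhood of $A$. (For large $t$ the sets involved are almost surely nonempty, bounded and closed, and the limit is taken along such $t$.) *)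

theory Defs
  imports "HOL-Probability.Probability"
begin

subsection \<open>Parameters and measures\<close>

text \<open>
  A collection of parameters is a function of type \<^typ>\<open>nat \<Rightarrow> nat \<Rightarrow> real\<close>; only the values
  \<open>c m i\<close> with \<open>1 \<le> i \<le> m\<close> are meaningful.
\<close>

definition min_param :: "(nat \<Rightarrow> nat \<Rightarrow> real) \<Rightarrow> nat \<Rightarrow> real" where
  "min_param c m = Min (c m ` {1..m})"

definition sup_min_param :: "(nat \<Rightarrow> nat \<Rightarrow> real) \<Rightarrow> ereal" where
  "sup_min_param c = (SUP m\<in>{1..}. ereal (min_param c m))"

definition empirical :: "(nat \<Rightarrow> nat \<Rightarrow> real) \<Rightarrow> nat \<Rightarrow> real measure" where
  "empirical c m = measure_of UNIV (sets borel)
     (\<lambda>A. ennreal (1 / real m) * (\<Sum>i=1..m. emeasure (return borel (c m i)) A))"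

lemma sets_empirical [simp, measurable_cong]: "sets (empirical c m) = sets borel"
  and space_empirical [simp]: "space (empirical c m) = UNIV"
  using sets.space_closed[of borel] sets.sigma_sets_eq[of "borel :: real measure"]
  by (simp_all add: empirical_def sets_measure_of space_measure_of)

lemma emeasure_empirical:
  assumes "A \<in> sets borel"
  shows "emeasure (empirical c m) A =
    ennreal (1 / real m) * (\<Sum>i=1..m. emeasure (return borel (c m i)) A)"
proof (rule emeasure_measure_of[OF empirical_def])
  show "positive (sets (empirical c m))
      (\<lambda>A. ennreal (1 / real m) * (\<Sum>i=1..m. emeasure (return borel (c m i)) A))"
    by (simp add: positive_def)
  show "countably_additive (sets (empirical c m))
      (\<lambda>A. ennreal (1 / real m) * (\<Sum>i=1..m. emeasure (return borel (c m i)) A))"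
  proof (rule countably_additiveI)
    fix F :: "nat \<Rightarrow> real set"
    assume F: "range F \<subseteq> sets (empirical c m)" "disjoint_family F"
    have "(\<Sum>k. emeasure (return borel (c m i)) (F k)) = emeasure (return borel (c m i)) (\<Union>k. F k)"
      for i using F by (intro suminf_emeasure) auto
    then show "(\<Sum>k. ennreal (1 / real m) * (\<Sum>i=1..m. emeasure (return borel (c m i)) (F k))) =
        ennreal (1 / real m) * (\<Sum>i=1..m. emeasure (return borel (c m i)) (\<Union>k. F k))"
      by (simp only: ennreal_suminf_cmult suminf_sum summableI)
  qed
qed (use assms in auto)

definition vague_conv :: "(nat \<Rightarrow> real measure) \<Rightarrow> real measure \<Rightarrow> bool" where
  "vague_conv M N \<longleftrightarrow> (\<forall>f :: real \<Rightarrow> real.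
     continuous_on UNIV f \<and> (f \<longlongrightarrow> 0) at_infinity \<longrightarrow>
     (\<lambda>n. LINT s|M n. f s) \<longlonglongrightarrow> (LINT s|N. f s))"

subsection \<open>The limit shape\<close>

text \<open>
  Under the hypotheses of the theorem \<open>\<alpha>\<close> and \<open>\<beta>\<close> are finite measures that give no mass to
  \<open>{..<\<aa>}\<close> and \<open>{..<\<bb>}\<close>, so for \<open>-\<aa> < z < \<bb>\<close> both integrands below are almost everywhere
  nonnegative and bounded; hence the Bochner integrals are the usual ones, and the real infimum
  is that of a nonempty set bounded below by \<open>0\<close>.
\<close>

definition shape_fun ::
  "real measure \<Rightarrow> real measure \<Rightarrow> ereal \<Rightarrow> ereal \<Rightarrow> real \<Rightarrow> real \<Rightarrow> real" where
  "shape_fun \<alpha> \<beta> \<aa> \<bb> x y =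
     (INF z\<in>{z :: real. - \<aa> < ereal z \<and> ereal z < \<bb>}.
        x * (LINT s|\<alpha>. 1 / (s + z)) + y * (LINT s|\<beta>. 1 / (s - z)))"

text \<open>
  The integral of \<open>1 / (s + w)\<close> with the convention \<open>1 / (s + \<infinity>) = 0\<close>; the value at
  \<open>w = -\<infinity>\<close> is irrelevant.
\<close>

definition recip_integral :: "real measure \<Rightarrow> ereal \<Rightarrow> real" where
  "recip_integral \<mu> w = (if w = \<infinity> then 0 else LINT s|\<mu>. 1 / (s + real_of_ereal w))"

definition limit_region ::
  "real measure \<Rightarrow> real measure \<Rightarrow> ereal \<Rightarrow> ereal \<Rightarrow> (real \<times> real) set" where
  "limit_region \<alpha> \<beta> \<aa> \<bb> = {(x, y). 0 < x \<and> 0 < y \<and> shape_fun \<alpha> \<beta> \<aa> \<bb> x y \<le> 1}"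

definition limit_axes ::
  "real measure \<Rightarrow> real measure \<Rightarrow> ereal \<Rightarrow> ereal \<Rightarrow> (real \<times> real) set" where
  "limit_axes \<alpha> \<beta> A B =
     {(x, 0) | x. 0 \<le> x \<and> x * recip_integral \<alpha> B \<le> 1} \<union>
     {(0, y) | y. 0 \<le> y \<and> y * recip_integral \<beta> A \<le> 1}"

definition window ::
  "real measure \<Rightarrow> real measure \<Rightarrow> ereal \<Rightarrow> ereal \<Rightarrow> real \<Rightarrow> (real \<times> real) set" where
  "window \<alpha> \<beta> \<aa> \<bb> C = {(x, y). 0 \<le> x \<and> 0 \<le> y \<and>
     (\<alpha> = null_measure borel \<or> \<bb> = \<infinity> \<longrightarrow> x \<le> C) \<and>
     (\<beta> = null_measure borel \<or> \<aa> = \<infinity> \<longrightarrow> y \<le> C)}"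

subsection \<open>Last-passage percolation\<close>

definition exp_product_space :: "(nat \<times> nat \<Rightarrow> real) measure" where
  "exp_product_space =
     PiM ({1..} \<times> {1..}) (\<lambda>_. density lborel (\<lambda>s. ennreal (exponential_density 1 s)))"

lemma prob_space_exp_product_space: "prob_space exp_product_space"
  unfolding exp_product_space_def
  by (intro prob_space_PiM prob_space_exponential_density) simp

text \<open>Paths are represented by the list of the visited sites, in order.\<close>

definition up_right_path :: "nat \<Rightarrow> nat \<Rightarrow> (nat \<times> nat) list \<Rightarrow> bool" where
  "up_right_path m n p \<longleftrightarrow> p \<noteq> [] \<and> hd p = (1, 1) \<and> last p = (m, n) \<and>
     successively (\<lambda>u v. v = (fst u + 1, snd u) \<or> v = (fst u, snd u + 1)) p"

definition last_passage :: "(nat \<times> nat \<Rightarrow> real) \<Rightarrow> nat \<Rightarrow> nat \<Rightarrow> real" where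
  "last_passage w m n = Max ((\<lambda>p. \<Sum>u\<leftarrow>p. w u) ` {p. up_right_path m n p})"

lemma up_right_steps_bounds:
  assumes "successively (\<lambda>u v. v = (fst u + 1, snd u) \<or> v = (fst u, snd u + 1)) p"
    and "p \<noteq> []"
  shows "set p \<subseteq> {fst (hd p)..fst (last p)} \<times> {snd (hd p)..snd (last p :: nat \<times> nat)} \<and>
    fst (hd p) + snd (hd p) + length p = fst (last p) + snd (last p) + 1"
  using assms
proof (induction p rule: induct_list012)
  case (3 u v p)
  have "set (v # p) \<subseteq> {fst v..fst (last (v # p))} \<times> {snd v..snd (last (v # p))}"
    and "fst v + snd v + length (v # p) = fst (last (v # p)) + snd (last (v # p)) + 1"
    using 3 by simp_all
  moreover from this(1) have "v \<in> {fst v..fst (last (v # p))} \<times> {snd v..snd (last (v # p))}"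
    by auto
  moreover have "v = (fst u + 1, snd u) \<or> v = (fst u, snd u + 1)"
    using 3 by simp
  ultimately show ?case
    by (cases u; cases v) fastforce
qed auto

lemma finite_up_right_paths: "finite {p. up_right_path m n p}"
proof (rule finite_subset)
  show "{p. up_right_path m n p} \<subseteq> {p. set p \<subseteq> {1..m} \<times> {1..n} \<and> length p \<le> m + n}"
    using up_right_steps_bounds by (fastforce simp: up_right_path_def)
  show "finite {p. set p \<subseteq> {1..m} \<times> {1..n} \<and> length p \<le> m + n}"
    by (rule finite_lists_length_le) simp
qed

lemma up_right_path_exists:
  assumes "1 \<le> m" "1 \<le> n"
  shows "\<exists>p. up_right_path m n p"
proof -
  have row: "\<exists>p. up_right_path m 1 p"
    using assms(1)
  proof (induction m rule: dec_induct)
    case base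
    have "up_right_path 1 1 [(1, 1)]" by (simp add: up_right_path_def)
    then show ?case by blast
  next
    case (step k)
    then obtain p where "up_right_path k 1 p" by blast
    then have "up_right_path (Suc k) 1 (p @ [(Suc k, 1)])"
      by (auto simp: up_right_path_def successively_append_iff)
    then show ?case by blast
  qed
  show ?thesis
    using assms(2)
  proof (induction n rule: dec_induct)
    case (step k)
    then obtain p where "up_right_path m k p" by blast
    then have "up_right_path m (Suc k) (p @ [(m, Suc k)])"
      by (auto simp: up_right_path_def successively_append_iff)
    then show ?case by blast
  qed (fact row)
qed

text \<open>Here \<open>w m n\<close> is the collection of weights used for the last-passage time to \<open>(m, n)\<close>.\<close>

definition cluster :: "(nat \<Rightarrow> nat \<Rightarrow> nat \<times> nat \<Rightarrow> real) \<Rightarrow> real \<Rightarrow> (real \<times> real) set" where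
  "cluster w t = {(x, y). 0 < x \<and> 0 < y \<and>
     last_passage (w (nat \<lceil>x\<rceil>) (nat \<lceil>y\<rceil>)) (nat \<lceil>x\<rceil>) (nat \<lceil>y\<rceil>) \<le> t}"

subsection \<open>Hausdorff distance\<close>

text \<open>
  The metric on \<^typ>\<open>real \<times> real\<close> is the Euclidean one. The distance is used only for sets
  satisfying \<open>hausdorff_dom\<close>, for which the infimum is over a nonempty set.
\<close>

definition hausdorff_dom :: "(real \<times> real) set \<Rightarrow> bool" where
  "hausdorff_dom A \<longleftrightarrow> A \<noteq> {} \<and> bounded A \<and> closed A"

definition hausdorff_dist :: "(real \<times> real) set \<Rightarrow> (real \<times> real) set \<Rightarrow> real" where
  "hausdorff_dist A B =
     Inf {\<epsilon>. 0 < \<epsilon> \<and> A \<subseteq> (\<Union>u\<in>B. ball u \<epsilon>) \<and> B \<subseteq> (\<Union>u\<in>A. ball u \<epsilon>)}"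

end

theory Submission
  imports Defs
begin

text \<open>
  For independent exponential weights with rates \<open>a\<^sub>i + b\<^sub>j\<close>, boundary weights with rates
  \<open>a\<^sub>i + z\<close> on the bottom row and \<open>b\<^sub>j - z\<close> on the left column make the model stationary
  (Burke property): the increments along the top and right sides again have these laws. Comparing
  the bulk with this stationary model gives the sharp exponential moment
  \<open>E exp (\<theta> G) \<le> exp (\<theta> (\<Sum>i. 1 / (a\<^sub>i + u)) + \<theta> (\<Sum>j. 1 / (b\<^sub>j - u - \<theta>)))\<close>, hence the upper tail.

  For the lower tail, suppose first that \<open>z\<close> is balanced,
  \<open>(\<Sum>i. 1 / (a\<^sub>i + z)\<^sup>2) = (\<Sum>j. 1 / (b\<^sub>j - z)\<^sup>2)\<close>. A path of the stationary model that stays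
  on the boundary for a macroscopic amount of weight loses a macroscopic amount: the upper tail at a
  slightly shifted parameter together with Cauchy--Schwarz shows this, whatever the order of the
  parameters. So the stationary maximum, which concentrates, is nearly attained in the bulk. In the
  flat directions, where no admissible \<open>z\<close> is balanced, the path follows the single column (or row)
  with the smallest parameter for a suitable stretch and is balanced before and after it.

  All bounds are exponentially small in the size of the rectangle, so Borel--Cantelli applies to all
  rectangles at once, with no assumption on how the arrays are coupled. Near the axes only one row
  (or column) matters, and the best ones have minimal parameter close to the supremum; this
  produces the part of the limit on the axes. The rest is homogeneity, monotonicity and compactness.
\<close>

text \<open>Nothing relates the arrays of different (m, n), so neither subadditivity along a
  sequence nor an ergodic theorem is available. Every rectangle needs its own estimate, with
  constants depending only on a lower bound \<open>r\<close> for the shifted rates and on the error,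
  so that they serve all parameter arrays at once. The bulk is dominated by the stationary model,
  and the bottom boundary row is independent of the bulk. Dividing the exponential moment of the
  right-hand increments by that of the bottom row therefore isolates the bulk; the shift by \<theta>
  in the second sum comes from x / (x - \<theta>) being at most exp (\<theta> / (x - \<theta>)). The
  stationary mean is convex in z, and its derivative is the difference of the two sums of squares.
  Balance thus means that z minimises the mean, which is why the infimum over z appears in the
  limit; a flat direction is one whose minimiser over the allowed interval is an endpoint. That
  interval is kept a distance 2h inside (-\<aa>, \<bb>), so that all rates stay bounded below; near
  an endpoint the extremal column or row replaces the missing balanced z at a cost absorbed by the
  error.\<close>

section \<open>The Burke transformation\<close>

text \<open>Nonpositive rates are replaced by \<open>1\<close>, so that this is always a probability measure.\<close>

definition expm :: "real \<Rightarrow> real measure" where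
  "expm r = density lborel (\<lambda>s. ennreal (exponential_density (if 0 < r then r else 1) s))"

lemma prob_space_expm: "prob_space (expm r)"
  unfolding expm_def by (rule prob_space_exponential_density) simp

lemma sets_expm [simp, measurable_cong]: "sets (expm r) = sets borel"
  and space_expm [simp]: "space (expm r) = UNIV"
  by (simp_all add: expm_def)

lemma nn_integral_expm:
  assumes "f \<in> borel_measurable borel" "0 < r"
  shows "(\<integral>\<^sup>+x. f x \<partial>expm r) = (\<integral>\<^sup>+x. ennreal (exponential_density r x) * f x \<partial>lborel)"
  using assms unfolding expm_def by (subst nn_integral_density) auto

lemma nn_integral_lborel_shift:
  fixes f :: "real \<Rightarrow> ennreal"
  assumes "f \<in> borel_measurable borel"
  shows "(\<integral>\<^sup>+x. f x \<partial>lborel) = (\<integral>\<^sup>+d. f (y + d) \<partial>lborel)"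
  using nn_integral_real_affine[of f 1 y] assms by simp

lemma nn_integral_lborel_shear:
  fixes f :: "real \<Rightarrow> real \<Rightarrow> ennreal"
  assumes [measurable]: "case_prod f \<in> borel_measurable (borel \<Otimes>\<^sub>M borel)"
  shows "(\<integral>\<^sup>+y. \<integral>\<^sup>+x. f x y \<partial>lborel \<partial>lborel) = (\<integral>\<^sup>+y. \<integral>\<^sup>+d. f (y + d) y \<partial>lborel \<partial>lborel)"
proof (rule nn_integral_cong)
  fix y :: real
  have "(\<lambda>x. f x y) \<in> borel_measurable borel" by measurable
  then show "(\<integral>\<^sup>+x. f x y \<partial>lborel) = (\<integral>\<^sup>+d. f (y + d) y \<partial>lborel)"
    by (rule nn_integral_lborel_shift)
qed

lemma nn_integral_lborel_swap:
  fixes f :: "real \<Rightarrow> real \<Rightarrow> ennreal"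
  assumes "case_prod f \<in> borel_measurable (borel \<Otimes>\<^sub>M borel)"
  shows "(\<integral>\<^sup>+y. \<integral>\<^sup>+x. f x y \<partial>lborel \<partial>lborel) = (\<integral>\<^sup>+x. \<integral>\<^sup>+y. f x y \<partial>lborel \<partial>lborel)"
proof (rule lborel_pair.Fubini')
  show "case_prod f \<in> borel_measurable (lborel \<Otimes>\<^sub>M lborel)"
    using assms by (subst measurable_cong_sets[OF sets_pair_measure_cong[OF sets_lborel sets_lborel] refl])
qed

text \<open>In the coordinates (d, y, w) with d = x - y the substitution exchanges y and w and fixes
  d, so it preserves Lebesgue measure. The half-space on which it will be used is encoded as an
  indicator inside \<open>F\<close>.\<close>

lemma burke_half:
  fixes F :: "real \<Rightarrow> real \<Rightarrow> real \<Rightarrow> ennreal"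
  assumes F: "(\<lambda>(x, y, w). F x y w) \<in> borel_measurable (borel \<Otimes>\<^sub>M borel \<Otimes>\<^sub>M borel)"
  shows "(\<integral>\<^sup>+w. \<integral>\<^sup>+y. \<integral>\<^sup>+x. F (w + (x - y)) w y \<partial>lborel \<partial>lborel \<partial>lborel) =
         (\<integral>\<^sup>+w. \<integral>\<^sup>+y. \<integral>\<^sup>+x. F x y w \<partial>lborel \<partial>lborel \<partial>lborel)"
proof -
  have [measurable]: "(\<lambda>z. F (f z) (g z) (h z)) \<in> borel_measurable M"
    if [measurable]: "f \<in> borel_measurable M" "g \<in> borel_measurable M" "h \<in> borel_measurable M"
    for f g h and M :: "'b measure"
    using measurable_compose[OF _ F, of "\<lambda>z. (f z, g z, h z)" M] by simp
  have "(\<integral>\<^sup>+w. \<integral>\<^sup>+y. \<integral>\<^sup>+x. F (w + (x - y)) w y \<partial>lborel \<partial>lborel \<partial>lborel) =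
    (\<integral>\<^sup>+w. \<integral>\<^sup>+y. \<integral>\<^sup>+d. F (w + d) w y \<partial>lborel \<partial>lborel \<partial>lborel)"
    by (rule nn_integral_cong, rule nn_integral_lborel_shear[THEN trans]) (simp_all add: split_beta')
  also have "\<dots> = (\<integral>\<^sup>+y. \<integral>\<^sup>+w. \<integral>\<^sup>+d. F (w + d) w y \<partial>lborel \<partial>lborel \<partial>lborel)"
    by (rule nn_integral_lborel_swap) (simp add: split_beta')
  also have "\<dots> = (\<integral>\<^sup>+w. \<integral>\<^sup>+y. \<integral>\<^sup>+x. F x y w \<partial>lborel \<partial>lborel \<partial>lborel)"
    by (rule nn_integral_cong, rule nn_integral_lborel_shear[THEN trans, symmetric])
      (simp_all add: split_beta')
  finally show ?thesis .
qed

lemma burke_aux: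
  fixes F :: "real \<Rightarrow> real \<Rightarrow> real \<Rightarrow> ennreal" and p q :: real
  assumes F: "(\<lambda>(x, y, w). F x y w) \<in> borel_measurable (borel \<Otimes>\<^sub>M borel \<Otimes>\<^sub>M borel)"
    and pq: "0 < p" "0 < q"
  shows "(\<integral>\<^sup>+w. \<integral>\<^sup>+y. \<integral>\<^sup>+x. F x y w \<partial>expm p \<partial>expm q \<partial>expm (p + q)) =
    (\<integral>\<^sup>+w. \<integral>\<^sup>+y. \<integral>\<^sup>+x. F x y w * ennreal (exponential_density p x *
      exponential_density q y * exponential_density (p + q) w) \<partial>lborel \<partial>lborel \<partial>lborel)"
proof -
  have [measurable]: "(\<lambda>z. F (f z) (g z) (h z)) \<in> borel_measurable M"
    if [measurable]: "f \<in> borel_measurable M" "g \<in> borel_measurable M" "h \<in> borel_measurable M"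
    for f g h and M :: "'b measure"
    using measurable_compose[OF _ F, of "\<lambda>z. (f z, g z, h z)" M] by simp
  have *: "exponential_density p x \<ge> 0" "exponential_density q x \<ge> 0"
    "exponential_density (p + q) x \<ge> 0" for x
    using pq by (auto intro: exponential_density_nonneg)
  have "(\<integral>\<^sup>+w. \<integral>\<^sup>+y. \<integral>\<^sup>+x. F x y w \<partial>expm p \<partial>expm q \<partial>expm (p + q)) =
    (\<integral>\<^sup>+w. ennreal (exponential_density (p + q) w) * (\<integral>\<^sup>+y. ennreal (exponential_density q y) *
      (\<integral>\<^sup>+x. ennreal (exponential_density p x) * F x y w \<partial>lborel) \<partial>lborel) \<partial>lborel)"
    using pq by (simp add: nn_integral_expm)
  also have "\<dots> = (\<integral>\<^sup>+w. \<integral>\<^sup>+y. \<integral>\<^sup>+x. F x y w * ennreal (exponential_density p x *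
      exponential_density q y * exponential_density (p + q) w) \<partial>lborel \<partial>lborel \<partial>lborel)"
    by (simp add: nn_integral_cmult[symmetric] ennreal_mult * mult_ac)
  finally show ?thesis .
qed

text \<open>On the positive octant the joint density is a constant times exp (-(p x + q y + (p + q)
  w)). The map is piecewise linear; each piece preserves Lebesgue measure and also this linear form,
  which is where the rate p + q of the third coordinate is forced.\<close>

theorem expm_burke:
  fixes F :: "real \<Rightarrow> real \<Rightarrow> real \<Rightarrow> ennreal" and p q :: real
  assumes F: "(\<lambda>(x, y, w). F x y w) \<in> borel_measurable (borel \<Otimes>\<^sub>M borel \<Otimes>\<^sub>M borel)"
    and pq: "0 < p" "0 < q"
  shows "(\<integral>\<^sup>+w. \<integral>\<^sup>+y. \<integral>\<^sup>+x. F (w + max 0 (x - y)) (w + max 0 (y - x)) (min x y)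
      \<partial>expm p \<partial>expm q \<partial>expm (p + q)) =
    (\<integral>\<^sup>+w. \<integral>\<^sup>+y. \<integral>\<^sup>+x. F x y w \<partial>expm p \<partial>expm q \<partial>expm (p + q))"
proof -
  have F'[measurable]: "(\<lambda>z. F (f z) (g z) (h z)) \<in> borel_measurable M"
    if [measurable]: "f \<in> borel_measurable M" "g \<in> borel_measurable M" "h \<in> borel_measurable M"
    for f g h and M :: "'b measure"
    using measurable_compose[OF _ F, of "\<lambda>z. (f z, g z, h z)" M] by simp
  define D where "D = (\<lambda>x y w. ennreal (exponential_density p x *
      exponential_density q y * exponential_density (p + q) w))"
  have E: "exponential_density p x * exponential_density q y * exponential_density (p + q) w =
      p * q * (p + q) * exp (- (p * x + q * y + (p + q) * w))"
    if "0 \<le> x" "0 \<le> y" "0 \<le> w" for x y w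
  proof -
    have "exp (- (p * x + q * y + (p + q) * w)) = exp (- x * p) * exp (- y * q) * exp (- w * (p + q))"
      unfolding exp_add[symmetric] by (simp add: algebra_simps)
    then show ?thesis using that by (simp add: exponential_density_def)
  qed
  have D1: "D x y w = D (w + (x - y)) w y" if "x \<ge> y" for x y w
  proof (cases "y \<ge> 0 \<and> w \<ge> 0")
    case True
    with that have "0 \<le> x" "0 \<le> y" "0 \<le> w" by auto
    moreover have "p * x + q * y + (p + q) * w = p * (w + (x - y)) + q * w + (p + q) * y"
      by algebra
    ultimately show ?thesis using that by (simp add: D_def E del: minus_add_distrib)
  next
    case False
    then show ?thesis by (auto simp: D_def exponential_density_def)
  qed
  have D2: "D x y w = D w (w + (y - x)) x" if "x < y" for x y w
  proof (cases "x \<ge> 0 \<and> w \<ge> 0")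
    case True
    with that have "0 \<le> x" "0 \<le> y" "0 \<le> w" by auto
    moreover have "p * x + q * y + (p + q) * w = p * w + q * (w + (y - x)) + (p + q) * x"
      by algebra
    ultimately show ?thesis using that by (simp add: D_def E del: minus_add_distrib)
  next
    case False
    then show ?thesis by (auto simp: D_def exponential_density_def)
  qed
  have [measurable]: "(\<lambda>z. D (f z) (g z) (h z)) \<in> borel_measurable M"
    if [measurable]: "f \<in> borel_measurable M" "g \<in> borel_measurable M" "h \<in> borel_measurable M"
    for f g h and M :: "'b measure"
    unfolding D_def by measurable
  \<comment> \<open>The map preserves the difference of the first two coordinates, so it sends each
    of the halves y \<le> x and x < y to itself. \<open>N\<close> takes its first two arguments in
    exchanged order, so that \<open>burke_half\<close> serves both halves.\<close>
  define P where "P = (\<lambda>x y w. indicator {(x, y). y \<le> x} (x, y) * F x y w * D x y w)"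
  define N where "N = (\<lambda>y x w. indicator {(x, y). x < y} (x, y) * F x y w * D x y w)"
  have [measurable]: "(\<lambda>z. P (f z) (g z) (h z)) \<in> borel_measurable M"
    "(\<lambda>z. N (f z) (g z) (h z)) \<in> borel_measurable M"
    if [measurable]: "f \<in> borel_measurable M" "g \<in> borel_measurable M" "h \<in> borel_measurable M"
    for f g h and M :: "'b measure"
    unfolding P_def N_def by measurable
  have split: "F x y w * D x y w = P x y w + N y x w" for x y w
    by (auto simp: P_def N_def indicator_def)
  have split': "F (w + max 0 (x - y)) (w + max 0 (y - x)) (min x y) * D x y w =
      P (w + (x - y)) w y + N (w + (y - x)) w x" for x y w
    using D1[of y x w] D2[of x y w] by (cases "y \<le> x") (auto simp: P_def N_def indicator_def max_def min_def)
  have N1: "(\<integral>\<^sup>+w. \<integral>\<^sup>+y. \<integral>\<^sup>+x. N (w + (y - x)) w x \<partial>lborel \<partial>lborel \<partial>lborel) =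
    (\<integral>\<^sup>+w. \<integral>\<^sup>+y. \<integral>\<^sup>+x. N y x w \<partial>lborel \<partial>lborel \<partial>lborel)"
  proof -
    have "(\<integral>\<^sup>+w. \<integral>\<^sup>+y. \<integral>\<^sup>+x. N (w + (y - x)) w x \<partial>lborel \<partial>lborel \<partial>lborel) =
      (\<integral>\<^sup>+w. \<integral>\<^sup>+x. \<integral>\<^sup>+y. N (w + (y - x)) w x \<partial>lborel \<partial>lborel \<partial>lborel)"
      by (rule nn_integral_cong, rule nn_integral_lborel_swap) (simp add: split_beta')
    also have "\<dots> = (\<integral>\<^sup>+w. \<integral>\<^sup>+x. \<integral>\<^sup>+y. N y x w \<partial>lborel \<partial>lborel \<partial>lborel)"
      by (rule burke_half) (simp add: split_beta')
    also have "\<dots> = (\<integral>\<^sup>+w. \<integral>\<^sup>+y. \<integral>\<^sup>+x. N y x w \<partial>lborel \<partial>lborel \<partial>lborel)"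
      by (rule nn_integral_cong, rule nn_integral_lborel_swap) (simp add: split_beta')
    finally show ?thesis .
  qed
  have P1: "(\<integral>\<^sup>+w. \<integral>\<^sup>+y. \<integral>\<^sup>+x. P (w + (x - y)) w y \<partial>lborel \<partial>lborel \<partial>lborel) =
    (\<integral>\<^sup>+w. \<integral>\<^sup>+y. \<integral>\<^sup>+x. P x y w \<partial>lborel \<partial>lborel \<partial>lborel)"
    by (rule burke_half) (simp add: split_beta')
  have "(\<integral>\<^sup>+w. \<integral>\<^sup>+y. \<integral>\<^sup>+x. F (w + max 0 (x - y)) (w + max 0 (y - x)) (min x y)
      \<partial>expm p \<partial>expm q \<partial>expm (p + q)) =
    (\<integral>\<^sup>+w. \<integral>\<^sup>+y. \<integral>\<^sup>+x. F (w + max 0 (x - y)) (w + max 0 (y - x)) (min x y) * D x y w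
      \<partial>lborel \<partial>lborel \<partial>lborel)"
    unfolding D_def using pq by (intro burke_aux) (simp_all add: split_beta')
  also have "\<dots> = (\<integral>\<^sup>+w. \<integral>\<^sup>+y. \<integral>\<^sup>+x. F x y w * D x y w \<partial>lborel \<partial>lborel \<partial>lborel)"
    unfolding split split' by (simp add: nn_integral_add N1 P1)
  also have "\<dots> = (\<integral>\<^sup>+w. \<integral>\<^sup>+y. \<integral>\<^sup>+x. F x y w \<partial>expm p \<partial>expm q \<partial>expm (p + q))"
    unfolding D_def using pq F by (intro burke_aux[symmetric])
  finally show ?thesis .
qed

section \<open>Stationary last-passage percolation\<close>

definition expQ :: "('i \<Rightarrow> real) \<Rightarrow> 'i set \<Rightarrow> ('i \<Rightarrow> real) measure" where
  "expQ \<rho> J = PiM J (\<lambda>c. expm (\<rho> c))"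

interpretation expQ: product_prob_space "\<lambda>c. expm (\<rho> c)" J for \<rho> :: "'i \<Rightarrow> real" and J
  by (intro product_prob_space.intro product_sigma_finite.intro product_prob_space_axioms.intro)
     (simp_all add: prob_space_expm prob_space_imp_sigma_finite)

lemma prob_space_expQ: "prob_space (expQ \<rho> J)"
  unfolding expQ_def by (rule prob_space_PiM) (rule prob_space_expm)

lemma sets_expQ [measurable_cong]: "sets (expQ \<rho> J) = sets (PiM J (\<lambda>_. borel))"
  unfolding expQ_def by (rule sets_PiM_cong) simp_all

lemma space_expQ: "space (expQ \<rho> J) = PiE J (\<lambda>_. UNIV)"
  by (simp add: expQ_def space_PiM)

lemma measurable_expQ_component: "c \<in> J \<Longrightarrow> (\<lambda>w. w c) \<in> borel_measurable (expQ \<rho> J)"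
  by measurable

text \<open>Keeping the minimum in the third coordinate makes the step an involution that preserves the whole
  product measure, so no order of revealing the weights has to be tracked.\<close>

definition burke_step :: "'i \<Rightarrow> 'i \<Rightarrow> 'i \<Rightarrow> ('i \<Rightarrow> real) \<Rightarrow> ('i \<Rightarrow> real)" where
  "burke_step c1 c2 c3 w = w(c1 := w c3 + max 0 (w c1 - w c2),
     c2 := w c3 + max 0 (w c2 - w c1), c3 := min (w c1) (w c2))"

lemma measurable_PiM_fun_upd:
  assumes "f \<in> M \<rightarrow>\<^sub>M PiM J (\<lambda>_. borel)" "g \<in> borel_measurable M" "c \<in> J"
  shows "(\<lambda>x. (f x)(c := g x)) \<in> M \<rightarrow>\<^sub>M PiM J (\<lambda>_. borel :: real measure)"
  using assms by (intro measurable_fun_upd[where J=J]) auto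

lemma measurable_burke_step:
  assumes "c1 \<in> J" "c2 \<in> J" "c3 \<in> J"
  shows "burke_step c1 c2 c3 \<in> expQ \<rho> J \<rightarrow>\<^sub>M expQ \<rho> J"
proof -
  have [measurable]: "(\<lambda>w. w c1) \<in> borel_measurable (expQ \<rho> J)"
    "(\<lambda>w. w c2) \<in> borel_measurable (expQ \<rho> J)" "(\<lambda>w. w c3) \<in> borel_measurable (expQ \<rho> J)"
    using assms by (auto intro: measurable_expQ_component)
  have 1: "(\<lambda>w. w) \<in> expQ \<rho> J \<rightarrow>\<^sub>M PiM J (\<lambda>_. borel)"
    by measurable
  have "burke_step c1 c2 c3 \<in> expQ \<rho> J \<rightarrow>\<^sub>M PiM J (\<lambda>_. borel)"
    unfolding burke_step_def[abs_def]
    by (intro measurable_PiM_fun_upd 1 assms) measurable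
  then show ?thesis
    by (simp add: measurable_cong_sets[OF refl sets_expQ])
qed

text \<open>Fubini isolates the three coordinates that change; with all others frozen, the
  three-variable identity applies to the inner integral.\<close>

lemma expQ_burke_step:
  assumes J: "finite J" "c1 \<in> J" "c2 \<in> J" "c3 \<in> J" "c1 \<noteq> c2" "c1 \<noteq> c3" "c2 \<noteq> c3"
    and \<rho>: "0 < \<rho> c1" "0 < \<rho> c2" "\<rho> c3 = \<rho> c1 + \<rho> c2"
    and F: "F \<in> borel_measurable (expQ \<rho> J)"
  shows "(\<integral>\<^sup>+w. F (burke_step c1 c2 c3 w) \<partial>expQ \<rho> J) = (\<integral>\<^sup>+w. F w \<partial>expQ \<rho> J)"
proof -
  define K where "K = J - {c1, c2, c3}"
  have JK: "J = insert c1 (insert c2 (insert c3 K))"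
    using J by (auto simp: K_def)
  have K: "finite K" "c3 \<notin> K" "c2 \<notin> insert c3 K" "c1 \<notin> insert c2 (insert c3 K)"
    using J by (auto simp: K_def)
  have ins: "(\<integral>\<^sup>+w. H w \<partial>expQ \<rho> J) =
     (\<integral>\<^sup>+u. \<integral>\<^sup>+w. \<integral>\<^sup>+y. \<integral>\<^sup>+x. H (u(c3 := w, c2 := y, c1 := x))
       \<partial>expm (\<rho> c1) \<partial>expm (\<rho> c2) \<partial>expm (\<rho> c3) \<partial>expQ \<rho> K)"
    if H: "H \<in> borel_measurable (expQ \<rho> J)" for H
  proof -
    have H': "H \<in> borel_measurable (PiM J (\<lambda>_. borel))"
      using H by (simp add: measurable_cong_sets[OF sets_expQ refl])
    have [measurable]: "(\<lambda>x. H (f x)) \<in> borel_measurable M"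
      if "f \<in> M \<rightarrow>\<^sub>M PiM J (\<lambda>_. borel)" for f and M :: "'b measure"
      using measurable_compose[OF that H'] .
    have a: "(\<lambda>(u, x). u(c1 := x)) \<in> PiM (insert c2 (insert c3 K)) (\<lambda>_. borel) \<Otimes>\<^sub>M expm (\<rho> c1) \<rightarrow>\<^sub>M PiM J (\<lambda>_. borel)"
      unfolding JK split_beta' by measurable
    have b: "(\<lambda>(u, y). u(c2 := y)) \<in> PiM (insert c3 K) (\<lambda>_. borel) \<Otimes>\<^sub>M expm (\<rho> c2) \<rightarrow>\<^sub>M PiM (insert c2 (insert c3 K)) (\<lambda>_. borel)"
      unfolding split_beta' by measurable
    have sf [simp]: "sigma_finite_measure (expm r)" for r
      by (simp add: prob_space_expm prob_space_imp_sigma_finite)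
    define H1 where "H1 u = (\<integral>\<^sup>+x. H (u(c1 := x)) \<partial>expm (\<rho> c1))" for u
    have H1: "H1 \<in> borel_measurable (expQ \<rho> (insert c2 (insert c3 K)))"
      unfolding H1_def
      by (rule sigma_finite_measure.borel_measurable_nn_integral[OF sf])
        (use measurable_compose[OF a H'] in \<open>simp add: split_beta' measurable_cong_sets[OF sets_pair_measure_cong[OF sets_expQ refl] refl]\<close>)
    define H2 where "H2 u = (\<integral>\<^sup>+y. H1 (u(c2 := y)) \<partial>expm (\<rho> c2))" for u
    have H1': "H1 \<in> borel_measurable (PiM (insert c2 (insert c3 K)) (\<lambda>_. borel))"
      using H1 by (simp add: measurable_cong_sets[OF sets_expQ refl])
    have H2: "H2 \<in> borel_measurable (expQ \<rho> (insert c3 K))"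
      unfolding H2_def
      by (rule sigma_finite_measure.borel_measurable_nn_integral[OF sf])
        (use measurable_compose[OF b H1'] in \<open>simp add: split_beta' measurable_cong_sets[OF sets_pair_measure_cong[OF sets_expQ refl] refl]\<close>)
    have "(\<integral>\<^sup>+w. H w \<partial>expQ \<rho> J) = (\<integral>\<^sup>+w. H1 w \<partial>expQ \<rho> (insert c2 (insert c3 K)))"
      using H unfolding JK H1_def expQ_def
      by (intro expQ.product_nn_integral_insert) (use K in auto)
    also have "\<dots> = (\<integral>\<^sup>+w. H2 w \<partial>expQ \<rho> (insert c3 K))"
      using H1 unfolding H2_def expQ_def
      by (intro expQ.product_nn_integral_insert) (use K in auto)
    also have "\<dots> = (\<integral>\<^sup>+u. \<integral>\<^sup>+w. H2 (u(c3 := w)) \<partial>expm (\<rho> c3) \<partial>expQ \<rho> K)"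
      using H2 unfolding expQ_def
      by (intro expQ.product_nn_integral_insert) (use K in auto)
    finally show ?thesis unfolding H2_def H1_def .
  qed
  have Fm: "(\<lambda>w. F (burke_step c1 c2 c3 w)) \<in> borel_measurable (expQ \<rho> J)"
    using measurable_compose[OF measurable_burke_step F] J by blast
  have "(\<integral>\<^sup>+w. F (burke_step c1 c2 c3 w) \<partial>expQ \<rho> J) =
    (\<integral>\<^sup>+u. \<integral>\<^sup>+w. \<integral>\<^sup>+y. \<integral>\<^sup>+x. F (u(c3 := min x y, c2 := w + max 0 (y - x), c1 := w + max 0 (x - y)))
       \<partial>expm (\<rho> c1) \<partial>expm (\<rho> c2) \<partial>expm (\<rho> c3) \<partial>expQ \<rho> K)"
    unfolding ins[OF Fm] using J
    by (intro nn_integral_cong arg_cong[where f=F]) (auto simp: burke_step_def fun_eq_iff)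
  also have "\<dots> = (\<integral>\<^sup>+u. \<integral>\<^sup>+w. \<integral>\<^sup>+y. \<integral>\<^sup>+x. F (u(c3 := w, c2 := y, c1 := x))
       \<partial>expm (\<rho> c1) \<partial>expm (\<rho> c2) \<partial>expm (\<rho> c3) \<partial>expQ \<rho> K)"
  proof (rule nn_integral_cong)
    fix u assume "u \<in> space (expQ \<rho> K)"
    then have u: "u \<in> extensional K" by (auto simp: space_expQ PiE_def)
    have F': "F \<in> borel_measurable (PiM J (\<lambda>_. borel))"
      using F by (simp add: measurable_cong_sets[OF sets_expQ refl])
    have "(\<lambda>(x, y, w). u(c3 := w, c2 := y, c1 := x)) \<in> borel \<Otimes>\<^sub>M borel \<Otimes>\<^sub>M borel \<rightarrow>\<^sub>M PiM J (\<lambda>_. borel :: real measure)"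
      unfolding split_beta'
    proof (rule measurable_PiM_single')
      show "(\<lambda>p. (u(c3 := snd (snd p), c2 := fst (snd p), c1 := fst p)) i) \<in> borel_measurable (borel \<Otimes>\<^sub>M borel \<Otimes>\<^sub>M borel)" for i
        by (cases "i = c1"; cases "i = c2"; cases "i = c3") simp_all
      show "(\<lambda>p i. (u(c3 := snd (snd p), c2 := fst (snd p), c1 := fst p)) i) \<in>
        space (borel \<Otimes>\<^sub>M borel \<Otimes>\<^sub>M borel) \<rightarrow> J \<rightarrow>\<^sub>E space (borel :: real measure)"
        using u by (auto simp: JK PiE_def extensional_def)
    qed
    from measurable_compose[OF this F']
    have "(\<lambda>(x, y, w). F (u(c3 := w, c2 := y, c1 := x))) \<in> borel_measurable (borel \<Otimes>\<^sub>M borel \<Otimes>\<^sub>M borel)"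
      by (simp add: split_beta')
    from expm_burke[OF this \<rho>(1,2)]
    show "(\<integral>\<^sup>+w. \<integral>\<^sup>+y. \<integral>\<^sup>+x. F (u(c3 := min x y, c2 := w + max 0 (y - x), c1 := w + max 0 (x - y)))
       \<partial>expm (\<rho> c1) \<partial>expm (\<rho> c2) \<partial>expm (\<rho> c3)) =
       (\<integral>\<^sup>+w. \<integral>\<^sup>+y. \<integral>\<^sup>+x. F (u(c3 := w, c2 := y, c1 := x))
       \<partial>expm (\<rho> c1) \<partial>expm (\<rho> c2) \<partial>expm (\<rho> c3))"
      unfolding \<rho>(3) .
  qed
  also have "\<dots> = (\<integral>\<^sup>+w. F w \<partial>expQ \<rho> J)"
    by (rule ins[OF F, symmetric])
  finally show ?thesis .
qed

text \<open>Row \<open>0\<close> and column \<open>0\<close> carry the boundary weights; the corner \<open>(0, 0)\<close> carries none.\<close>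

fun blpp :: "(nat \<times> nat \<Rightarrow> real) \<Rightarrow> nat \<Rightarrow> nat \<Rightarrow> real" where
  "blpp w 0 0 = 0"
| "blpp w (Suc i) 0 = blpp w i 0 + w (Suc i, 0)"
| "blpp w 0 (Suc j) = blpp w 0 j + w (0, Suc j)"
| "blpp w (Suc i) (Suc j) = w (Suc i, Suc j) + max (blpp w i (Suc j)) (blpp w (Suc i) j)"

text \<open>Cells are reused as storage: (i, 0) holds the horizontal increment in column i at the
  height reached so far, (0, j) the vertical increment of the current column in row j. The weight of
  the bulk cell is consumed and replaced by the minimum.\<close>

fun burke_row :: "nat \<Rightarrow> nat \<Rightarrow> (nat \<times> nat \<Rightarrow> real) \<Rightarrow> (nat \<times> nat \<Rightarrow> real)" where
  "burke_row j 0 w = w"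
| "burke_row j (Suc i) w = burke_step (Suc i, 0) (0, j) (Suc i, j) (burke_row j i w)"

fun burke_sweep :: "nat \<Rightarrow> nat \<Rightarrow> (nat \<times> nat \<Rightarrow> real) \<Rightarrow> (nat \<times> nat \<Rightarrow> real)" where
  "burke_sweep m 0 w = w"
| "burke_sweep m (Suc j) w = burke_row (Suc j) m (burke_sweep m j w)"

text \<open>With horizontal and vertical increments I and J entering a cell of weight w, the
  recursion of \<open>blpp\<close> gives the outgoing increments w + max 0 (I - J) and w + max 0 (J
  - I), which is one Burke step. The last two claims record the untouched cells and keep the
  induction going.\<close>

lemma burke_row_spec:
  assumes v: "\<And>i. i < m \<Longrightarrow> v (Suc i, 0) = blpp w (Suc i) j - blpp w i j"
    "v (0, Suc j) = w (0, Suc j)" "\<And>i. v (Suc i, Suc j) = w (Suc i, Suc j)"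
  shows "i \<le> m \<Longrightarrow> k < m \<Longrightarrow> burke_row (Suc j) i v (Suc k, 0) = (if k < i then blpp w (Suc k) (Suc j) - blpp w k (Suc j)
           else blpp w (Suc k) j - blpp w k j)"
    "i \<le> m \<Longrightarrow> burke_row (Suc j) i v (0, Suc j) = blpp w i (Suc j) - blpp w i j"
    "j' \<noteq> Suc j \<Longrightarrow> burke_row (Suc j) i v (k', j') = (if j' = 0 \<and> k' > 0 then burke_row (Suc j) i v (k', 0) else v (k', j'))"
    "k \<ge> i \<Longrightarrow> burke_row (Suc j) i v (Suc k, Suc j) = w (Suc k, Suc j)"
proof (induction i arbitrary: k k' j')
  case 0
  { case 1 then show ?case using v by simp }
  { case 2 then show ?case using v by (cases j) simp_all }
  { case 3 then show ?case by simp }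
  { case 4 then show ?case using v by simp }
next
  case (Suc i)
  have "max 0 (blpp w (Suc i) j - blpp w i j - (blpp w i (Suc j) - blpp w i j)) =
     max (blpp w i (Suc j)) (blpp w (Suc i) j) - blpp w i (Suc j)"
    "max 0 (blpp w i (Suc j) - blpp w i j - (blpp w (Suc i) j - blpp w i j)) =
     max (blpp w i (Suc j)) (blpp w (Suc i) j) - blpp w (Suc i) j" by auto
  note * = this Suc.IH(1)[of i] Suc.IH(2) Suc.IH(4)[of i]
  { case 1 then show ?case using Suc.IH(1)[of k] * by (auto simp: burke_step_def) }
  { case 2 then show ?case using * by (auto simp: burke_step_def) }
  { case 3 then show ?case using Suc.IH(3)[of j' k'] by (auto simp: burke_step_def) }
  { case 4 then show ?case using Suc.IH(4) by (auto simp: burke_step_def) }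
qed

lemma burke_sweep_spec:
  "(\<forall>i<m. burke_sweep m n w (Suc i, 0) = blpp w (Suc i) n - blpp w i n) \<and>
    (\<forall>j. burke_sweep m n w (0, Suc j) = (if j < n then blpp w m (Suc j) - blpp w m j else w (0, Suc j))) \<and>
    (\<forall>j i. n \<le> j \<longrightarrow> burke_sweep m n w (Suc i, Suc j) = w (Suc i, Suc j))"
proof (induction n)
  case (Suc n)
  define v where "v = burke_sweep m n w"
  have v: "\<And>i. i < m \<Longrightarrow> v (Suc i, 0) = blpp w (Suc i) n - blpp w i n"
    "v (0, Suc n) = w (0, Suc n)" "\<And>i. v (Suc i, Suc n) = w (Suc i, Suc n)"
    using Suc by (auto simp: v_def)
  note R = burke_row_spec[of m v w n, OF v]
  have "burke_row (Suc n) m v (0, Suc j) = v (0, Suc j)" if "j \<noteq> n" for j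
    using R(3)[of "Suc j" m 0] that by simp
  moreover have "burke_row (Suc n) m v (Suc i, Suc j) = v (Suc i, Suc j)" if "j \<noteq> n" for i j
    using R(3)[of "Suc j" m "Suc i"] that by simp
  ultimately show ?case using R(1)[of m] R(2)[of m] Suc
    by (auto simp: v_def[symmetric] less_Suc_eq)
qed simp

lemma measurable_burke_row:
  assumes "{(0, j)} \<union> {1..i} \<times> {0, j} \<subseteq> J"
  shows "burke_row j i \<in> expQ \<rho> J \<rightarrow>\<^sub>M expQ \<rho> J"
  using assms
proof (induction i)
  case (Suc i)
  have "burke_row j i \<in> expQ \<rho> J \<rightarrow>\<^sub>M expQ \<rho> J" by (rule Suc.IH) (use Suc.prems in auto)
  from measurable_compose[OF this measurable_burke_step[of "(Suc i, 0)" J "(0, j)" "(Suc i, j)" \<rho>]]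
  moreover have "(Suc i, 0) \<in> J" "(0, j) \<in> J" "(Suc i, j) \<in> J"
    using Suc.prems by (auto simp: subset_eq)
  ultimately show ?case by simp
qed (simp add: measurable_ident_sets[of "expQ \<rho> J", unfolded id_def] cong: measurable_cong)

definition bd_cells :: "nat \<Rightarrow> nat \<Rightarrow> (nat \<times> nat) set" where
  "bd_cells m n = {..m} \<times> {..n} - {(0, 0)}"

definition rates :: "(nat \<Rightarrow> real) \<Rightarrow> (nat \<Rightarrow> real) \<Rightarrow> nat \<times> nat \<Rightarrow> real" where
  "rates a b = (\<lambda>(i, j). a i + b j)"

text \<open>Since a 0 + b 0 = 0, the rate a i + b j of a bulk cell is the sum of the rates a i + b 0
  and a 0 + b j of the two boundary cells that meet there. As a step leaves the law unchanged, this
  relation is available again at the next cell.\<close>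

lemma expQ_burke_row:
  assumes J: "finite J" "{(0, j)} \<union> {1..i} \<times> {0, j} \<subseteq> J" "j > 0"
    and pos: "a 0 + b 0 = 0" "\<And>k. k \<in> {1..i} \<Longrightarrow> 0 < a k + b 0" "0 < a 0 + b j"
    and F: "F \<in> borel_measurable (expQ (rates a b) J)"
  shows "(\<integral>\<^sup>+w. F (burke_row j i w) \<partial>expQ (rates a b) J) = (\<integral>\<^sup>+w. F w \<partial>expQ (rates a b) J)"
  using J pos F
proof (induction i arbitrary: F)
  case (Suc i)
  have "(\<integral>\<^sup>+w. F (burke_row j (Suc i) w) \<partial>expQ (rates a b) J) =
    (\<integral>\<^sup>+w. F (burke_step (Suc i, 0) (0, j) (Suc i, j) w) \<partial>expQ (rates a b) J)"
    unfolding burke_row.simps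
    by (rule Suc.IH[of "\<lambda>w. F (burke_step (Suc i, 0) (0, j) (Suc i, j) w)"])
       (use Suc.prems in \<open>auto intro!: measurable_compose[OF measurable_burke_step]\<close>)
  also have "\<dots> = (\<integral>\<^sup>+w. F w \<partial>expQ (rates a b) J)"
    by (rule expQ_burke_step) (use Suc.prems in \<open>auto simp: rates_def\<close>)
  finally show ?case .
qed simp

lemma expQ_burke_sweep:
  assumes J: "finite J" "{0} \<times> {1..n} \<union> {1..m} \<times> {0..n} \<subseteq> J"
    and pos: "a 0 + b 0 = 0" "\<And>k. k \<in> {1..m} \<Longrightarrow> 0 < a k + b 0" "\<And>k. k \<in> {1..n} \<Longrightarrow> 0 < a 0 + b k"
    and F: "F \<in> borel_measurable (expQ (rates a b) J)"
  shows "(\<integral>\<^sup>+w. F (burke_sweep m n w) \<partial>expQ (rates a b) J) = (\<integral>\<^sup>+w. F w \<partial>expQ (rates a b) J)"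
  using J pos F
proof (induction n arbitrary: F)
  case (Suc n)
  have "(\<integral>\<^sup>+w. F (burke_sweep m (Suc n) w) \<partial>expQ (rates a b) J) =
    (\<integral>\<^sup>+w. F (burke_row (Suc n) m w) \<partial>expQ (rates a b) J)"
    unfolding burke_sweep.simps
    by (rule Suc.IH[of "\<lambda>w. F (burke_row (Suc n) m w)"])
       (use Suc.prems in \<open>auto intro!: measurable_compose[OF measurable_burke_row]\<close>)
  also have "\<dots> = (\<integral>\<^sup>+w. F w \<partial>expQ (rates a b) J)"
    by (rule expQ_burke_row) (use Suc.prems in \<open>auto simp: rates_def\<close>)
  finally show ?case .
qed simp

lemma blpp_bottom: "blpp w m 0 = (\<Sum>i\<in>{1..m}. w (i, 0))"
  by (induction m) simp_all

lemma blpp_left: "blpp w 0 n = (\<Sum>j\<in>{1..n}. w (0, j))"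
  by (induction n) simp_all

lemma sum_burke_sweep_left:
  "(\<Sum>j\<in>{1..n}. burke_sweep m n w (0, j)) = blpp w m n - (\<Sum>i\<in>{1..m}. w (i, 0))"
proof -
  have "(\<Sum>j\<in>{1..n}. burke_sweep m n w (0, j)) = (\<Sum>j<n. burke_sweep m n w (0, Suc j))"
    using sum.atLeast1_atMost_eq[of "\<lambda>j. burke_sweep m n w (0, j)" n] by simp
  also have "\<dots> = (\<Sum>j<n. blpp w m (Suc j) - blpp w m j)"
    using burke_sweep_spec[of m n w] by (intro sum.cong) auto
  also have "\<dots> = blpp w m n - blpp w m 0"
    by (rule sum_lessThan_telescope)
  finally show ?thesis by (simp add: blpp_bottom)
qed

section \<open>Exponential moments\<close>

lemma expm_mgf:
  assumes "0 < r" "\<theta> < r"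
  shows "(\<integral>\<^sup>+x. ennreal (exp (\<theta> * x)) \<partial>expm r) = ennreal (r / (r - \<theta>))"
proof -
  have eq: "exponential_density r x * exp (\<theta> * x) = r / (r - \<theta>) * exponential_density (r - \<theta>) x" for x
  proof -
    have "exp (- x * (r - \<theta>)) = exp (- x * r) * exp (\<theta> * x)"
      unfolding exp_add[symmetric] by (simp add: algebra_simps)
    then show ?thesis using assms by (simp add: exponential_density_def)
  qed
  have "(\<integral>\<^sup>+x. ennreal (exp (\<theta> * x)) \<partial>expm r) = (\<integral>\<^sup>+x. ennreal (r / (r - \<theta>)) * ennreal (exponential_density (r - \<theta>) x) \<partial>lborel)"
    using assms by (simp add: nn_integral_expm ennreal_mult'[symmetric] ennreal_mult''[symmetric] eq)
  also have "\<dots> = ennreal (r / (r - \<theta>)) * (\<integral>\<^sup>+x. 1 \<partial>expm (r - \<theta>))"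
    using assms by (subst nn_integral_expm) (simp_all add: nn_integral_cmult)
  also have "\<dots> = ennreal (r / (r - \<theta>))"
    using prob_space.emeasure_space_1[OF prob_space_expm, of "r - \<theta>"] by simp
  finally show ?thesis .
qed

lemma AE_expm_nonneg: "AE x in expm r. 0 \<le> x"
  unfolding expm_def by (auto simp: AE_density exponential_density_def)

lemma AE_expQ_nonneg:
  assumes "finite J"
  shows "AE w in expQ \<rho> J. \<forall>c\<in>J. 0 \<le> w c"
  unfolding expQ_def
  by (intro eventually_ball_finite assms ballI AE_PiM_component prob_space_expm AE_expm_nonneg)

lemma expQ_mgf_sum:
  assumes "finite J" "K \<subseteq> J" "\<And>c. c \<in> K \<Longrightarrow> 0 < \<rho> c" "\<And>c. c \<in> K \<Longrightarrow> \<theta> < \<rho> c"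
  shows "(\<integral>\<^sup>+w. ennreal (exp (\<theta> * (\<Sum>c\<in>K. w c))) \<partial>expQ \<rho> J) = ennreal (\<Prod>c\<in>K. \<rho> c / (\<rho> c - \<theta>))"
proof -
  define f where "f c x = (if c \<in> K then ennreal (exp (\<theta> * x)) else 1)" for c x
  have *: "(\<Prod>c\<in>J. h (c :: 'a) :: ennreal) = (\<Prod>c\<in>K. h c)" if "\<And>c. c \<notin> K \<Longrightarrow> h c = 1" for h
    using assms that by (intro prod.mono_neutral_right) auto
  have "ennreal (exp (\<theta> * (\<Sum>c\<in>K. w c))) = (\<Prod>c\<in>J. f c (w c))" for w
    using assms finite_subset[OF assms(2,1)]
    by (subst *) (auto simp: f_def sum_distrib_left exp_sum prod_ennreal)
  then have "(\<integral>\<^sup>+w. ennreal (exp (\<theta> * (\<Sum>c\<in>K. w c))) \<partial>expQ \<rho> J) = (\<integral>\<^sup>+w. (\<Prod>c\<in>J. f c (w c)) \<partial>expQ \<rho> J)"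
    by simp
  also have "\<dots> = (\<Prod>c\<in>J. \<integral>\<^sup>+x. f c x \<partial>expm (\<rho> c))"
    unfolding expQ_def by (rule expQ.product_nn_integral_prod) (auto simp: assms f_def)
  also have "\<dots> = (\<Prod>c\<in>K. \<integral>\<^sup>+x. f c x \<partial>expm (\<rho> c))"
    using prob_space.emeasure_space_1[OF prob_space_expm] by (intro *) (simp add: f_def)
  also have "\<dots> = (\<Prod>c\<in>K. ennreal (\<rho> c / (\<rho> c - \<theta>)))"
    using assms by (intro prod.cong) (auto simp: f_def expm_mgf)
  also have "\<dots> = ennreal (\<Prod>c\<in>K. \<rho> c / (\<rho> c - \<theta>))"
    using assms by (intro prod_ennreal) (auto intro!: divide_nonneg_nonneg simp: less_imp_le)
  finally show ?thesis .
qed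

lemma distr_expQ_reindex:
  assumes "inj_on t K" "t ` K \<subseteq> J"
  shows "distr (expQ \<rho> J) (expQ (\<lambda>c. \<rho> (t c)) K) (\<lambda>w. \<lambda>c\<in>K. w (t c)) = expQ (\<lambda>c. \<rho> (t c)) K"
  unfolding expQ_def using assms
  by (intro distr_PiM_reindex prob_space_expm) auto

lemma measurable_expQ_reindex:
  assumes "t ` K \<subseteq> J"
  shows "(\<lambda>w. \<lambda>c\<in>K. w (t c)) \<in> expQ \<rho> J \<rightarrow>\<^sub>M expQ \<rho>' K"
  unfolding measurable_cong_sets[OF refl sets_expQ]
  by (rule measurable_restrict, rule measurable_expQ_component) (use assms in auto)

lemma nn_integral_expQ_reindex:
  assumes "inj_on t K" "t ` K \<subseteq> J" "F \<in> borel_measurable (expQ (\<lambda>c. \<rho> (t c)) K)"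
  shows "(\<integral>\<^sup>+w. F (\<lambda>c\<in>K. w (t c)) \<partial>expQ \<rho> J) = (\<integral>\<^sup>+w. F w \<partial>expQ (\<lambda>c. \<rho> (t c)) K)"
proof -
  have "(\<integral>\<^sup>+w. F w \<partial>distr (expQ \<rho> J) (expQ (\<lambda>c. \<rho> (t c)) K) (\<lambda>w. \<lambda>c\<in>K. w (t c))) =
    (\<integral>\<^sup>+w. F (\<lambda>c\<in>K. w (t c)) \<partial>expQ \<rho> J)"
    using assms(3) by (intro nn_integral_distr measurable_expQ_reindex[OF assms(2)]) simp
  then show ?thesis unfolding distr_expQ_reindex[OF assms(1,2)] by simp
qed

lemma measure_expQ_reindex:
  assumes "inj_on t K" "t ` K \<subseteq> J" "{w \<in> space (expQ (\<lambda>c. \<rho> (t c)) K). P w} \<in> sets (expQ (\<lambda>c. \<rho> (t c)) K)"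
  shows "\<P>(w in expQ \<rho> J. P (\<lambda>c\<in>K. w (t c))) =
    measure (expQ (\<lambda>c. \<rho> (t c)) K) {w \<in> space (expQ (\<lambda>c. \<rho> (t c)) K). P w}"
proof -
  have "measure (expQ (\<lambda>c. \<rho> (t c)) K) {w \<in> space (expQ (\<lambda>c. \<rho> (t c)) K). P w} =
    measure (expQ \<rho> J) ((\<lambda>w. \<lambda>c\<in>K. w (t c)) -` {w \<in> space (expQ (\<lambda>c. \<rho> (t c)) K). P w} \<inter> space (expQ \<rho> J))"
    by (subst distr_expQ_reindex[OF assms(1,2), symmetric], rule measure_distr)
      (use assms measurable_expQ_reindex in auto)
  also have "(\<lambda>w. \<lambda>c\<in>K. w (t c)) -` {w \<in> space (expQ (\<lambda>c. \<rho> (t c)) K). P w} \<inter> space (expQ \<rho> J) =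
     {w \<in> space (expQ \<rho> J). P (\<lambda>c\<in>K. w (t c))}"
    by (auto simp: space_expQ)
  finally show ?thesis by simp
qed

lemma expQ_indep:
  assumes K: "finite K1" "finite K2" "K1 \<inter> K2 = {}"
    and f: "f \<in> borel_measurable (expQ \<rho> K1)" and g: "g \<in> borel_measurable (expQ \<rho> K2)"
  shows "(\<integral>\<^sup>+w. f (restrict w K1) * g (restrict w K2) \<partial>expQ \<rho> (K1 \<union> K2)) =
    (\<integral>\<^sup>+w. f w \<partial>expQ \<rho> K1) * (\<integral>\<^sup>+w. g w \<partial>expQ \<rho> K2)"
proof -
  have [measurable]: "(\<lambda>w. f (restrict w K1)) \<in> borel_measurable (expQ \<rho> (K1 \<union> K2))"
    using measurable_compose[OF measurable_expQ_reindex[of "\<lambda>c. c" K1 "K1 \<union> K2" \<rho> \<rho>] f] by simp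
  have [measurable]: "(\<lambda>w. g (restrict w K2)) \<in> borel_measurable (expQ \<rho> (K1 \<union> K2))"
    using measurable_compose[OF measurable_expQ_reindex[of "\<lambda>c. c" K2 "K1 \<union> K2" \<rho> \<rho>] g] by simp
  have "(\<lambda>w. f (restrict w K1) * g (restrict w K2)) \<in> borel_measurable (expQ \<rho> (K1 \<union> K2))"
    by measurable
  then have "(\<integral>\<^sup>+w. f (restrict w K1) * g (restrict w K2) \<partial>expQ \<rho> (K1 \<union> K2)) =
    (\<integral>\<^sup>+x. \<integral>\<^sup>+y. f (restrict (merge K1 K2 (x, y)) K1) * g (restrict (merge K1 K2 (x, y)) K2) \<partial>expQ \<rho> K2 \<partial>expQ \<rho> K1)"
    unfolding expQ_def using K by (intro expQ.product_nn_integral_fold) auto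
  also have "\<dots> = (\<integral>\<^sup>+x. \<integral>\<^sup>+y. f x * g y \<partial>expQ \<rho> K2 \<partial>expQ \<rho> K1)"
    using K by (intro nn_integral_cong) (simp add: space_expQ PiE_def extensional_restrict)
  also have "\<dots> = (\<integral>\<^sup>+w. f w \<partial>expQ \<rho> K1) * (\<integral>\<^sup>+w. g w \<partial>expQ \<rho> K2)"
    using f g by (simp add: nn_integral_cmult nn_integral_multc)
  finally show ?thesis .
qed

text \<open>A recursion with boundary value 0 replaces the maximum over paths. The two agree for
  nonnegative weights, which is enough because weights are almost surely nonnegative.\<close>

fun lpp :: "(nat \<times> nat \<Rightarrow> real) \<Rightarrow> nat \<Rightarrow> nat \<Rightarrow> real" where
  "lpp w 0 j = 0"
| "lpp w (Suc i) 0 = 0"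
| "lpp w (Suc i) (Suc j) = w (Suc i, Suc j) + max (lpp w i (Suc j)) (lpp w (Suc i) j)"

lemma lpp_0 [simp]: "lpp w i 0 = 0" by (cases i) auto

definition cells :: "nat \<Rightarrow> nat \<Rightarrow> (nat \<times> nat) set" where
  "cells m n = {1..m} \<times> {1..n}"

lemma finite_cells [simp]: "finite (cells m n)" "finite (bd_cells m n)"
  by (simp_all add: cells_def bd_cells_def)

lemma cells_subset_bd: "cells m n \<subseteq> bd_cells m n"
  by (auto simp: cells_def bd_cells_def)

lemma lpp_cong: "(\<And>c. c \<in> cells m n \<Longrightarrow> w c = w' c) \<Longrightarrow> lpp w m n = lpp w' m n"
proof (induction w m n rule: lpp.induct)
  case (3 w i j)
  then have "lpp w i (Suc j) = lpp w' i (Suc j)" "lpp w (Suc i) j = lpp w' (Suc i) j"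
    by (auto simp: cells_def)
  then show ?case using 3(3) by (simp add: cells_def)
qed auto

lemma measurable_lpp:
  "(\<And>c. c \<in> cells m n \<Longrightarrow> (\<lambda>x. w x c) \<in> borel_measurable M) \<Longrightarrow> (\<lambda>x. lpp (w x) m n) \<in> borel_measurable M"
proof (induction m arbitrary: n)
  case (Suc m)
  note IHm = Suc.IH
  show ?case using Suc.prems
  proof (induction n)
    case (Suc n)
    have "(\<lambda>x. lpp (w x) m (Suc n)) \<in> borel_measurable M" "(\<lambda>x. lpp (w x) (Suc m) n) \<in> borel_measurable M"
      "(\<lambda>x. w x (Suc m, Suc n)) \<in> borel_measurable M"
      using Suc IHm[of "Suc n"] by (auto simp: cells_def)
    then show ?case by simp
  qed simp
qed simp

lemma measurable_blpp:
  "(\<And>c. c \<in> bd_cells m n \<Longrightarrow> (\<lambda>x. w x c) \<in> borel_measurable M) \<Longrightarrow> (\<lambda>x. blpp (w x) m n) \<in> borel_measurable M"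
proof (induction m arbitrary: n)
  case 0
  then show ?case
  proof (induction n)
    case (Suc n)
    have "(\<lambda>x. blpp (w x) 0 n) \<in> borel_measurable M" "(\<lambda>x. w x (0, Suc n)) \<in> borel_measurable M"
      using Suc by (auto simp: bd_cells_def)
    then show ?case by simp
  qed simp
next
  case (Suc m)
  note IHm = Suc.IH
  show ?case using Suc.prems
  proof (induction n)
    case 0
    have "(\<lambda>x. blpp (w x) m 0) \<in> borel_measurable M" "(\<lambda>x. w x (Suc m, 0)) \<in> borel_measurable M"
      using 0 IHm[of 0] by (auto simp: bd_cells_def)
    then show ?case by simp
  next
    case (Suc n)
    have "(\<lambda>x. blpp (w x) m (Suc n)) \<in> borel_measurable M" "(\<lambda>x. blpp (w x) (Suc m) n) \<in> borel_measurable M"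
      "(\<lambda>x. w x (Suc m, Suc n)) \<in> borel_measurable M"
      using Suc IHm[of "Suc n"] by (auto simp: bd_cells_def)
    then show ?case by simp
  qed
qed

lemma lpp_nonneg: "(\<And>c. c \<in> cells m n \<Longrightarrow> 0 \<le> w c) \<Longrightarrow> 0 \<le> lpp w m n"
proof (induction w m n rule: lpp.induct)
  case (3 w i j)
  have "0 \<le> lpp w i (Suc j)" "0 \<le> w (Suc i, Suc j)"
    using 3 by (auto simp: cells_def)
  then show ?case by simp
qed auto

lemma blpp_nonneg: "(\<And>c. c \<in> bd_cells m n \<Longrightarrow> 0 \<le> w c) \<Longrightarrow> 0 \<le> blpp w m n"
proof (induction w m n rule: blpp.induct)
  case (4 w i j)
  have "0 \<le> blpp w i (Suc j)" "0 \<le> w (Suc i, Suc j)"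
    using 4 by (auto simp: bd_cells_def)
  then show ?case by simp
next
  case (2 w i)
  have "0 \<le> blpp w i 0" "0 \<le> w (Suc i, 0)" using 2 by (auto simp: bd_cells_def)
  then show ?case by simp
next
  case (3 w j)
  have "0 \<le> blpp w 0 j" "0 \<le> w (0, Suc j)" using 3 by (auto simp: bd_cells_def)
  then show ?case by simp
qed simp

lemma lpp_le_blpp: "(\<And>c. c \<in> bd_cells m n \<Longrightarrow> 0 \<le> w c) \<Longrightarrow> lpp w m n \<le> blpp w m n"
proof (induction w m n rule: lpp.induct)
  case (3 w i j)
  have "lpp w i (Suc j) \<le> blpp w i (Suc j)" "lpp w (Suc i) j \<le> blpp w (Suc i) j"
    using 3 by (auto simp: bd_cells_def)
  then show ?case by auto
next
  case (2 w i)
  then show ?case using blpp_nonneg[of "Suc i" 0 w] by simp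
qed (simp add: blpp_nonneg)

lemma measurable_lpp_expQ: "cells m n \<subseteq> J \<Longrightarrow> (\<lambda>w. lpp w m n) \<in> borel_measurable (expQ \<rho> J)"
  by (intro measurable_lpp measurable_expQ_component) auto

lemma measurable_blpp_expQ: "bd_cells m n \<subseteq> J \<Longrightarrow> (\<lambda>w. blpp w m n) \<in> borel_measurable (expQ \<rho> J)"
  by (intro measurable_blpp measurable_expQ_component) auto

lemma measurable_sum_expQ: "K \<subseteq> J \<Longrightarrow> (\<lambda>w. \<Sum>c\<in>K. w c) \<in> borel_measurable (expQ \<rho> J)"
  by (intro borel_measurable_sum measurable_expQ_component) auto

section \<open>Stationary increments and the exponential moment of the bulk\<close>

lemma sum_bottom: "(\<Sum>c\<in>{1..m} \<times> {0}. f c) = (\<Sum>i\<in>{1..m}. f (i, 0))"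
  and sum_left: "(\<Sum>c\<in>{0} \<times> {1..n}. f c) = (\<Sum>j\<in>{1..n}. f (0, j))"
  for f :: "nat \<times> nat \<Rightarrow> 'a :: comm_monoid_add"
proof -
  have "(\<Sum>i\<in>{1..m}. f (i, 0)) = sum f ((\<lambda>i. (i, 0)) ` {1..m})"
    by (subst sum.reindex) (auto simp: inj_on_def)
  also have "(\<lambda>i. (i, 0 :: nat)) ` {1..m} = {1..m} \<times> {0}" by auto
  finally show "(\<Sum>c\<in>{1..m} \<times> {0}. f c) = (\<Sum>i\<in>{1..m}. f (i, 0))" ..
  have "(\<Sum>j\<in>{1..n}. f (0, j)) = sum f (Pair 0 ` {1..n})"
    by (subst sum.reindex) (auto simp: inj_on_def)
  also have "Pair (0 :: nat) ` {1..n} = {0} \<times> {1..n}" by auto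
  finally show "(\<Sum>c\<in>{0} \<times> {1..n}. f c) = (\<Sum>j\<in>{1..n}. f (0, j))" ..
qed

text \<open>After the sweep the left cells hold the increments along the right side, whose sum
  telescopes to the left-hand argument; invariance of the law under the sweep does the rest.\<close>

lemma stationary_right:
  assumes pos: "a 0 + b 0 = 0" "\<And>k. k \<in> {1..m} \<Longrightarrow> 0 < a k + b 0" "\<And>k. k \<in> {1..n} \<Longrightarrow> 0 < a 0 + b k"
    and F: "F \<in> borel_measurable borel"
  shows "(\<integral>\<^sup>+w. F (blpp w m n - (\<Sum>i\<in>{1..m}. w (i, 0))) \<partial>expQ (rates a b) (bd_cells m n)) =
    (\<integral>\<^sup>+w. F (\<Sum>c\<in>{0} \<times> {1..n}. w c) \<partial>expQ (rates a b) (bd_cells m n))"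
proof -
  have "(\<integral>\<^sup>+w. F (\<Sum>c\<in>{0} \<times> {1..n}. burke_sweep m n w c) \<partial>expQ (rates a b) (bd_cells m n)) =
    (\<integral>\<^sup>+w. F (\<Sum>c\<in>{0} \<times> {1..n}. w c) \<partial>expQ (rates a b) (bd_cells m n))"
    by (rule expQ_burke_sweep)
       (use pos in \<open>auto simp: bd_cells_def intro!: measurable_compose[OF _ F] measurable_sum_expQ\<close>)
  then show ?thesis unfolding sum_left sum_burke_sweep_left by simp
qed

text \<open>With boundary parameter u, the bulk value minus the bottom row is at most the total
  increment along the right side, which has the law of the left column. On the left-hand side of
  this comparison the expectation factors, because the bottom row and the bulk use disjoint
  cells.\<close>

lemma lpp_mgf:
  assumes \<theta>: "0 \<le> \<theta>"
    and a: "\<And>i. i \<in> {1..m} \<Longrightarrow> 0 < a i + u" and b: "\<And>j. j \<in> {1..n} \<Longrightarrow> 0 < b j - u - \<theta>"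
  shows "(\<integral>\<^sup>+w. ennreal (exp (\<theta> * lpp w m n)) \<partial>expQ (rates a b) (cells m n)) \<le>
    ennreal (exp (\<theta> * ((\<Sum>i\<in>{1..m}. 1 / (a i + u)) + (\<Sum>j\<in>{1..n}. 1 / (b j - u - \<theta>)))))"
proof -
  \<comment> \<open>Index 0 carries the boundary parameters -u and u; bulk cells have indices from 1
    on, so their rates do not change.\<close>
  define a' where "a' = a(0 := - u)"
  define b' where "b' = b(0 := u)"
  let ?R = "rates a' b'"
  let ?B = "{1..m} \<times> {0 :: nat}"
  let ?L = "{0 :: nat} \<times> {1..n}"
  let ?J = "bd_cells m n"
  define I where "I = (\<integral>\<^sup>+w. ennreal (exp (\<theta> * lpp w m n)) \<partial>expQ ?R (cells m n))"
  have I: "(\<integral>\<^sup>+w. ennreal (exp (\<theta> * lpp w m n)) \<partial>expQ (rates a b) (cells m n)) = I"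
    unfolding I_def expQ_def
    by (intro arg_cong2[where f="nn_integral"] PiM_cong refl) (auto simp: rates_def a'_def b'_def cells_def)
  have l1: "lpp (restrict w (cells m n)) m n = lpp w m n" for w
    by (rule lpp_cong) simp
  have ind: "(\<integral>\<^sup>+w. ennreal (exp (- \<theta> * (\<Sum>c\<in>?B. w c))) * ennreal (exp (\<theta> * lpp w m n)) \<partial>expQ ?R (?B \<union> cells m n)) =
    (\<integral>\<^sup>+w. ennreal (exp (- \<theta> * (\<Sum>c\<in>?B. w c))) \<partial>expQ ?R ?B) * I"
  proof -
    have "?B \<inter> cells m n = {}" by (auto simp: cells_def)
    then show ?thesis
      using expQ_indep[of ?B "cells m n" "\<lambda>w. ennreal (exp (- \<theta> * (\<Sum>c\<in>?B. w c)))" ?R "\<lambda>w. ennreal (exp (\<theta> * lpp w m n))"]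
        measurable_sum_expQ[of ?B ?B ?R] measurable_lpp_expQ[of m n "cells m n" ?R]
      unfolding I_def by (simp add: l1)
  qed
  have mB: "(\<lambda>w. \<Sum>c\<in>?B. w c) \<in> borel_measurable (expQ (?R) (?B \<union> cells m n))"
    by (rule measurable_sum_expQ) auto
  have mL: "(\<lambda>w. lpp w m n) \<in> borel_measurable (expQ (?R) (?B \<union> cells m n))"
    by (rule measurable_lpp_expQ) auto
  have "(\<integral>\<^sup>+w. ennreal (exp (- \<theta> * (\<Sum>c\<in>?B. w c))) \<partial>expQ ?R ?B) * I =
     (\<integral>\<^sup>+w. ennreal (exp (- \<theta> * (\<Sum>c\<in>?B. w c))) * ennreal (exp (\<theta> * lpp w m n)) \<partial>expQ ?R ?J)"
  proof -
    have 1: "(\<integral>\<^sup>+w. ennreal (exp (- \<theta> * (\<Sum>c\<in>?B. (restrict w (?B \<union> cells m n)) c))) *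
         ennreal (exp (\<theta> * lpp (restrict w (?B \<union> cells m n)) m n)) \<partial>expQ ?R ?J) =
       (\<integral>\<^sup>+w. ennreal (exp (- \<theta> * (\<Sum>c\<in>?B. w c))) * ennreal (exp (\<theta> * lpp w m n)) \<partial>expQ ?R (?B \<union> cells m n))"
      by (rule nn_integral_expQ_reindex) (use mB mL in \<open>auto simp: cells_def bd_cells_def\<close>)
    have 2: "(\<Sum>c\<in>?B. (restrict w (?B \<union> cells m n)) c) = (\<Sum>c\<in>?B. w c)"
      "lpp (restrict w (?B \<union> cells m n)) m n = lpp w m n" for w
      by (auto intro!: sum.cong lpp_cong)
    from 1 show ?thesis unfolding 2 ind by simp
  qed
  also have "\<dots> \<le> (\<integral>\<^sup>+w. ennreal (exp (\<theta> * (blpp w m n - (\<Sum>i\<in>{1..m}. w (i, 0))))) \<partial>expQ ?R ?J)"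
  proof (rule nn_integral_mono_AE)
    show "AE w in expQ ?R ?J. ennreal (exp (- \<theta> * (\<Sum>c\<in>?B. w c))) * ennreal (exp (\<theta> * lpp w m n)) \<le>
      ennreal (exp (\<theta> * (blpp w m n - (\<Sum>i\<in>{1..m}. w (i, 0)))))"
      using AE_expQ_nonneg[OF finite_cells(2)]
    proof eventually_elim
      case (elim w)
      have "lpp w m n \<le> blpp w m n" by (rule lpp_le_blpp) (use elim in auto)
      then have "- \<theta> * (\<Sum>c\<in>?B. w c) + \<theta> * lpp w m n \<le> \<theta> * (blpp w m n - (\<Sum>i\<in>{1..m}. w (i, 0)))"
        unfolding sum_bottom using \<theta> by (simp add: mult_left_mono right_diff_distrib)
      then show ?case by (simp add: ennreal_mult''[symmetric] exp_add[symmetric])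
    qed
  qed
  also have "\<dots> = (\<integral>\<^sup>+w. ennreal (exp (\<theta> * (\<Sum>c\<in>?L. w c))) \<partial>expQ ?R ?J)"
  proof (rule stationary_right)
    show "0 < a' 0 + b' k" if "k \<in> {1..n}" for k
      using b[OF that] \<theta> that by (simp add: a'_def b'_def)
  qed (use a in \<open>auto simp: a'_def b'_def\<close>)
  also have "\<dots> = ennreal (\<Prod>c\<in>?L. ?R c / (?R c - \<theta>))"
    by (rule expQ_mgf_sum) (use b \<theta> in \<open>force simp: bd_cells_def rates_def a'_def b'_def\<close>)+
  also have "(\<integral>\<^sup>+w. ennreal (exp (- \<theta> * (\<Sum>c\<in>?B. w c))) \<partial>expQ ?R ?B) = ennreal (\<Prod>c\<in>?B. ?R c / (?R c - - \<theta>))"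
    by (rule expQ_mgf_sum) (use a \<theta> in \<open>force simp: bd_cells_def rates_def a'_def b'_def\<close>)+
  finally have main: "ennreal (\<Prod>c\<in>?B. ?R c / (?R c + \<theta>)) * I \<le> ennreal (\<Prod>c\<in>?L. ?R c / (?R c - \<theta>))"
    by simp
  have RB: "?R c > 0" if "c \<in> ?B" for c using a that by (auto simp: rates_def a'_def b'_def)
  have RL: "?R c - \<theta> > 0" if "c \<in> ?L" for c using b that by (auto simp: rates_def a'_def b'_def)
  \<comment> \<open>\<open>I\<close> is an extended number not yet known to be finite, so dividing
    by the bottom factor is written as multiplying by the reciprocal product.\<close>
  have "I = ennreal (\<Prod>c\<in>?B. (?R c + \<theta>) / ?R c) * (ennreal (\<Prod>c\<in>?B. ?R c / (?R c + \<theta>)) * I)"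
  proof -
    have "(\<Prod>c\<in>?B. (?R c + \<theta>) / ?R c) * (\<Prod>c\<in>?B. ?R c / (?R c + \<theta>)) = 1"
      using RB \<theta> by (subst prod.distrib[symmetric], intro prod.neutral) (force simp: divide_simps)
    moreover have "0 \<le> (\<Prod>c\<in>?B. (?R c + \<theta>) / ?R c)"
      using RB \<theta> by (intro prod_nonneg) (force simp: add_nonneg_nonneg less_imp_le)
    ultimately show ?thesis by (simp add: mult.assoc[symmetric] ennreal_mult'[symmetric])
  qed
  also have "\<dots> \<le> ennreal (\<Prod>c\<in>?B. (?R c + \<theta>) / ?R c) * ennreal (\<Prod>c\<in>?L. ?R c / (?R c - \<theta>))"
    by (rule mult_left_mono[OF main]) simp
  also have "\<dots> = ennreal ((\<Prod>c\<in>?B. (?R c + \<theta>) / ?R c) * (\<Prod>c\<in>?L. ?R c / (?R c - \<theta>)))"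
    using RB \<theta> by (intro ennreal_mult'[symmetric] prod_nonneg) (force simp: add_nonneg_nonneg less_imp_le)
  also have "\<dots> \<le> ennreal (exp (\<Sum>c\<in>?B. \<theta> / ?R c) * exp (\<Sum>c\<in>?L. \<theta> / (?R c - \<theta>)))"
  proof (intro ennreal_leI mult_mono)
    \<comment> \<open>One inequality, 1 + s \<le> exp s, bounds both products: s = \<theta> / x for
      a bottom cell of rate x, and s = \<theta> / (x - \<theta>) for a left cell.\<close>
    have 1: "x / y \<le> exp ((x - y) / y)" if "0 < y" for x y :: real
      using exp_ge_add_one_self[of "(x - y) / y"] that by (simp add: diff_divide_distrib)
    show "(\<Prod>c\<in>?B. (?R c + \<theta>) / ?R c) \<le> exp (\<Sum>c\<in>?B. \<theta> / ?R c)"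
      unfolding exp_sum[OF finite_cartesian_product[OF finite_atLeastAtMost finite.intros(2)[OF finite.intros(1)]]]
      using RB \<theta> 1[of "?R c" "?R c + \<theta>" for c] by (intro prod_mono) (force simp: add_nonneg_nonneg less_imp_le)
    show "(\<Prod>c\<in>?L. ?R c / (?R c - \<theta>)) \<le> exp (\<Sum>c\<in>?L. \<theta> / (?R c - \<theta>))"
      unfolding exp_sum[OF finite_cartesian_product[OF finite.intros(2)[OF finite.intros(1)] finite_atLeastAtMost]]
      using RL \<theta> 1[of "?R c - \<theta>" "?R c" for c] by (intro prod_mono) (force simp: less_imp_le intro!: divide_nonneg_nonneg)
    show "0 \<le> (\<Prod>c\<in>?L. ?R c / (?R c - \<theta>))"
      using RL \<theta> by (intro prod_nonneg) (force intro!: divide_nonneg_nonneg)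
  qed simp
  also have "exp (\<Sum>c\<in>?B. \<theta> / ?R c) * exp (\<Sum>c\<in>?L. \<theta> / (?R c - \<theta>)) =
    exp (\<theta> * ((\<Sum>i\<in>{1..m}. 1 / (a i + u)) + (\<Sum>j\<in>{1..n}. 1 / (b j - u - \<theta>))))"
  proof -
    have "(\<Sum>c\<in>?B. \<theta> / ?R c) = \<theta> * (\<Sum>i\<in>{1..m}. 1 / (a i + u))"
      unfolding sum_bottom sum_distrib_left by (intro sum.cong) (auto simp: rates_def a'_def b'_def)
    moreover have "(\<Sum>c\<in>?L. \<theta> / (?R c - \<theta>)) = \<theta> * (\<Sum>j\<in>{1..n}. 1 / (b j - u - \<theta>))"
      unfolding sum_left sum_distrib_left by (intro sum.cong) (auto simp: rates_def a'_def b'_def)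
    ultimately show ?thesis by (simp add: exp_add distrib_left)
  qed
  finally show ?thesis unfolding I .
qed

section \<open>Tail bounds and exit points\<close>

lemma chernoff_bound:
  assumes "prob_space M" and [measurable]: "X \<in> borel_measurable M"
    and le: "(\<integral>\<^sup>+x. ennreal (exp (X x)) \<partial>M) \<le> ennreal (exp B)"
  shows "\<P>(x in M. s \<le> X x) \<le> exp (B - s)"
proof -
  interpret prob_space M by fact
  have "ennreal (exp s) * emeasure M {x \<in> space M. s \<le> X x} =
      (\<integral>\<^sup>+x. ennreal (exp s) * indicator {x \<in> space M. s \<le> X x} x \<partial>M)"
    by (subst nn_integral_cmult_indicator) auto
  also have "\<dots> \<le> (\<integral>\<^sup>+x. ennreal (exp (X x)) \<partial>M)"
    by (intro nn_integral_mono) (auto simp: indicator_def)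
  also note le
  finally have "ennreal (exp s * \<P>(x in M. s \<le> X x)) \<le> ennreal (exp B)"
    by (simp add: emeasure_eq_measure ennreal_mult)
  then show ?thesis by (simp add: exp_diff field_simps)
qed

lemma lpp_upper_tail:
  assumes \<theta>: "0 \<le> \<theta>"
    and a: "\<And>i. i \<in> {1..m} \<Longrightarrow> 0 < a i + u" and b: "\<And>j. j \<in> {1..n} \<Longrightarrow> 0 < b j - u - \<theta>"
  shows "\<P>(w in expQ (rates a b) (cells m n). s \<le> lpp w m n)
    \<le> exp (\<theta> * ((\<Sum>i\<in>{1..m}. 1 / (a i + u)) + (\<Sum>j\<in>{1..n}. 1 / (b j - u - \<theta>)) - s))"
proof -
  let ?Q = "expQ (rates a b) (cells m n)"
  interpret prob_space ?Q by (rule prob_space_expQ)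
  have [measurable]: "(\<lambda>w. lpp w m n) \<in> borel_measurable ?Q"
    by (rule measurable_lpp_expQ) simp
  have "prob {w \<in> space ?Q. s \<le> lpp w m n} \<le> prob {w \<in> space ?Q. \<theta> * s \<le> \<theta> * lpp w m n}"
    using \<theta> by (intro finite_measure_mono) (auto simp: mult_left_mono)
  also have "\<dots> \<le> exp (\<theta> * ((\<Sum>i\<in>{1..m}. 1 / (a i + u)) + (\<Sum>j\<in>{1..n}. 1 / (b j - u - \<theta>))) - \<theta> * s)"
    by (rule chernoff_bound[OF prob_space_axioms]) (use lpp_mgf[of \<theta> m a u n b] assms in auto)
  finally show ?thesis by (simp add: right_diff_distrib)
qed

lemma inverse_one_minus_le_exp:
  fixes s :: real
  assumes "\<bar>s\<bar> \<le> 1 / 2"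
  shows "1 / (1 - s) \<le> exp (s + 2 * s\<^sup>2)"
proof -
  have "\<bar>ln (1 + - s) - - s\<bar> \<le> 2 * (- s)\<^sup>2"
    using assms by (intro abs_ln_one_plus_x_minus_x_bound) auto
  then have "- (s + 2 * s\<^sup>2) \<le> ln (1 - s)" by (simp add: abs_le_iff)
  then have "exp (- (s + 2 * s\<^sup>2)) \<le> 1 - s"
    using assms by (subst (asm) ln_ge_iff) auto
  moreover have "0 < 1 - s" using assms by linarith
  ultimately show ?thesis
    by (simp only: exp_minus) (metis exp_gt_zero inverse_eq_divide inverse_inverse_eq le_imp_inverse_le
        positive_imp_inverse_positive)
qed

lemma expQ_sum_mgf_bound:
  assumes J: "finite J" "K \<subseteq> J" and r: "0 < r" "\<And>c. c \<in> K \<Longrightarrow> r \<le> \<rho> c"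
    and \<theta>: "\<bar>\<theta>\<bar> \<le> r / 2" and N: "real (card K) \<le> N"
  shows "(\<integral>\<^sup>+w. ennreal (exp (\<theta> * (\<Sum>c\<in>K. w c))) \<partial>expQ \<rho> J) \<le>
    ennreal (exp (\<theta> * (\<Sum>c\<in>K. 1 / \<rho> c) + 2 * \<theta>\<^sup>2 * N / r\<^sup>2))"
proof -
  have K: "finite K" using J finite_subset by blast
  have pos: "0 < \<rho> c" "\<theta> < \<rho> c" if "c \<in> K" for c
    using r(1) r(2)[OF that] \<theta> by auto
  have "(\<integral>\<^sup>+w. ennreal (exp (\<theta> * (\<Sum>c\<in>K. w c))) \<partial>expQ \<rho> J) = ennreal (\<Prod>c\<in>K. \<rho> c / (\<rho> c - \<theta>))"
    using J pos by (rule expQ_mgf_sum)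
  also have "\<dots> \<le> ennreal (\<Prod>c\<in>K. exp (\<theta> * (1 / \<rho> c) + 2 * \<theta>\<^sup>2 / r\<^sup>2))"
  proof (intro ennreal_leI prod_mono conjI)
    fix c assume c: "c \<in> K"
    note p = pos[OF c]
    show "0 \<le> \<rho> c / (\<rho> c - \<theta>)" using p by simp
    have s: "\<bar>\<theta> / \<rho> c\<bar> \<le> 1 / 2"
      using \<theta> r(2)[OF c] p by (simp add: abs_divide field_simps)
    have "\<rho> c / (\<rho> c - \<theta>) = 1 / (1 - \<theta> / \<rho> c)"
      using p by (simp add: field_simps)
    also have "\<dots> \<le> exp (\<theta> / \<rho> c + 2 * (\<theta> / \<rho> c)\<^sup>2)"
      by (rule inverse_one_minus_le_exp[OF s])
    also have "\<dots> \<le> exp (\<theta> * (1 / \<rho> c) + 2 * \<theta>\<^sup>2 / r\<^sup>2)"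
    proof -
      have "r\<^sup>2 \<le> (\<rho> c)\<^sup>2" using r(1) r(2)[OF c] by (intro power_mono) auto
      then have "\<theta>\<^sup>2 / (\<rho> c)\<^sup>2 \<le> \<theta>\<^sup>2 / r\<^sup>2" using r(1) by (intro divide_left_mono) (use p in auto)
      then show ?thesis by (simp add: power_divide)
    qed
    finally show "\<rho> c / (\<rho> c - \<theta>) \<le> exp (\<theta> * (1 / \<rho> c) + 2 * \<theta>\<^sup>2 / r\<^sup>2)" .
  qed
  also have "(\<Prod>c\<in>K. exp (\<theta> * (1 / \<rho> c) + 2 * \<theta>\<^sup>2 / r\<^sup>2)) = exp (\<theta> * (\<Sum>c\<in>K. 1 / \<rho> c) + real (card K) * (2 * \<theta>\<^sup>2 / r\<^sup>2))"
    using K by (simp add: exp_sum[symmetric] sum.distrib sum_distrib_left)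
  also have "ennreal \<dots> \<le> ennreal (exp (\<theta> * (\<Sum>c\<in>K. 1 / \<rho> c) + 2 * \<theta>\<^sup>2 * N / r\<^sup>2))"
  proof -
    have "real (card K) * (2 * \<theta>\<^sup>2 / r\<^sup>2) \<le> N * (2 * \<theta>\<^sup>2 / r\<^sup>2)"
      using N by (intro mult_right_mono) auto
    then show ?thesis by (intro ennreal_leI) (simp add: mult_ac)
  qed
  finally show ?thesis .
qed

text \<open>The exponent 2 \<theta>^2 N / r^2 - \<theta> e N is minimal at \<theta> = e r^2 / 4; the
  moment bound needs \<theta> at most r / 2. For the smaller of the two the quadratic term eats at
  most half of \<theta> e N, and this is the remaining rate.\<close>

definition tail_rate :: "real \<Rightarrow> real \<Rightarrow> real" where
  "tail_rate r e = min (r / 2) (e * r\<^sup>2 / 4) * e / 2"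

lemma tail_rate_pos: "0 < r \<Longrightarrow> 0 < e \<Longrightarrow> 0 < tail_rate r e"
  by (simp add: tail_rate_def min_def)

lemma tail_rate_exponent:
  fixes r e N :: real
  assumes "0 < r" "0 < e" "0 \<le> N"
  defines "\<theta> \<equiv> min (r / 2) (e * r\<^sup>2 / 4)"
  shows "2 * \<theta>\<^sup>2 * N / r\<^sup>2 - \<theta> * (e * N) \<le> - tail_rate r e * N"
proof -
  have \<theta>: "0 \<le> \<theta>" "\<theta> \<le> e * r\<^sup>2 / 4" using assms by (auto simp: \<theta>_def)
  have "2 * \<theta>\<^sup>2 * N / r\<^sup>2 = (\<theta> * N) * (2 * \<theta> / r\<^sup>2)"
    by (simp add: power2_eq_square)
  also have "\<dots> \<le> (\<theta> * N) * (e / 2)"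
    using \<theta> assms by (intro mult_left_mono) (auto simp: field_simps)
  finally show ?thesis by (simp add: tail_rate_def \<theta>_def algebra_simps)
qed

lemma expQ_sum_upper_tail:
  assumes J: "finite J" "K \<subseteq> J" and r: "0 < r" "\<And>c. c \<in> K \<Longrightarrow> r \<le> \<rho> c"
    and e: "0 < e" and N: "real (card K) \<le> N"
  shows "\<P>(w in expQ \<rho> J. (\<Sum>c\<in>K. 1 / \<rho> c) + e * N \<le> (\<Sum>c\<in>K. w c))
      \<le> exp (- tail_rate r e * N)"
proof -
  interpret prob_space "expQ \<rho> J" by (rule prob_space_expQ)
  have m[measurable]: "(\<lambda>w. \<Sum>c\<in>K. w c) \<in> borel_measurable (expQ \<rho> J)"
    by (rule measurable_sum_expQ) fact
  define \<theta> where "\<theta> = min (r / 2) (e * r\<^sup>2 / 4)"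
  have \<theta>: "0 < \<theta>" "\<theta> \<le> r / 2" using r e by (auto simp: \<theta>_def)
  have N0: "0 \<le> N" using N by linarith
  note te = tail_rate_exponent[OF r(1) e N0, folded \<theta>_def]
  let ?S = "\<Sum>c\<in>K. 1 / \<rho> c"
  have eq: "{w \<in> space (expQ \<rho> J). ?S + e * N \<le> (\<Sum>c\<in>K. w c)} =
     {w \<in> space (expQ \<rho> J). \<theta> * (?S + e * N) \<le> \<theta> * (\<Sum>c\<in>K. w c)}"
    using \<theta> by (simp add: mult_le_cancel_left_pos)
  have "prob {w \<in> space (expQ \<rho> J). \<theta> * (?S + e * N) \<le> \<theta> * (\<Sum>c\<in>K. w c)} \<le>
    exp (\<theta> * ?S + 2 * \<theta>\<^sup>2 * N / r\<^sup>2 - \<theta> * (?S + e * N))"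
    by (rule chernoff_bound[OF prob_space_axioms])
       (use expQ_sum_mgf_bound[OF J r, where \<theta>=\<theta>] \<theta> N in auto)
  also have "\<dots> \<le> exp (- tail_rate r e * N)"
    using te by (simp add: algebra_simps)
  finally show ?thesis unfolding eq .
qed

text \<open>The rates of a single row need not be bounded away from \<open>0\<close>, hence the comparison with the larger
  rates \<open>\<rho>'\<close>.\<close>

lemma expQ_sum_lower_tail_dominated:
  assumes J: "finite J" "K \<subseteq> J" and r: "0 < r" "\<And>c. c \<in> K \<Longrightarrow> r \<le> \<rho>' c"
    and \<rho>: "\<And>c. c \<in> K \<Longrightarrow> 0 < \<rho> c" "\<And>c. c \<in> K \<Longrightarrow> \<rho> c \<le> \<rho>' c"
    and e: "0 < e" and N: "real (card K) \<le> N"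
  shows "\<P>(w in expQ \<rho> J. (\<Sum>c\<in>K. w c) \<le> (\<Sum>c\<in>K. 1 / \<rho>' c) - e * N)
      \<le> exp (- tail_rate r e * N)"
proof -
  interpret prob_space "expQ \<rho> J" by (rule prob_space_expQ)
  have m[measurable]: "(\<lambda>w. \<Sum>c\<in>K. w c) \<in> borel_measurable (expQ \<rho> J)"
    by (rule measurable_sum_expQ) fact
  define \<theta> where "\<theta> = min (r / 2) (e * r\<^sup>2 / 4)"
  have \<theta>: "0 < \<theta>" "\<theta> \<le> r / 2" using r e by (auto simp: \<theta>_def)
  have N0: "0 \<le> N" using N by linarith
  note te = tail_rate_exponent[OF r(1) e N0, folded \<theta>_def]
  let ?S = "\<Sum>c\<in>K. 1 / \<rho>' c"
  have "(\<integral>\<^sup>+w. ennreal (exp (- \<theta> * (\<Sum>c\<in>K. w c))) \<partial>expQ \<rho> J) = ennreal (\<Prod>c\<in>K. \<rho> c / (\<rho> c - - \<theta>))"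
    by (rule expQ_mgf_sum[OF J]) (use \<rho> \<theta> in \<open>auto intro: less_trans[of _ 0]\<close>)
  \<comment> \<open>The Laplace transform \<rho> / (\<rho> + \<theta>) increases with the rate:
    slower weights are only larger, so the lower tail of the faster ones is an upper bound.\<close>
  also have "\<dots> \<le> ennreal (\<Prod>c\<in>K. \<rho>' c / (\<rho>' c - - \<theta>))"
  proof (intro ennreal_leI prod_mono conjI)
    fix c assume c: "c \<in> K"
    show "0 \<le> \<rho> c / (\<rho> c - - \<theta>)" using \<rho>(1)[OF c] \<theta> by simp
    have "\<rho> c * \<theta> \<le> \<rho>' c * \<theta>" using \<rho>[OF c] \<theta> by simp
    then show "\<rho> c / (\<rho> c - - \<theta>) \<le> \<rho>' c / (\<rho>' c - - \<theta>)"
      using \<rho>[OF c] \<theta> by (simp add: divide_simps algebra_simps)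
  qed
  also have "\<dots> = (\<integral>\<^sup>+w. ennreal (exp (- \<theta> * (\<Sum>c\<in>K. w c))) \<partial>expQ \<rho>' J)"
    by (rule expQ_mgf_sum[OF J, symmetric]) (use r \<theta> in \<open>force+\<close>)
  also have "\<dots> \<le> ennreal (exp (- \<theta> * ?S + 2 * (- \<theta>)\<^sup>2 * N / r\<^sup>2))"
    by (rule expQ_sum_mgf_bound[OF J r]) (use \<theta> N in auto)
  finally have mgf: "(\<integral>\<^sup>+w. ennreal (exp (- \<theta> * (\<Sum>c\<in>K. w c))) \<partial>expQ \<rho> J) \<le> ennreal (exp (- \<theta> * ?S + 2 * (- \<theta>)\<^sup>2 * N / r\<^sup>2))" .
  have eq: "{w \<in> space (expQ \<rho> J). (\<Sum>c\<in>K. w c) \<le> ?S - e * N} =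
     {w \<in> space (expQ \<rho> J). - \<theta> * (?S - e * N) \<le> - \<theta> * (\<Sum>c\<in>K. w c)}"
    using \<theta> by (simp add: mult_le_cancel_left_pos)
  have "prob {w \<in> space (expQ \<rho> J). - \<theta> * (?S - e * N) \<le> - \<theta> * (\<Sum>c\<in>K. w c)} \<le>
    exp (- \<theta> * ?S + 2 * (- \<theta>)\<^sup>2 * N / r\<^sup>2 - (- \<theta>) * (?S - e * N))"
    by (rule chernoff_bound[OF prob_space_axioms]) (use mgf in auto)
  also have "\<dots> \<le> exp (- tail_rate r e * N)"
    using te by (simp add: algebra_simps)
  finally show ?thesis unfolding eq .
qed

lemma expQ_sum_lower_tail:
  assumes "finite J" "K \<subseteq> J" and r: "0 < r" "\<And>c. c \<in> K \<Longrightarrow> r \<le> \<rho> c"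
    and "0 < e" "real (card K) \<le> N"
  shows "\<P>(w in expQ \<rho> J. (\<Sum>c\<in>K. w c) \<le> (\<Sum>c\<in>K. 1 / \<rho> c) - e * N)
      \<le> exp (- tail_rate r e * N)"
proof (rule expQ_sum_lower_tail_dominated)
  show "0 < \<rho> c" if "c \<in> K" for c using r(1) r(2)[OF that] by linarith
qed (use assms in auto)

lemma blpp_right_lower_tail:
  assumes pos: "a 0 + b 0 = 0" "\<And>k. k \<in> {1..m} \<Longrightarrow> 0 < a k + b 0" "\<And>k. k \<in> {1..n} \<Longrightarrow> r \<le> a 0 + b k"
    and r: "0 < r" and e: "0 < e" and N: "real n \<le> N"
  defines "Q \<equiv> expQ (rates a b) (bd_cells m n)"
  shows "\<P>(w in Q. blpp w m n - (\<Sum>i\<in>{1..m}. w (i, 0)) \<le> (\<Sum>j\<in>{1..n}. 1 / (a 0 + b j)) - e * N)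
      \<le> exp (- tail_rate r e * N)"
proof -
  interpret prob_space Q unfolding Q_def by (rule prob_space_expQ)
  define s where "s = (\<Sum>j\<in>{1..n}. 1 / (a 0 + b j)) - e * N"
  let ?L = "{0 :: nat} \<times> {1..n}"
  have L: "?L \<subseteq> bd_cells m n" by (auto simp: bd_cells_def)
  have [measurable]: "(\<lambda>w. \<Sum>c\<in>?L. w c) \<in> borel_measurable Q"
    unfolding Q_def by (rule measurable_sum_expQ) fact
  have [measurable]: "(\<lambda>w. blpp w m n) \<in> borel_measurable Q"
    unfolding Q_def by (rule measurable_blpp_expQ) simp
  have [measurable]: "(\<lambda>w. w (i, 0)) \<in> borel_measurable Q" if "i \<in> {1..m}" for i
    unfolding Q_def by (rule measurable_expQ_component) (use that in \<open>auto simp: bd_cells_def\<close>)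
  have "(\<integral>\<^sup>+w. indicator {..s} (blpp w m n - (\<Sum>i\<in>{1..m}. w (i, 0))) \<partial>Q) =
    (\<integral>\<^sup>+w. indicator {..s} (\<Sum>c\<in>?L. w c) \<partial>Q)"
    unfolding Q_def by (rule stationary_right) (use pos r in \<open>auto intro: less_le_trans\<close>)
  note st = this
  have ind: "(\<integral>\<^sup>+w. indicator {..s} (X w) \<partial>Q) = emeasure Q {w \<in> space Q. X w \<le> s}"
    if [measurable]: "X \<in> borel_measurable Q" for X
  proof -
    have "(\<integral>\<^sup>+w. indicator {..s} (X w) \<partial>Q) = (\<integral>\<^sup>+w. indicator {w \<in> space Q. X w \<le> s} w \<partial>Q)"
      by (intro nn_integral_cong) (auto simp: indicator_def)
    then show ?thesis by simp
  qed
  have "emeasure Q {w \<in> space Q. blpp w m n - (\<Sum>i\<in>{1..m}. w (i, 0)) \<le> s} =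
     emeasure Q {w \<in> space Q. (\<Sum>c\<in>?L. w c) \<le> s}"
    by (subst (1 2) ind[symmetric]) (measurable, fact st)
  then have eq: "prob {w \<in> space Q. blpp w m n - (\<Sum>i\<in>{1..m}. w (i, 0)) \<le> s} = prob {w \<in> space Q. (\<Sum>c\<in>?L. w c) \<le> s}"
    by (simp add: measure_def)
  have s: "s = (\<Sum>c\<in>?L. 1 / rates a b c) - e * N"
    unfolding s_def sum_left by (simp add: rates_def)
  have "prob {w \<in> space Q. (\<Sum>c\<in>?L. w c) \<le> s} \<le> exp (- tail_rate r e * N)"
    unfolding s Q_def by (rule expQ_sum_lower_tail) (use L r e N pos in \<open>auto simp: rates_def\<close>)
  then show ?thesis using eq by (simp only: s_def)
qed

section \<open>Where the stationary path leaves the boundary\<close>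

lemma lpp_row: "lpp w m (Suc 0) = (\<Sum>i\<in>{1..m}. w (i, Suc 0))" if "\<And>i. i \<in> {1..m} \<Longrightarrow> 0 \<le> w (i, Suc 0)"
  using that
proof (induction m)
  case (Suc m)
  have "0 \<le> lpp w m (Suc 0)" by (rule lpp_nonneg) (use Suc.prems in \<open>auto simp: cells_def\<close>)
  then show ?case using Suc by (simp add: max_def)
qed simp

lemma lpp_column: "lpp w (Suc 0) n = (\<Sum>j\<in>{1..n}. w (Suc 0, j))" if "\<And>j. j \<in> {1..n} \<Longrightarrow> 0 \<le> w (Suc 0, j)"
  using that
proof (induction n)
  case (Suc n)
  have "0 \<le> lpp w (Suc 0) n" by (rule lpp_nonneg) (use Suc.prems in \<open>auto simp: cells_def\<close>)
  then show ?case using Suc by (simp add: max_def)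
qed simp

lemma sum_split_at:
  fixes f :: "nat \<Rightarrow> 'a :: comm_monoid_add"
  assumes "k \<le> m"
  shows "(\<Sum>i\<in>{1..m}. f i) = (\<Sum>i\<in>{1..k}. f i) + (\<Sum>i\<in>{k + 1..m}. f i)"
proof -
  have "{1..k} \<union> {k + 1..m} = {1..m}" using assms by auto
  then show ?thesis using sum.union_disjoint[of "{1..k}" "{k + 1..m}" f] by simp
qed

text \<open>An optimal path either has left the boundary by column \<open>k\<close> or row
  \<open>l\<close>, hence collected at most \<open>X\<close> or \<open>Y\<close> there, or it stays
  beyond. In the latter case its remainder is a bulk path in the rectangle to the right of column
  \<open>k\<close> enlarged by row 0, or above row \<open>l\<close> enlarged by column 0;
  \<open>wA\<close> and \<open>wB\<close> reindex these rectangles to start at (1, 1). The induction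
  follows the recursion, so no paths have to be cut.\<close>

lemma blpp_exit:
  fixes w :: "nat \<times> nat \<Rightarrow> real" and k l :: nat
  assumes w: "\<And>c. c \<in> bd_cells m n \<Longrightarrow> 0 \<le> w c"
  defines "X \<equiv> \<Sum>i\<in>{1..k}. w (i, 0)" and "Y \<equiv> \<Sum>j\<in>{1..l}. w (0, j)"
  defines "wA \<equiv> \<lambda>(i, j). w (k + i, j - 1)" and "wB \<equiv> \<lambda>(i, j). w (i - 1, l + j)"
  assumes k: "k \<le> m" and l: "l \<le> n" and ij: "i \<le> m" "j \<le> n"
  shows "blpp w i j \<le> max X Y + lpp w i j \<or>
    (k < i \<and> blpp w i j \<le> X + lpp wA (i - k) (Suc j)) \<or>
    (l < j \<and> blpp w i j \<le> Y + lpp wB (Suc i) (j - l))"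
  using ij
proof (induction i arbitrary: j)
  case 0
  have X0: "0 \<le> X" unfolding X_def by (intro sum_nonneg w) (use k in \<open>auto simp: bd_cells_def\<close>)
  show ?case
  proof (cases "j \<le> l")
    case True
    have "blpp w 0 j \<le> Y" unfolding blpp_left Y_def
      by (intro sum_mono2 w) (use True l in \<open>auto simp: bd_cells_def\<close>)
    then show ?thesis by (simp add: le_max_iff_disj)
  next
    case False
    have "blpp w 0 j = Y + (\<Sum>j'\<in>{l + 1..j}. w (0, j'))"
      unfolding blpp_left Y_def using False by (intro sum_split_at) simp
    also have "(\<Sum>j'\<in>{l + 1..j}. w (0, j')) = (\<Sum>j'\<in>{1..j - l}. wB (Suc 0, j'))"
      using sum.shift_bounds_cl_nat_ivl[of "\<lambda>j. w (0, j)" 1 l "j - l"] False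
      by (simp add: wB_def add.commute)
    also have "\<dots> = lpp wB (Suc 0) (j - l)"
      by (rule lpp_column[symmetric]) (use 0 w in \<open>auto simp: wB_def bd_cells_def\<close>)
    finally show ?thesis using False by simp
  qed
next
  case (Suc i)
  note IHi = Suc.IH
  show ?case using Suc.prems
  proof (induction j)
    case 0
    have Y0: "0 \<le> Y" unfolding Y_def by (intro sum_nonneg w) (use l in \<open>auto simp: bd_cells_def\<close>)
    show ?case
    proof (cases "Suc i \<le> k")
      case True
      have "blpp w (Suc i) 0 \<le> X" unfolding blpp_bottom X_def
        by (intro sum_mono2 w) (use True k in \<open>auto simp: bd_cells_def\<close>)
      then show ?thesis by (simp add: le_max_iff_disj)
    next
      case False
      have "blpp w (Suc i) 0 = X + (\<Sum>i'\<in>{k + 1..Suc i}. w (i', 0))"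
        unfolding blpp_bottom X_def using False by (intro sum_split_at) simp
      also have "(\<Sum>i'\<in>{k + 1..Suc i}. w (i', 0)) = (\<Sum>i'\<in>{1..Suc i - k}. wA (i', Suc 0))"
        using sum.shift_bounds_cl_nat_ivl[of "\<lambda>i. w (i, 0)" 1 k "Suc i - k"] False
        by (simp add: wA_def add.commute)
      also have "\<dots> = lpp wA (Suc i - k) (Suc 0)"
        by (rule lpp_row[symmetric]) (use 0 w in \<open>auto simp: wA_def bd_cells_def\<close>)
      finally show ?thesis using False by simp
    qed
  next
    case (Suc j)
    let ?\<omega> = "w (Suc i, Suc j)"
    \<comment> \<open>The bound \<open>b\<close> is kept abstract so that adding the weight of the
      new cell can be treated once for each direction of the last step, whatever the predecessor's
      value is.\<close>
    let ?P = "\<lambda>i j b. b \<le> max X Y + lpp w i j \<or> (k < i \<and> b \<le> X + lpp wA (i - k) (Suc j)) \<or>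
       (l < j \<and> b \<le> Y + lpp wB (Suc i) (j - l))"
    have step: "v (Suc i, Suc j) + lpp v i (Suc j) \<le> lpp v (Suc i) (Suc j)"
      "v (Suc i, Suc j) + lpp v (Suc i) j \<le> lpp v (Suc i) (Suc j)" for v i j by simp_all
    have 1: "?P (Suc i) (Suc j) (?\<omega> + b)" if "?P i (Suc j) b" for b
      using that
    proof (elim disjE conjE)
      assume "b \<le> max X Y + lpp w i (Suc j)"
      then show ?thesis using step(1)[of w i j] by linarith
    next
      assume b: "k < i" "b \<le> X + lpp wA (i - k) (Suc (Suc j))"
      then have "wA (Suc (i - k), Suc (Suc j)) = ?\<omega>" "Suc i - k = Suc (i - k)" by (auto simp: wA_def)
      then show ?thesis using step(1)[of wA "i - k" "Suc j"] b by (simp del: lpp.simps)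
    next
      assume b: "l < Suc j" "b \<le> Y + lpp wB (Suc i) (Suc j - l)"
      then have "wB (Suc (Suc i), Suc (j - l)) = ?\<omega>" "Suc j - l = Suc (j - l)" by (auto simp: wB_def)
      then show ?thesis using step(1)[of wB "Suc i" "j - l"] b by (simp del: lpp.simps)
    qed
    have 2: "?P (Suc i) (Suc j) (?\<omega> + b)" if "?P (Suc i) j b" for b
      using that
    proof (elim disjE conjE)
      assume "b \<le> max X Y + lpp w (Suc i) j"
      then show ?thesis using step(2)[of w i j] by linarith
    next
      assume b: "k < Suc i" "b \<le> X + lpp wA (Suc i - k) (Suc j)"
      then have "wA (Suc (i - k), Suc (Suc j)) = ?\<omega>" "Suc i - k = Suc (i - k)" by (auto simp: wA_def)
      then show ?thesis using step(2)[of wA "i - k" "Suc j"] b by (simp del: lpp.simps)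
    next
      assume b: "l < j" "b \<le> Y + lpp wB (Suc (Suc i)) (j - l)"
      then have "wB (Suc (Suc i), Suc (j - l)) = ?\<omega>" "Suc j - l = Suc (j - l)" by (auto simp: wB_def)
      then show ?thesis using step(2)[of wB "Suc i" "j - l"] b by (simp del: lpp.simps)
    qed
    have "?P i (Suc j) (blpp w i (Suc j))" using IHi[of "Suc j"] Suc.prems by simp
    note P1 = 1[OF this]
    have "?P (Suc i) j (blpp w (Suc i) j)" using Suc by simp
    note P2 = 2[OF this]
    show ?case
    proof (cases "blpp w (Suc i) j \<le> blpp w i (Suc j)")
      case True
      then have "blpp w (Suc i) (Suc j) = ?\<omega> + blpp w i (Suc j)" by simp
      with P1 show ?thesis by (simp only:)
    next
      case False
      then have "blpp w (Suc i) (Suc j) = ?\<omega> + blpp w (Suc i) j" by simp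
      with P2 show ?thesis by (simp only:)
    qed
  qed
qed

lemma sum_pred_shift:
  fixes f :: "nat \<Rightarrow> 'a :: comm_monoid_add"
  shows "(\<Sum>j\<in>{1..Suc n}. f (j - Suc 0)) = f 0 + (\<Sum>j\<in>{1..n}. f j)"
  by (induction n) (simp_all add: add_ac)

text \<open>The boundary row is an ordinary row of the bulk model, with parameter \<open>b 0\<close>; so the paths that
  leave it after column \<open>k\<close> are controlled by the upper tail of the bulk.\<close>

lemma exit_tail_bottom:
  assumes ab0: "a 0 + b 0 = 0" and k: "k \<le> m"
    and a: "\<And>i. i \<in> {1..m} \<Longrightarrow> \<delta> + \<eta> < a i + b 0" and b: "\<And>j. j \<in> {1..n} \<Longrightarrow> 0 < a 0 + b j"
    and pos: "0 < \<delta>" "0 < \<eta>"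
  defines "Q \<equiv> expQ (rates a b) (bd_cells m n)"
  shows "\<P>(w in Q. s \<le> lpp (\<lambda>(i, j). w (k + i, j - 1)) (m - k) (Suc n)) \<le>
    exp (\<eta> * ((\<Sum>i\<in>{k + 1..m}. 1 / (a i + b 0 - \<delta> - \<eta>)) + (\<Sum>j\<in>{1..n}. 1 / (a 0 + b j + \<delta>)) + 1 / \<delta> - s))"
proof -
  define t where "t = (\<lambda>(i, j). (k + i, j - Suc 0))"
  define a' where "a' i = a (k + i)" for i
  define b' where "b' j = b (j - Suc 0)" for j
  let ?K = "cells (m - k) (Suc n)"
  have R: "(\<lambda>c. rates a b (t c)) = rates a' b'"
    by (auto simp: rates_def t_def a'_def b'_def fun_eq_iff)
  have t: "inj_on t ?K" "t ` ?K \<subseteq> bd_cells m n"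
    by (auto simp: t_def cells_def bd_cells_def inj_on_def)
  have "{w \<in> space Q. s \<le> lpp (\<lambda>(i, j). w (k + i, j - 1)) (m - k) (Suc n)} =
    {w \<in> space Q. s \<le> lpp (\<lambda>c\<in>?K. w (t c)) (m - k) (Suc n)}"
    by (intro Collect_cong conj_cong refl arg_cong2[where f="(\<le>)"] lpp_cong) (auto simp: t_def)
  then have "\<P>(w in Q. s \<le> lpp (\<lambda>(i, j). w (k + i, j - 1)) (m - k) (Suc n)) =
    \<P>(w in expQ (rates a' b') ?K. s \<le> lpp w (m - k) (Suc n))"
    unfolding Q_def R[symmetric]
    by (simp only:, intro measure_expQ_reindex t)
      (use measurable_lpp_expQ[OF subset_refl, of "m - k" "Suc n" "\<lambda>c. rates a b (t c)"] in measurable)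
  \<comment> \<open>The moment parameter is u = b 0 - \<delta> - \<eta> with exponent \<eta>. In the
    second sum \<eta> cancels, so the boundary row keeps the small rate \<delta> and contributes the
    constant 1 / \<delta>.\<close>
  also have "\<dots> \<le> exp (\<eta> * ((\<Sum>i\<in>{1..m - k}. 1 / (a' i + (b 0 - \<delta> - \<eta>))) +
      (\<Sum>j\<in>{1..Suc n}. 1 / (b' j - (b 0 - \<delta> - \<eta>) - \<eta>)) - s))"
  proof (rule lpp_upper_tail)
    show "0 < b' j - (b 0 - \<delta> - \<eta>) - \<eta>" if "j \<in> {1..Suc n}" for j
    proof (cases "j = 1")
      case False
      with that have "j - Suc 0 \<in> {1..n}" by auto
      from b[OF this] pos ab0 show ?thesis by (simp add: b'_def)
    qed (use ab0 pos in \<open>simp add: b'_def\<close>)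
    show "0 < a' i + (b 0 - \<delta> - \<eta>)" if "i \<in> {1..m - k}" for i
    proof -
      have "k + i \<in> {1..m}" using that by auto
      from a[OF this] show ?thesis by (simp add: a'_def)
    qed
  qed (use pos in auto)
  also have "(\<Sum>i\<in>{1..m - k}. 1 / (a' i + (b 0 - \<delta> - \<eta>))) = (\<Sum>i\<in>{k + 1..m}. 1 / (a i + b 0 - \<delta> - \<eta>))"
    using sum.shift_bounds_cl_nat_ivl[of "\<lambda>i. 1 / (a i + b 0 - \<delta> - \<eta>)" 1 k "m - k"] k
    by (simp add: a'_def add.commute algebra_simps)
  also have "(\<Sum>j\<in>{1..Suc n}. 1 / (b' j - (b 0 - \<delta> - \<eta>) - \<eta>)) = 1 / \<delta> + (\<Sum>j\<in>{1..n}. 1 / (a 0 + b j + \<delta>))"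
  proof -
    have eq: "b' j - (b 0 - \<delta> - \<eta>) - \<eta> = a 0 + b (j - Suc 0) + \<delta>" for j
      using ab0 by (simp add: b'_def)
    show ?thesis
      unfolding eq using sum_pred_shift[of "\<lambda>j. 1 / (a 0 + b j + \<delta>)" n] ab0 by simp
  qed
  finally show ?thesis by (simp add: algebra_simps)
qed

text \<open>The moment bound is not symmetric in rows and columns, so the parameter differs from the
  bottom case: u = b 0 + \<delta>. The loss \<eta> again falls on the side whose boundary is being
  followed, and the boundary column now gives 1 / \<delta> in the first sum.\<close>

lemma exit_tail_left:
  assumes ab0: "a 0 + b 0 = 0" and l: "l \<le> n"
    and a: "\<And>i. i \<in> {1..m} \<Longrightarrow> 0 < a i + b 0" and b: "\<And>j. j \<in> {1..n} \<Longrightarrow> \<delta> + \<eta> < a 0 + b j"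
    and pos: "0 < \<delta>" "0 < \<eta>"
  defines "Q \<equiv> expQ (rates a b) (bd_cells m n)"
  shows "\<P>(w in Q. s \<le> lpp (\<lambda>(i, j). w (i - 1, l + j)) (Suc m) (n - l)) \<le>
    exp (\<eta> * ((\<Sum>j\<in>{l + 1..n}. 1 / (a 0 + b j - \<delta> - \<eta>)) + (\<Sum>i\<in>{1..m}. 1 / (a i + b 0 + \<delta>)) + 1 / \<delta> - s))"
proof -
  define t where "t = (\<lambda>(i, j). (i - Suc 0, l + j))"
  define a' where "a' i = a (i - Suc 0)" for i
  define b' where "b' j = b (l + j)" for j
  let ?K = "cells (Suc m) (n - l)"
  have R: "(\<lambda>c. rates a b (t c)) = rates a' b'"
    by (auto simp: rates_def t_def a'_def b'_def fun_eq_iff)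
  have t: "inj_on t ?K" "t ` ?K \<subseteq> bd_cells m n"
    by (auto simp: t_def cells_def bd_cells_def inj_on_def)
  have "{w \<in> space Q. s \<le> lpp (\<lambda>(i, j). w (i - 1, l + j)) (Suc m) (n - l)} =
    {w \<in> space Q. s \<le> lpp (\<lambda>c\<in>?K. w (t c)) (Suc m) (n - l)}"
    by (intro Collect_cong conj_cong refl arg_cong2[where f="(\<le>)"] lpp_cong) (auto simp: t_def)
  then have "\<P>(w in Q. s \<le> lpp (\<lambda>(i, j). w (i - 1, l + j)) (Suc m) (n - l)) =
    \<P>(w in expQ (rates a' b') ?K. s \<le> lpp w (Suc m) (n - l))"
    unfolding Q_def R[symmetric]
    by (simp only:, intro measure_expQ_reindex t)
      (use measurable_lpp_expQ[OF subset_refl, of "Suc m" "n - l" "\<lambda>c. rates a b (t c)"] in measurable)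
  also have "\<dots> \<le> exp (\<eta> * ((\<Sum>i\<in>{1..Suc m}. 1 / (a' i + (b 0 + \<delta>))) +
      (\<Sum>j\<in>{1..n - l}. 1 / (b' j - (b 0 + \<delta>) - \<eta>)) - s))"
  proof (rule lpp_upper_tail)
    show "0 < a' i + (b 0 + \<delta>)" if "i \<in> {1..Suc m}" for i
    proof (cases "i = 1")
      case False
      with that have "i - Suc 0 \<in> {1..m}" by auto
      from a[OF this] pos show ?thesis by (simp add: a'_def)
    qed (use ab0 pos in \<open>simp add: a'_def\<close>)
    show "0 < b' j - (b 0 + \<delta>) - \<eta>" if "j \<in> {1..n - l}" for j
    proof -
      have "l + j \<in> {1..n}" using that by auto
      from b[OF this] ab0 show ?thesis by (simp add: b'_def)
    qed
  qed (use pos in auto)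
  also have "(\<Sum>j\<in>{1..n - l}. 1 / (b' j - (b 0 + \<delta>) - \<eta>)) = (\<Sum>j\<in>{l + 1..n}. 1 / (a 0 + b j - \<delta> - \<eta>))"
  proof -
    have "a 0 = - b 0" using ab0 by simp
    then show ?thesis
    using sum.shift_bounds_cl_nat_ivl[of "\<lambda>j. 1 / (a 0 + b j - \<delta> - \<eta>)" 1 l "n - l"] l
    by (simp add: b'_def add.commute algebra_simps)
  qed
  also have "(\<Sum>i\<in>{1..Suc m}. 1 / (a' i + (b 0 + \<delta>))) = 1 / \<delta> + (\<Sum>i\<in>{1..m}. 1 / (a i + b 0 + \<delta>))"
    using sum_pred_shift[of "\<lambda>i. 1 / (a i + b 0 + \<delta>)" m] ab0 by (simp add: a'_def algebra_simps)
  finally show ?thesis by (simp add: algebra_simps)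
qed

lemma reciprocal_expansions:
  fixes x r s :: real
  assumes "r \<le> x" "0 < r" "0 \<le> s"
  shows reciprocal_minus_le: "s \<le> r / 2 \<Longrightarrow> 1 / (x - s) \<le> 1 / x + s * (1 / x)\<^sup>2 + 2 * s\<^sup>2 / r ^ 3"
    and reciprocal_plus_le: "1 / (x + s) \<le> 1 / x - s * (1 / x)\<^sup>2 + s\<^sup>2 / r ^ 3"
proof -
  have x: "0 < x" using assms by linarith
  have r3: "r ^ 3 \<le> x ^ 3" using assms by (intro power_mono) auto
  have q: "c / x ^ 3 \<le> c / r ^ 3" if "0 \<le> c" for c :: real
    using r3 that x assms by (intro divide_left_mono) auto
  {
    assume s: "s \<le> r / 2"
    then have xs: "0 < x - s" "s \<le> x / 2" using assms by auto
    have "1 / (x - s) - (1 / x + s * (1 / x)\<^sup>2 + 2 * s\<^sup>2 / x ^ 3) =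
      (s\<^sup>2 * (2 * s - x)) / ((x - s) * x ^ 3)"
      using xs x by (simp add: field_simps power2_eq_square power3_eq_cube)
    also have "\<dots> \<le> 0" using xs x by (intro divide_nonpos_pos mult_nonneg_nonpos) auto
    finally show "1 / (x - s) \<le> 1 / x + s * (1 / x)\<^sup>2 + 2 * s\<^sup>2 / r ^ 3"
      using q[of "2 * s\<^sup>2"] by simp
  }
  have "1 / (x + s) - (1 / x - s * (1 / x)\<^sup>2 + s\<^sup>2 / x ^ 3) = - (s ^ 3) / ((x + s) * x ^ 3)"
  proof -
    have "x \<noteq> 0" "x + s \<noteq> 0" using x assms by auto
    then show ?thesis by (simp add: divide_simps power2_eq_square power3_eq_cube) algebra
  qed
  also have "\<dots> \<le> 0" using x assms by (intro divide_nonpos_pos) auto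
  finally show "1 / (x + s) \<le> 1 / x - s * (1 / x)\<^sup>2 + s\<^sup>2 / r ^ 3"
    using q[of "s\<^sup>2"] by simp
qed

text \<open>The balance condition cancels the first-order effect of shifting the parameter by \<open>\<delta>\<close>, except for
  the columns up to \<open>k\<close>, whose contribution is macroscopic by Cauchy--Schwarz.\<close>

lemma exit_gain:
  fixes u v :: "nat \<Rightarrow> real"
  assumes r: "0 < r" "\<And>i. i \<in> {1..m} \<Longrightarrow> r \<le> u i" "\<And>j. j \<in> {1..n} \<Longrightarrow> r \<le> v j"
    and k: "k < m" and N: "real m \<le> N" "real n \<le> N"
    and e: "0 < e" "e * N < (\<Sum>i\<in>{1..Suc k}. 1 / u i)"
    and bal: "\<bar>(\<Sum>i\<in>{1..m}. (1 / u i)\<^sup>2) - (\<Sum>j\<in>{1..n}. (1 / v j)\<^sup>2)\<bar> \<le> 1 / r\<^sup>2"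
    and \<delta>: "0 < \<delta>" "\<delta> \<le> r / 4" "9 * \<delta> / r ^ 3 \<le> e\<^sup>2 / 4"
    and \<eta>: "0 < \<eta>" "\<eta> \<le> \<delta>" "\<eta> / r\<^sup>2 \<le> \<delta> * e\<^sup>2 / 4"
  shows "(\<Sum>i\<in>{k + 1..m}. 1 / (u i - \<delta> - \<eta>)) + (\<Sum>j\<in>{1..n}. 1 / (v j + \<delta>)) \<le>
    (\<Sum>i\<in>{k + 1..m}. 1 / u i) + (\<Sum>j\<in>{1..n}. 1 / v j) - \<delta> * e\<^sup>2 / 2 * N + 2 * \<delta> / r\<^sup>2"
proof -
  let ?A2 = "\<lambda>I. \<Sum>i\<in>I. (1 / u i)\<^sup>2"
  let ?B2 = "\<Sum>j\<in>{1..n}. (1 / v j)\<^sup>2"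
  have N0: "0 \<le> N" using N by linarith
  have Npos: "0 < N" using k N by linarith
  have Ai: "0 \<le> 1 / u i" "1 / u i \<le> 1 / r" "(1 / u i)\<^sup>2 \<le> 1 / r\<^sup>2" if "i \<in> {1..m}" for i
  proof -
    show "0 \<le> 1 / u i" using r(2)[OF that] r(1) by simp
    show le: "1 / u i \<le> 1 / r" using r(2)[OF that] r(1) by (intro divide_left_mono) auto
    show "(1 / u i)\<^sup>2 \<le> 1 / r\<^sup>2" using power_mono[OF le \<open>0 \<le> 1 / u i\<close>, of 2] by (simp add: power_one_over)
  qed
  have "(\<Sum>i\<in>{k + 1..m}. 1 / (u i - \<delta> - \<eta>)) \<le> (\<Sum>i\<in>{k + 1..m}. 1 / u i + (\<delta> + \<eta>) * (1 / u i)\<^sup>2 + 2 * (\<delta> + \<eta>)\<^sup>2 / r ^ 3)"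
    using reciprocal_minus_le[of r "u i" "\<delta> + \<eta>" for i] r \<delta> \<eta>
    by (intro sum_mono) (auto simp: diff_diff_eq)
  also have "\<dots> = (\<Sum>i\<in>{k + 1..m}. 1 / u i) + (\<delta> + \<eta>) * ?A2 {k + 1..m} + (real m - real k) * (2 * (\<delta> + \<eta>)\<^sup>2 / r ^ 3)"
    using k by (simp add: sum.distrib sum_distrib_left of_nat_diff)
  also have "\<dots> \<le> (\<Sum>i\<in>{k + 1..m}. 1 / u i) + (\<delta> * ?A2 {k + 1..m} + N * (\<delta> * e\<^sup>2 / 4)) + N * (2 * (2 * \<delta>)\<^sup>2 / r ^ 3)"
  proof (intro add_mono order_refl mult_mono)
    have "\<eta> * ?A2 {k + 1..m} \<le> \<eta> * (\<Sum>i\<in>{k + 1..m}. 1 / r\<^sup>2)"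
      using \<eta> by (intro mult_left_mono sum_mono Ai) auto
    also have "\<dots> = (real m - real k) * (\<eta> / r\<^sup>2)"
      using k by (simp add: of_nat_diff)
    also have "\<dots> \<le> N * (\<delta> * e\<^sup>2 / 4)"
      using N \<eta> r by (intro mult_mono) auto
    finally show "(\<delta> + \<eta>) * ?A2 {k + 1..m} \<le> \<delta> * ?A2 {k + 1..m} + N * (\<delta> * e\<^sup>2 / 4)"
      by (simp add: distrib_right)
    show "2 * (\<delta> + \<eta>)\<^sup>2 / r ^ 3 \<le> 2 * (2 * \<delta>)\<^sup>2 / r ^ 3"
      using r \<delta> \<eta> by (intro divide_right_mono mult_left_mono power_mono) auto
  qed (use N r \<delta> \<eta> N0 in auto)
  finally have A: "(\<Sum>i\<in>{k + 1..m}. 1 / (u i - \<delta> - \<eta>)) \<le> (\<Sum>i\<in>{k + 1..m}. 1 / u i) + \<delta> * ?A2 {k + 1..m} + N * (\<delta> * e\<^sup>2 / 4) + N * (8 * \<delta>\<^sup>2 / r ^ 3)"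
    by (simp add: power_mult_distrib)
  have "(\<Sum>j\<in>{1..n}. 1 / (v j + \<delta>)) \<le> (\<Sum>j\<in>{1..n}. 1 / v j - \<delta> * (1 / v j)\<^sup>2 + \<delta>\<^sup>2 / r ^ 3)"
    using r \<delta> by (intro sum_mono reciprocal_plus_le) auto
  also have "\<dots> = (\<Sum>j\<in>{1..n}. 1 / v j) - \<delta> * ?B2 + real n * (\<delta>\<^sup>2 / r ^ 3)"
    by (simp add: sum.distrib sum_subtractf sum_distrib_left)
  also have "\<dots> \<le> (\<Sum>j\<in>{1..n}. 1 / v j) - \<delta> * ?B2 + N * (\<delta>\<^sup>2 / r ^ 3)"
    using N r by (intro add_mono order_refl mult_right_mono) auto
  finally have B: "(\<Sum>j\<in>{1..n}. 1 / (v j + \<delta>)) \<le> (\<Sum>j\<in>{1..n}. 1 / v j) - \<delta> * ?B2 + N * (\<delta>\<^sup>2 / r ^ 3)" .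
  \<comment> \<open>Cauchy--Schwarz over the first k + 1 columns, where the threshold is crossed.
    Only the first k are skipped by the path, so the term of index k + 1 is returned at a cost of 1
    / r^2.\<close>
  have "e\<^sup>2 * N - 1 / r\<^sup>2 \<le> ?A2 {1..k}"
  proof -
    have "(e * N)\<^sup>2 \<le> (\<Sum>i\<in>{1..Suc k}. 1 / u i)\<^sup>2"
      using e N0 by (intro power_mono) auto
    also have "\<dots> \<le> ?A2 {1..Suc k} * card {1..Suc k}"
      by (rule sum_squared_le_sum_of_squares)
    also have "\<dots> \<le> ?A2 {1..Suc k} * N"
      using k N by (intro mult_left_mono sum_nonneg) auto
    finally have "e\<^sup>2 * N \<le> ?A2 {1..Suc k}"
      using Npos by (simp add: power2_eq_square mult_ac)
    also have "\<dots> \<le> ?A2 {1..k} + 1 / r\<^sup>2"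
      using Ai(3)[of "Suc k"] k by simp
    finally show ?thesis by simp
  qed
  moreover have "?A2 {1..m} = ?A2 {1..k} + ?A2 {k + 1..m}"
    using k by (intro sum_split_at) simp
  ultimately have "?A2 {k + 1..m} - ?B2 \<le> 1 / r\<^sup>2 - (e\<^sup>2 * N - 1 / r\<^sup>2)"
    using bal by linarith
  then have "\<delta> * (?A2 {k + 1..m} - ?B2) \<le> \<delta> * (2 / r\<^sup>2 - e\<^sup>2 * N)"
    using \<delta> by (intro mult_left_mono) auto
  then have C: "\<delta> * ?A2 {k + 1..m} - \<delta> * ?B2 \<le> 2 * \<delta> / r\<^sup>2 - \<delta> * e\<^sup>2 * N"
    by (simp add: algebra_simps)
  have D: "N * (8 * \<delta>\<^sup>2 / r ^ 3) + N * (\<delta>\<^sup>2 / r ^ 3) \<le> N * (\<delta> * e\<^sup>2 / 4)"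
  proof -
    have "N * (8 * \<delta>\<^sup>2 / r ^ 3) + N * (\<delta>\<^sup>2 / r ^ 3) = N * (\<delta> * (9 * \<delta> / r ^ 3))"
      by (simp add: power2_eq_square algebra_simps add_divide_distrib)
    also have "\<dots> \<le> N * (\<delta> * (e\<^sup>2 / 4))"
      using N0 \<delta> by (intro mult_left_mono) auto
    finally show ?thesis by simp
  qed
  \<comment> \<open>Of the gain \<open>\<delta> * e\<^sup>2 * N\<close>, one quarter pays for the
    additional shift by \<eta> and one quarter for the second-order terms (8 + 1 = 9 units of
    \<delta>^2 / r^3); one half is left.\<close>
  have "N * (\<delta> * e\<^sup>2 / 4) + N * (\<delta> * e\<^sup>2 / 4) - \<delta> * e\<^sup>2 * N = - (\<delta> * e\<^sup>2 / 2 * N)"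
    by (simp add: field_simps)
  with A B C D show ?thesis by linarith
qed

lemma obtain_threshold_index:
  fixes f :: "nat \<Rightarrow> real"
  assumes "0 \<le> c"
  obtains k where "k \<le> m" "(\<Sum>i\<in>{1..k}. f i) \<le> c" "k < m \<Longrightarrow> c < (\<Sum>i\<in>{1..Suc k}. f i)"
proof -
  have "\<exists>k\<le>m. (\<Sum>i\<in>{1..k}. f i) \<le> c \<and> (k < m \<longrightarrow> c < (\<Sum>i\<in>{1..Suc k}. f i))"
  proof (induction m)
    case (Suc m)
    then obtain k where "k \<le> m" "(\<Sum>i\<in>{1..k}. f i) \<le> c" "k < m \<longrightarrow> c < (\<Sum>i\<in>{1..Suc k}. f i)"
      by blast
    then show ?case
      by (cases "k = m"; cases "(\<Sum>i\<in>{1..Suc m}. f i) \<le> c") (force intro: exI[of _ k] exI[of _ "Suc m"])+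
  qed (use assms in auto)
  then show ?thesis using that by blast
qed

section \<open>Lower tail in the balanced direction\<close>

lemma measurable_lpp_reindex:
  "(\<And>c. c \<in> cells p q \<Longrightarrow> t c \<in> J) \<Longrightarrow> (\<lambda>w. lpp (\<lambda>c. w (t c)) p q) \<in> borel_measurable (expQ \<rho> J)"
  by (intro measurable_lpp measurable_expQ_component) auto

text \<open>Outside six bad events the stationary maximum is close to its mean, while any path
  following a boundary past the threshold falls short of it. The exit alternative then leaves only
  paths whose boundary part is small, so the bulk carries the rest. Balance is required only up to 1
  / r^2, the size of one summand: later the rectangle is cut at integer positions, where exact
  balance cannot be expected.\<close>

lemma lpp_lower_tail_balanced:
  fixes r \<epsilon> :: real
  assumes r: "0 < r" and \<epsilon>: "0 < \<epsilon>"
  shows "\<exists>c>0. \<exists>C>0. \<forall>a b z m n N. (\<forall>i\<in>{1..m}. r \<le> a i + z) \<longrightarrow> (\<forall>j\<in>{1..n}. r \<le> b j - z) \<longrightarrow>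
    \<bar>(\<Sum>i\<in>{1..m}. (1 / (a i + z))\<^sup>2) - (\<Sum>j\<in>{1..n}. (1 / (b j - z))\<^sup>2)\<bar> \<le> 1 / r\<^sup>2 \<longrightarrow>
    real m \<le> N \<longrightarrow> real n \<le> N \<longrightarrow>
    \<P>(w in expQ (rates a b) (cells m n). lpp w m n < (\<Sum>i\<in>{1..m}. 1 / (a i + z)) + (\<Sum>j\<in>{1..n}. 1 / (b j - z)) - \<epsilon> * N) \<le> C * exp (- c * N)"
proof -
  \<comment> \<open>The final deficit is at most 2 e1 N + (e + e1) N, below 8 e N = \<epsilon> N.
    \<delta> makes the second-order terms and \<eta> the extra shift small against the gain \<delta>
    e^2 N; \<open>e1\<close> is so small that three concentration errors leave \<delta> e^2 N / 8 of
    the half that survives.\<close>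
  define e where "e = \<epsilon> / 8"
  define \<delta> where "\<delta> = min (r / 4) (e\<^sup>2 * r ^ 3 / 36)"
  define \<eta> where "\<eta> = min \<delta> (\<delta> * e\<^sup>2 * r\<^sup>2 / 4)"
  define e1 where "e1 = min e (\<delta> * e\<^sup>2 / 8)"
  have e: "0 < e" using \<epsilon> by (simp add: e_def)
  have \<delta>0: "0 < \<delta>" using r e by (simp add: \<delta>_def)
  have \<delta>1: "\<delta> \<le> r / 4" by (simp add: \<delta>_def)
  have \<delta>2: "9 * \<delta> / r ^ 3 \<le> e\<^sup>2 / 4"
  proof -
    have "\<delta> \<le> e\<^sup>2 * r ^ 3 / 36" by (simp add: \<delta>_def)
    then show ?thesis using r by (simp add: field_simps)
  qed
  have \<eta>0: "0 < \<eta>" using r e \<delta>0 by (simp add: \<eta>_def)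
  have \<eta>1: "\<eta> \<le> \<delta>" by (simp add: \<eta>_def)
  have \<eta>2: "\<eta> / r\<^sup>2 \<le> \<delta> * e\<^sup>2 / 4"
  proof -
    have "\<eta> \<le> \<delta> * e\<^sup>2 * r\<^sup>2 / 4" by (simp add: \<eta>_def)
    then show ?thesis using r by (simp add: field_simps)
  qed
  have e1: "0 < e1" "e1 \<le> e" "e1 \<le> \<delta> * e\<^sup>2 / 8" using e \<delta>0 by (auto simp: e1_def)
  define c where "c = min (tail_rate r e1) (\<eta> * (\<delta> * e\<^sup>2 / 8))"
  \<comment> \<open>Absorbs the contributions to the exit bounds that do not grow with N.\<close>
  define D where "D = exp (\<eta> * (2 * \<delta> / r\<^sup>2 + 1 / \<delta>))"
  have c0: "0 < c" using r e \<delta>0 \<eta>0 e1 by (simp add: c_def tail_rate_pos)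
  have D0: "0 < D" by (simp add: D_def)
  show ?thesis
  proof (rule exI[of _ c], intro conjI c0, rule exI[of _ "4 + 2 * D"], intro conjI allI impI)
    show "0 < 4 + 2 * D" using D0 by simp
  next
    fix a b :: "nat \<Rightarrow> real" and z :: real and m n :: nat and N :: real
    assume a: "\<forall>i\<in>{1..m}. r \<le> a i + z" and b: "\<forall>j\<in>{1..n}. r \<le> b j - z"
      and bal: "\<bar>(\<Sum>i\<in>{1..m}. (1 / (a i + z))\<^sup>2) - (\<Sum>j\<in>{1..n}. (1 / (b j - z))\<^sup>2)\<bar> \<le> 1 / r\<^sup>2"
      and N: "real m \<le> N" "real n \<le> N"
    have N0: "0 \<le> N" using N by linarith
    define u where "u i = a i + z" for i
    define v where "v j = b j - z" for j
    define a' where "a' = a(0 := - z)"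
    define b' where "b' = b(0 := z)"
    let ?R = "rates a' b'"
    define Q where "Q = expQ ?R (bd_cells m n)"
    interpret prob_space Q unfolding Q_def by (rule prob_space_expQ)
    have ab0: "a' 0 + b' 0 = 0" by (simp add: a'_def b'_def)
    have u': "a' i + b' 0 = u i" if "i \<in> {1..m}" for i using that by (simp add: a'_def b'_def u_def)
    have v': "a' 0 + b' j = v j" if "j \<in> {1..n}" for j using that by (simp add: a'_def b'_def v_def)
    have u: "r \<le> u i" if "i \<in> {1..m}" for i using a that by (simp add: u_def)
    have v: "r \<le> v i" if "i \<in> {1..n}" for i using b that by (simp add: v_def)
    have bal1: "\<bar>(\<Sum>i\<in>{1..m}. (1 / u i)\<^sup>2) - (\<Sum>j\<in>{1..n}. (1 / v j)\<^sup>2)\<bar> \<le> 1 / r\<^sup>2"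
      using bal by (simp add: u_def v_def)
    have bal2: "\<bar>(\<Sum>j\<in>{1..n}. (1 / v j)\<^sup>2) - (\<Sum>i\<in>{1..m}. (1 / u i)\<^sup>2)\<bar> \<le> 1 / r\<^sup>2"
      using bal1 by linarith
    obtain k where k: "k \<le> m" "(\<Sum>i\<in>{1..k}. 1 / u i) \<le> e * N" "k < m \<Longrightarrow> e * N < (\<Sum>i\<in>{1..Suc k}. 1 / u i)"
      using obtain_threshold_index[of "e * N" m "\<lambda>i. 1 / u i"] e N0 by auto
    obtain l where l: "l \<le> n" "(\<Sum>i\<in>{1..l}. 1 / v i) \<le> e * N" "l < n \<Longrightarrow> e * N < (\<Sum>i\<in>{1..Suc l}. 1 / v i)"
      using obtain_threshold_index[of "e * N" n "\<lambda>i. 1 / v i"] e N0 by auto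
    define SA where "SA = (\<Sum>i\<in>{1..m}. 1 / u i)"
    define SB where "SB = (\<Sum>j\<in>{1..n}. 1 / v j)"
    define X where "X w = (\<Sum>c\<in>{1..k} \<times> {0}. w c)" for w :: "nat \<times> nat \<Rightarrow> real"
    define Y where "Y w = (\<Sum>c\<in>{0} \<times> {1..l}. w c)" for w :: "nat \<times> nat \<Rightarrow> real"
    define Z where "Z w = (\<Sum>c\<in>{1..m} \<times> {0}. w c)" for w :: "nat \<times> nat \<Rightarrow> real"
    define LA where "LA w = lpp (\<lambda>(i, j). w (k + i, j - 1)) (m - k) (Suc n)" for w :: "nat \<times> nat \<Rightarrow> real"
    define LB where "LB w = lpp (\<lambda>(i, j). w (i - 1, l + j)) (Suc m) (n - l)" for w :: "nat \<times> nat \<Rightarrow> real"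
    have [measurable]: "X \<in> borel_measurable Q" "Y \<in> borel_measurable Q" "Z \<in> borel_measurable Q"
      unfolding X_def Y_def Z_def Q_def using k(1) l(1)
      by (auto intro!: measurable_sum_expQ simp: bd_cells_def)
    have [measurable]: "LA \<in> borel_measurable Q" "LB \<in> borel_measurable Q"
      unfolding LA_def LB_def Q_def split_beta' using k(1) l(1)
      by (auto intro!: measurable_lpp_reindex simp: bd_cells_def cells_def)
    have [measurable]: "(\<lambda>w. blpp w m n) \<in> borel_measurable Q"
      unfolding Q_def by (rule measurable_blpp_expQ) simp
    have [measurable]: "(\<lambda>w. lpp w m n) \<in> borel_measurable Q"
      unfolding Q_def by (rule measurable_lpp_expQ) (rule cells_subset_bd)
    \<comment> \<open>Chosen so that X + LA stays below SA + SB - 2 e1 N, which the stationary value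
      exceeds outside the first two bad events.\<close>
    define tA where "tA = (\<Sum>i\<in>{k + 1..m}. 1 / u i) + SB - 3 * e1 * N"
    define tB where "tB = SA + (\<Sum>i\<in>{l + 1..n}. 1 / v i) - 3 * e1 * N"
    define E1 where "E1 = {w \<in> space Q. blpp w m n - Z w \<le> SB - e1 * N}"
    define E2 where "E2 = {w \<in> space Q. Z w \<le> SA - e1 * N}"
    define E3 where "E3 = {w \<in> space Q. (\<Sum>i\<in>{1..k}. 1 / u i) + e1 * N \<le> X w}"
    define E4 where "E4 = {w \<in> space Q. (\<Sum>i\<in>{1..l}. 1 / v i) + e1 * N \<le> Y w}"
    define E5 where "E5 = {w \<in> space Q. k < m \<and> tA \<le> LA w}"
    define E6 where "E6 = {w \<in> space Q. l < n \<and> tB \<le> LB w}"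
    have ev [measurable]: "E1 \<in> events" "E2 \<in> events" "E3 \<in> events" "E4 \<in> events" "E5 \<in> events" "E6 \<in> events"
      unfolding E1_def E2_def E3_def E4_def E5_def E6_def by measurable
    have tr: "exp (- tail_rate r e1 * N) \<le> exp (- c * N)"
      using N0 by (auto intro!: mult_right_mono simp: c_def)
    have P1: "prob E1 \<le> exp (- c * N)"
    proof -
      have "prob {w \<in> space Q. blpp w m n - (\<Sum>i\<in>{1..m}. w (i, 0)) \<le> (\<Sum>j\<in>{1..n}. 1 / (a' 0 + b' j)) - e1 * N}
        \<le> exp (- tail_rate r e1 * N)"
        unfolding Q_def
      proof (rule blpp_right_lower_tail)
        show "0 < a' k + b' 0" if "k \<in> {1..m}" for k using u[OF that] u'[OF that] r by simp
        show "r \<le> a' 0 + b' k" if "k \<in> {1..n}" for k using v[OF that] v'[OF that] by simp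
      qed (use r e1 N ab0 in auto)
      moreover have "(\<Sum>j\<in>{1..n}. 1 / (a' 0 + b' j)) = SB"
        unfolding SB_def by (intro sum.cong refl) (simp add: v')
      ultimately show ?thesis unfolding E1_def Z_def sum_bottom by - (rule order_trans[OF _ tr], simp)
    qed
    have P2: "prob E2 \<le> exp (- c * N)"
    proof -
      have "prob {w \<in> space Q. (\<Sum>c\<in>{1..m} \<times> {0}. w c) \<le> (\<Sum>c\<in>{1..m} \<times> {0}. 1 / ?R c) - e1 * N} \<le> exp (- tail_rate r e1 * N)"
        unfolding Q_def by (rule expQ_sum_lower_tail)
          (use r e1 N u u' in \<open>auto simp: bd_cells_def rates_def\<close>)
      moreover have "(\<Sum>c\<in>{1..m} \<times> {0}. 1 / ?R c) = SA"
        unfolding SA_def sum_bottom by (intro sum.cong refl) (simp add: u' rates_def)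
      ultimately show ?thesis unfolding E2_def Z_def by - (rule order_trans[OF _ tr], simp)
    qed
    have P3: "prob E3 \<le> exp (- c * N)"
    proof -
      have "prob {w \<in> space Q. (\<Sum>c\<in>{1..k} \<times> {0}. 1 / ?R c) + e1 * N \<le> (\<Sum>c\<in>{1..k} \<times> {0}. w c)} \<le> exp (- tail_rate r e1 * N)"
        unfolding Q_def by (rule expQ_sum_upper_tail)
          (use r e1 N u u' k(1) in \<open>auto simp: bd_cells_def rates_def\<close>)
      moreover have "(\<Sum>c\<in>{1..k} \<times> {0}. 1 / ?R c) = (\<Sum>i\<in>{1..k}. 1 / u i)"
        unfolding sum_bottom using k(1) by (intro sum.cong refl) (simp add: u' rates_def)
      ultimately show ?thesis unfolding E3_def X_def by - (rule order_trans[OF _ tr], simp)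
    qed
    have P4: "prob E4 \<le> exp (- c * N)"
    proof -
      have "prob {w \<in> space Q. (\<Sum>c\<in>{0} \<times> {1..l}. 1 / ?R c) + e1 * N \<le> (\<Sum>c\<in>{0} \<times> {1..l}. w c)} \<le> exp (- tail_rate r e1 * N)"
        unfolding Q_def by (rule expQ_sum_upper_tail)
          (use r e1 N v v' l(1) in \<open>auto simp: bd_cells_def rates_def\<close>)
      moreover have "(\<Sum>c\<in>{0} \<times> {1..l}. 1 / ?R c) = (\<Sum>i\<in>{1..l}. 1 / v i)"
        unfolding sum_left using l(1) by (intro sum.cong refl) (simp add: v' rates_def)
      ultimately show ?thesis unfolding E4_def Y_def by - (rule order_trans[OF _ tr], simp)
    qed
    have gain: "exp (\<eta> * (G + 1 / \<delta> - t)) \<le> D * exp (- c * N)"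
      if "G \<le> t + 3 * e1 * N - \<delta> * e\<^sup>2 / 2 * N + 2 * \<delta> / r\<^sup>2" for G t
    proof -
      have "e1 * N \<le> \<delta> * e\<^sup>2 / 8 * N" using e1 N0 by (intro mult_right_mono) auto
      moreover have "\<delta> * e\<^sup>2 / 2 * N = 4 * (\<delta> * e\<^sup>2 / 8 * N)" by simp
      ultimately have "G + 1 / \<delta> - t \<le> (2 * \<delta> / r\<^sup>2 + 1 / \<delta>) - \<delta> * e\<^sup>2 / 8 * N"
        using that by linarith
      then have "\<eta> * (G + 1 / \<delta> - t) \<le> \<eta> * ((2 * \<delta> / r\<^sup>2 + 1 / \<delta>) - \<delta> * e\<^sup>2 / 8 * N)"
        using \<eta>0 by (intro mult_left_mono) auto
      also have "\<dots> = \<eta> * (2 * \<delta> / r\<^sup>2 + 1 / \<delta>) + - (\<eta> * (\<delta> * e\<^sup>2 / 8)) * N"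
        by (simp add: right_diff_distrib)
      also have "\<dots> \<le> \<eta> * (2 * \<delta> / r\<^sup>2 + 1 / \<delta>) + - c * N"
        using N0 by (intro add_left_mono mult_right_mono) (auto simp: c_def)
      finally show ?thesis by (simp add: D_def exp_add[symmetric])
    qed
    have P5: "prob E5 \<le> D * exp (- c * N)"
    proof (cases "k < m")
      case True
      have "prob E5 \<le> exp (\<eta> * ((\<Sum>i\<in>{k + 1..m}. 1 / (a' i + b' 0 - \<delta> - \<eta>)) + (\<Sum>j\<in>{1..n}. 1 / (a' 0 + b' j + \<delta>)) + 1 / \<delta> - tA))"
        using True unfolding E5_def LA_def Q_def
        by (simp only: simp_thms, intro exit_tail_bottom) (use ab0 u u' v v' r \<delta>0 \<delta>1 \<eta>0 \<eta>1 k in force)+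
      also have "(\<Sum>i\<in>{k + 1..m}. 1 / (a' i + b' 0 - \<delta> - \<eta>)) = (\<Sum>i\<in>{k + 1..m}. 1 / (u i - \<delta> - \<eta>))"
        by (intro sum.cong refl) (simp add: u')
      also have "(\<Sum>j\<in>{1..n}. 1 / (a' 0 + b' j + \<delta>)) = (\<Sum>j\<in>{1..n}. 1 / (v j + \<delta>))"
        by (intro sum.cong refl) (simp add: v')
      also have "exp (\<eta> * ((\<Sum>i\<in>{k + 1..m}. 1 / (u i - \<delta> - \<eta>)) + (\<Sum>j\<in>{1..n}. 1 / (v j + \<delta>)) + 1 / \<delta> - tA)) \<le> D * exp (- c * N)"
      proof (rule gain)
        have "(\<Sum>i\<in>{k + 1..m}. 1 / (u i - \<delta> - \<eta>)) + (\<Sum>j\<in>{1..n}. 1 / (v j + \<delta>)) \<le>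
          (\<Sum>i\<in>{k + 1..m}. 1 / u i) + (\<Sum>j\<in>{1..n}. 1 / v j) - \<delta> * e\<^sup>2 / 2 * N + 2 * \<delta> / r\<^sup>2"
          by (rule exit_gain[OF r u v True N e k(3)[OF True] bal1 \<delta>0 \<delta>1 \<delta>2 \<eta>0 \<eta>1 \<eta>2])
        then show "(\<Sum>i\<in>{k + 1..m}. 1 / (u i - \<delta> - \<eta>)) + (\<Sum>j\<in>{1..n}. 1 / (v j + \<delta>)) \<le>
          tA + 3 * e1 * N - \<delta> * e\<^sup>2 / 2 * N + 2 * \<delta> / r\<^sup>2"
          unfolding tA_def SB_def by linarith
      qed
      finally show ?thesis .
    qed (use D0 in \<open>simp add: E5_def\<close>)
    have P6: "prob E6 \<le> D * exp (- c * N)"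
    proof (cases "l < n")
      case True
      have "prob E6 \<le> exp (\<eta> * ((\<Sum>j\<in>{l + 1..n}. 1 / (a' 0 + b' j - \<delta> - \<eta>)) + (\<Sum>i\<in>{1..m}. 1 / (a' i + b' 0 + \<delta>)) + 1 / \<delta> - tB))"
        using True unfolding E6_def LB_def Q_def
        by (simp only: simp_thms, intro exit_tail_left) (use ab0 u u' v v' r \<delta>0 \<delta>1 \<eta>0 \<eta>1 l in force)+
      also have "(\<Sum>j\<in>{l + 1..n}. 1 / (a' 0 + b' j - \<delta> - \<eta>)) = (\<Sum>j\<in>{l + 1..n}. 1 / (v j - \<delta> - \<eta>))"
        by (intro sum.cong refl) (simp add: v')
      also have "(\<Sum>i\<in>{1..m}. 1 / (a' i + b' 0 + \<delta>)) = (\<Sum>i\<in>{1..m}. 1 / (u i + \<delta>))"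
        by (intro sum.cong refl) (simp add: u')
      also have "exp (\<eta> * ((\<Sum>j\<in>{l + 1..n}. 1 / (v j - \<delta> - \<eta>)) + (\<Sum>i\<in>{1..m}. 1 / (u i + \<delta>)) + 1 / \<delta> - tB)) \<le> D * exp (- c * N)"
      proof (rule gain)
        have "(\<Sum>j\<in>{l + 1..n}. 1 / (v j - \<delta> - \<eta>)) + (\<Sum>i\<in>{1..m}. 1 / (u i + \<delta>)) \<le>
          (\<Sum>j\<in>{l + 1..n}. 1 / v j) + (\<Sum>i\<in>{1..m}. 1 / u i) - \<delta> * e\<^sup>2 / 2 * N + 2 * \<delta> / r\<^sup>2"
          by (rule exit_gain[OF r v u True N(2,1) e l(3)[OF True] bal2 \<delta>0 \<delta>1 \<delta>2 \<eta>0 \<eta>1 \<eta>2])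
        then show "(\<Sum>j\<in>{l + 1..n}. 1 / (v j - \<delta> - \<eta>)) + (\<Sum>i\<in>{1..m}. 1 / (u i + \<delta>)) \<le>
          tB + 3 * e1 * N - \<delta> * e\<^sup>2 / 2 * N + 2 * \<delta> / r\<^sup>2"
          unfolding tB_def SA_def by linarith
      qed
      finally show ?thesis .
    qed (use D0 in \<open>simp add: E6_def\<close>)
    define T where "T = SA + SB - \<epsilon> * N"
    have incl: "AE w in Q. w \<in> {w \<in> space Q. lpp w m n < T} \<longrightarrow> w \<in> E1 \<union> (E2 \<union> (E3 \<union> (E4 \<union> (E5 \<union> E6))))"
      using AE_expQ_nonneg[OF finite_cells(2)[of m n], of ?R, folded Q_def]
    proof eventually_elim
      case (elim w)
      show ?case
      proof (rule impI, rule ccontr)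
        assume w: "w \<in> {w \<in> space Q. lpp w m n < T}" and "w \<notin> E1 \<union> (E2 \<union> (E3 \<union> (E4 \<union> (E5 \<union> E6))))"
        then have n: "SB - e1 * N < blpp w m n - Z w" "SA - e1 * N < Z w"
           "X w < (\<Sum>i\<in>{1..k}. 1 / u i) + e1 * N" "Y w < (\<Sum>i\<in>{1..l}. 1 / v i) + e1 * N"
           "k < m \<Longrightarrow> LA w < tA" "l < n \<Longrightarrow> LB w < tB"
          by (auto simp: E1_def E2_def E3_def E4_def E5_def E6_def)
        have SA: "SA = (\<Sum>i\<in>{1..k}. 1 / u i) + (\<Sum>i\<in>{k + 1..m}. 1 / u i)"
          unfolding SA_def by (rule sum_split_at) (rule k)
        have SB: "SB = (\<Sum>i\<in>{1..l}. 1 / v i) + (\<Sum>i\<in>{l + 1..n}. 1 / v i)"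
          unfolding SB_def by (rule sum_split_at) (rule l)
        have eN: "e1 * N \<le> e * N" using e1 N0 by (intro mult_right_mono) auto
        have "blpp w m n \<le> max (X w) (Y w) + lpp w m n \<or> (k < m \<and> blpp w m n \<le> X w + LA w) \<or>
           (l < n \<and> blpp w m n \<le> Y w + LB w)"
          unfolding X_def Y_def LA_def LB_def sum_bottom sum_left
          by (rule blpp_exit) (use elim k l in auto)
        then show False
        proof (elim disjE conjE)
          assume "blpp w m n \<le> max (X w) (Y w) + lpp w m n"
          then have "SA + SB - 2 * (e1 * N) - (e * N + e1 * N) < lpp w m n"
            using n(1-4) k(2) l(2) by linarith
          moreover have "\<epsilon> * N = 8 * (e * N)" by (simp add: e_def)
          moreover have "0 \<le> e * N" using e N0 by simp
          moreover have "lpp w m n < SA + SB - \<epsilon> * N" using w by (simp add: T_def)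
          ultimately show False using eN by linarith
        next
          assume "k < m" "blpp w m n \<le> X w + LA w"
          then show False using n SA unfolding tA_def by simp
        next
          assume "l < n" "blpp w m n \<le> Y w + LB w"
          then show False using n SB unfolding tB_def by simp
        qed
      qed
    qed
    have "\<P>(w in expQ (rates a b) (cells m n). lpp w m n < T) =
       prob {w \<in> space Q. lpp w m n < T}"
    proof -
      have eq: "expQ (rates a b) (cells m n) = expQ ?R (cells m n)"
        unfolding expQ_def by (intro PiM_cong refl) (auto simp: rates_def a'_def b'_def cells_def)
      have "prob {w \<in> space Q. lpp (\<lambda>c\<in>cells m n. w c) m n < T} =
        \<P>(w in expQ ?R (cells m n). lpp w m n < T)"
        unfolding Q_def
        by (rule measure_expQ_reindex)
          (use cells_subset_bd measurable_lpp_expQ[OF subset_refl, of m n ?R] in \<open>auto intro: borel_measurable_less\<close>)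
      moreover have "lpp (\<lambda>c\<in>cells m n. w c) m n = lpp w m n" for w
        by (rule lpp_cong) simp
      ultimately show ?thesis unfolding eq by simp
    qed
    also have "prob {w \<in> space Q. lpp w m n < T} \<le> prob (E1 \<union> (E2 \<union> (E3 \<union> (E4 \<union> (E5 \<union> E6)))))"
      using incl by (intro finite_measure_mono_AE) auto
    also have "\<dots> \<le> prob E1 + (prob E2 + (prob E3 + (prob E4 + (prob E5 + prob E6))))"
      by (intro order_trans[OF measure_Un_le] add_mono order_refl) auto
    also have "\<dots> \<le> exp (- c * N) + (exp (- c * N) + (exp (- c * N) + (exp (- c * N) + (D * exp (- c * N) + D * exp (- c * N)))))"
      using P1 P2 P3 P4 P5 P6 by (intro add_mono)
    also have "\<dots> = (4 + 2 * D) * exp (- c * N)" by (simp add: algebra_simps)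
    finally show "\<P>(w in expQ (rates a b) (cells m n). lpp w m n < (\<Sum>i\<in>{1..m}. 1 / (a i + z)) + (\<Sum>j\<in>{1..n}. 1 / (b j - z)) - \<epsilon> * N) \<le> (4 + 2 * D) * exp (- c * N)"
      unfolding T_def SA_def SB_def u_def v_def .
  qed
qed

section \<open>Lower tail in all directions\<close>

lemma lpp_mono:
  assumes "p \<le> p'" "q \<le> q'" "\<And>c. c \<in> cells p' q' \<Longrightarrow> 0 \<le> w c"
  shows "lpp w p q \<le> lpp w p' q'"
proof -
  have 1: "lpp w p q \<le> lpp w p' q" if "p \<le> p'" "\<And>c. c \<in> cells p' q \<Longrightarrow> 0 \<le> w c" for p p' q
    using that
  proof (induction p' rule: dec_induct)
    case (step k)
    have IH: "lpp w p q \<le> lpp w k q" by (rule step.IH) (use step.prems in \<open>auto simp: cells_def\<close>)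
    show ?case
    proof (cases q)
      case (Suc q')
      have "0 \<le> w (Suc k, q)" using step.prems Suc by (auto simp: cells_def)
      then show ?thesis using IH Suc by simp
    qed simp
  qed simp
  have 2: "lpp w p q \<le> lpp w p q'" if "q \<le> q'" "\<And>c. c \<in> cells p q' \<Longrightarrow> 0 \<le> w c" for p q q'
    using that
  proof (induction q' rule: dec_induct)
    case (step k)
    have IH: "lpp w p q \<le> lpp w p k" by (rule step.IH) (use step.prems in \<open>auto simp: cells_def\<close>)
    show ?case
    proof (cases p)
      case (Suc p')
      have "0 \<le> w (p, Suc k)" using step.prems Suc by (auto simp: cells_def)
      then show ?thesis using IH Suc by simp
    qed simp
  qed simp
  have "lpp w p q \<le> lpp w p q'" by (rule 2) (use assms in \<open>auto simp: cells_def\<close>)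
  also have "\<dots> \<le> lpp w p' q'" by (rule 1) (use assms in \<open>auto simp: cells_def\<close>)
  finally show ?thesis .
qed

lemma lpp_shift_superadditive:
  assumes "\<And>c. c \<in> cells (p + i) (q + j) \<Longrightarrow> 0 \<le> w c"
  shows "lpp w p q + lpp (\<lambda>(i, j). w (p + i, q + j)) i j \<le> lpp w (p + i) (q + j)"
  using assms
proof (induction i arbitrary: j)
  case 0
  then show ?case using lpp_mono[of p p q "q + j" w] by simp
next
  case (Suc i)
  note IHi = Suc.IH
  show ?case using Suc.prems
  proof (induction j)
    case 0
    then show ?case using lpp_mono[of p "p + Suc i" q q w] by simp
  next
    case (Suc j)
    have "lpp w p q + lpp (\<lambda>(i, j). w (p + i, q + j)) i (Suc j) \<le> lpp w (p + i) (q + Suc j)"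
      by (rule IHi) (use Suc.prems in \<open>auto simp: cells_def\<close>)
    moreover have "lpp w p q + lpp (\<lambda>(i, j). w (p + i, q + j)) (Suc i) j \<le> lpp w (p + Suc i) (q + j)"
      by (rule Suc.IH) (use Suc.prems in \<open>auto simp: cells_def\<close>)
    ultimately show ?case by auto
  qed
qed

lemma lpp_column_extend:
  assumes "1 \<le> i" "j1 \<le> j2"
  shows "lpp w i j1 + (\<Sum>j\<in>{j1 + 1..j2}. w (i, j)) \<le> lpp w i j2"
  using assms(2)
proof (induction j2 rule: dec_induct)
  case (step k)
  obtain i' where "i = Suc i'" using assms(1) by (cases i) auto
  then have "lpp w i k + w (i, Suc k) \<le> lpp w i (Suc k)" by simp
  then show ?case using step by simp
qed simp

lemma lpp_swap: "lpp (\<lambda>(i, j). w (j, i)) n m = lpp w m n"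
proof (induction w m n rule: lpp.induct)
  case (3 w i j)
  then show ?case by (simp add: max.commute)
qed simp_all

lemma measure_lpp_shift:
  assumes "p + m' \<le> m" "q + n' \<le> n"
  shows "\<P>(w in expQ (rates a b) (cells m n). lpp (\<lambda>(i, j). w (p + i, q + j)) m' n' < s) =
    measure (expQ (rates (\<lambda>i. a (p + i)) (\<lambda>j. b (q + j))) (cells m' n'))
      {w \<in> space (expQ (rates (\<lambda>i. a (p + i)) (\<lambda>j. b (q + j))) (cells m' n')). lpp w m' n' < s}"
proof -
  define t where "t = (\<lambda>(i, j). (p + i, q + j))"
  let ?K = "cells m' n'"
  have R: "rates (\<lambda>i. a (p + i)) (\<lambda>j. b (q + j)) = (\<lambda>c. rates a b (t c))"
    by (auto simp: rates_def t_def fun_eq_iff)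
  have t: "inj_on t ?K" "t ` ?K \<subseteq> cells m n"
    using assms by (auto simp: t_def cells_def inj_on_def)
  have "lpp (\<lambda>(i, j). w (p + i, q + j)) m' n' = lpp (\<lambda>c\<in>?K. w (t c)) m' n'" for w :: "nat \<times> nat \<Rightarrow> real"
    by (rule lpp_cong) (auto simp: t_def)
  moreover have "\<P>(w in expQ (rates a b) (cells m n). lpp (\<lambda>c\<in>?K. w (t c)) m' n' < s) =
    measure (expQ (\<lambda>c. rates a b (t c)) ?K) {w \<in> space (expQ (\<lambda>c. rates a b (t c)) ?K). lpp w m' n' < s}"
    by (rule measure_expQ_reindex[OF t])
      (use measurable_lpp_expQ[OF subset_refl, of m' n' "\<lambda>c. rates a b (t c)"] in measurable)
  ultimately show ?thesis unfolding R by simp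
qed

lemma measure_lpp_swap:
  "\<P>(w in expQ (rates b a) (cells n m). lpp w n m < s) =
   \<P>(w in expQ (rates a b) (cells m n). lpp w m n < s)"
proof -
  define t where "t = (\<lambda>(i :: nat, j :: nat). (j, i))"
  let ?K = "cells n m"
  have R: "rates b a = (\<lambda>c. rates a b (t c))"
    by (auto simp: rates_def t_def fun_eq_iff)
  have t: "inj_on t ?K" "t ` ?K \<subseteq> cells m n"
    by (auto simp: t_def cells_def inj_on_def)
  have "lpp w m n = lpp (\<lambda>c\<in>?K. w (t c)) n m" for w :: "nat \<times> nat \<Rightarrow> real"
    unfolding lpp_swap[symmetric, of w] by (rule lpp_cong) (auto simp: t_def)
  moreover have "\<P>(w in expQ (rates a b) (cells m n). lpp (\<lambda>c\<in>?K. w (t c)) n m < s) =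
    measure (expQ (\<lambda>c. rates a b (t c)) ?K) {w \<in> space (expQ (\<lambda>c. rates a b (t c)) ?K). lpp w n m < s}"
    by (rule measure_expQ_reindex[OF t])
      (use measurable_lpp_expQ[OF subset_refl, of n m "\<lambda>c. rates a b (t c)"] in measurable)
  ultimately show ?thesis unfolding R by simp
qed

text \<open>The path is balanced up to column \<open>p\<close>, then climbs this column, and is balanced again afterwards.\<close>

lemma lpp_lower_tail_column:
  fixes r \<epsilon> :: real
  assumes r: "0 < r" and \<epsilon>: "0 < \<epsilon>"
  shows "\<exists>c>0. \<exists>C>0. \<forall>a b z m n N p. p \<in> {1..m} \<longrightarrow> (\<forall>i\<in>{1..m}. r \<le> a i + z) \<longrightarrow> (\<forall>j\<in>{1..n}. r \<le> b j - z) \<longrightarrow>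
    (\<Sum>i\<in>{1..m}. (1 / (a i + z))\<^sup>2) \<le> (\<Sum>j\<in>{1..n}. (1 / (b j - z))\<^sup>2) \<longrightarrow>
    real m \<le> N \<longrightarrow> real n \<le> N \<longrightarrow>
    \<P>(w in expQ (rates a b) (cells m n). lpp w m n < (\<Sum>i\<in>{1..m}. 1 / (a i + z)) + (\<Sum>j\<in>{1..n}. 1 / (a p + b j)) - \<epsilon> * N) \<le> C * exp (- c * N)"
proof -
  define e where "e = \<epsilon> / 3"
  have e: "0 < e" using \<epsilon> by (simp add: e_def)
  obtain c1 C1 where c1: "0 < c1" "0 < C1" and BL: "\<And>a b z m n N. (\<forall>i\<in>{1..m}. r \<le> a i + z) \<Longrightarrow> (\<forall>j\<in>{1..n}. r \<le> b j - z) \<Longrightarrow>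
    \<bar>(\<Sum>i\<in>{1..m}. (1 / (a i + z))\<^sup>2) - (\<Sum>j\<in>{1..n}. (1 / (b j - z))\<^sup>2)\<bar> \<le> 1 / r\<^sup>2 \<Longrightarrow>
    real m \<le> N \<Longrightarrow> real n \<le> N \<Longrightarrow>
    \<P>(w in expQ (rates a b) (cells m n). lpp w m n < (\<Sum>i\<in>{1..m}. 1 / (a i + z)) + (\<Sum>j\<in>{1..n}. 1 / (b j - z)) - e * N) \<le> C1 * exp (- c1 * N)"
    using lpp_lower_tail_balanced[OF r e] by blast
  define c where "c = min c1 (tail_rate r e)"
  have c0: "0 < c" using c1 r e by (simp add: c_def tail_rate_pos)
  show ?thesis
  proof (rule exI[of _ c], intro conjI c0, rule exI[of _ "1 + 2 * C1"], intro conjI allI impI)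
    show "0 < 1 + 2 * C1" using c1 by simp
  next
    fix a b :: "nat \<Rightarrow> real" and z :: real and m n :: nat and N :: real and p :: nat
    assume p: "p \<in> {1..m}" and a: "\<forall>i\<in>{1..m}. r \<le> a i + z" and b: "\<forall>j\<in>{1..n}. r \<le> b j - z"
      and bal: "(\<Sum>i\<in>{1..m}. (1 / (a i + z))\<^sup>2) \<le> (\<Sum>j\<in>{1..n}. (1 / (b j - z))\<^sup>2)"
      and N: "real m \<le> N" "real n \<le> N"
    have N0: "0 \<le> N" using N by linarith
    define u where "u i = a i + z" for i
    define v where "v j = b j - z" for j
    have u: "r \<le> u i" if "i \<in> {1..m}" for i using a that by (simp add: u_def)
    have v: "r \<le> v i" if "i \<in> {1..n}" for i using b that by (simp add: v_def)
    have bal': "(\<Sum>i\<in>{1..m}. (1 / u i)\<^sup>2) \<le> (\<Sum>j\<in>{1..n}. (1 / v j)\<^sup>2)" using bal by (simp add: u_def v_def)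
    define A2 where "A2 I = (\<Sum>i\<in>I. (1 / u i)\<^sup>2)" for I
    define B2 where "B2 I = (\<Sum>i\<in>I. (1 / v i)\<^sup>2)" for I
    have A2s: "A2 {1..m} = A2 {1..p} + A2 {p + 1..m}"
      unfolding A2_def by (rule sum_split_at) (use p in simp)
    have A2n: "0 \<le> A2 I" "0 \<le> B2 I" for I by (auto simp: A2_def B2_def intro: sum_nonneg)
    have B2s: "B2 {1..n} = B2 {1..j} + B2 {j + 1..n}" if "j \<le> n" for j
      unfolding B2_def by (rule sum_split_at) (use that in simp)
    have B2S: "B2 {1..Suc j} \<le> B2 {1..j} + 1 / r\<^sup>2" if "j < n" for j
    proof -
      have "r \<le> v (Suc j)" using that by (intro v) simp
      then have "1 / v (Suc j) \<le> 1 / r" "0 \<le> 1 / v (Suc j)" using r by (auto intro!: divide_left_mono mult_pos_pos)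
      then have "(1 / v (Suc j))\<^sup>2 \<le> (1 / r)\<^sup>2" by (intro power_mono)
      then show ?thesis by (simp add: B2_def power_one_over)
    qed
    have AB: "A2 {1..m} \<le> B2 {1..n}" using bal' by (simp add: A2_def B2_def)
    \<comment> \<open>Rows up to \<open>j1\<close> balance the columns up to \<open>p\<close>,
      within one summand.\<close>
    obtain j1 where j1: "j1 \<le> n" "B2 {1..j1} \<le> A2 {1..p}" "j1 < n \<Longrightarrow> A2 {1..p} < B2 {1..Suc j1}"
      using obtain_threshold_index[of "A2 {1..p}" n "\<lambda>i. (1 / v i)\<^sup>2"] A2n by (auto simp: B2_def)
    \<comment> \<open>Likewise the rows above \<open>j2\<close> balance the columns after
      \<open>p\<close>. The rows have at least as much total square weight as the columns, so the
      two groups of rows do not overlap, and the rows in between are crossed inside column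
      \<open>p\<close>.\<close>
    define t where "t = B2 {1..n} - A2 {p + 1..m}"
    have t: "A2 {1..p} \<le> t" using AB A2s by (simp add: t_def)
    obtain j2 where j2: "j2 \<le> n" "B2 {1..j2} \<le> t" "j2 < n \<Longrightarrow> t < B2 {1..Suc j2}"
      using obtain_threshold_index[of t n "\<lambda>i. (1 / v i)\<^sup>2"] A2n(1)[of "{1..p}"] t by (auto simp: B2_def)
    have j12: "j1 \<le> j2"
    proof (rule ccontr)
      assume "\<not> j1 \<le> j2"
      then have "j2 < n" "{1..Suc j2} \<subseteq> {1..j1}" using j1 by auto
      moreover from this have "B2 {1..Suc j2} \<le> B2 {1..j1}" unfolding B2_def by (intro sum_mono2) auto
      ultimately show False using j2(3) j1(2) t by linarith
    qed
    have bal1: "\<bar>A2 {1..p} - B2 {1..j1}\<bar> \<le> 1 / r\<^sup>2"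
    proof (cases "j1 < n")
      case True then show ?thesis using j1 B2S[OF True] by auto
    next
      case False
      then have "j1 = n" using j1 by simp
      then have "A2 {1..p} - B2 {1..j1} = 0" using j1(2) AB A2s A2n(1)[of "{p + 1..m}"] by simp
      then show ?thesis by simp
    qed
    have bal2: "\<bar>A2 {p + 1..m} - B2 {j2 + 1..n}\<bar> \<le> 1 / r\<^sup>2"
    proof -
      have "B2 {j2 + 1..n} - A2 {p + 1..m} = t - B2 {1..j2}" using B2s[OF j2(1)] by (simp add: t_def)
      moreover have "t - B2 {1..j2} \<le> 1 / r\<^sup>2"
      proof (cases "j2 < n")
        case True then show ?thesis using j2(3) B2S[OF True] by auto
      next
        case False
        then have "j2 = n" using j2 by simp
        then have "t - B2 {1..j2} \<le> 0" using A2n(1)[of "{p + 1..m}"] by (simp add: t_def)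
        then show ?thesis by (rule order_trans) simp
      qed
      ultimately show ?thesis using j2(2) by auto
    qed
    let ?R = "rates a b"
    define Q where "Q = expQ ?R (cells m n)"
    interpret prob_space Q unfolding Q_def by (rule prob_space_expQ)
    let ?K = "{p} \<times> {j1 + 1..j2}"
    define L1 where "L1 w = lpp (\<lambda>(i, j). w (0 + i, 0 + j)) p j1" for w :: "nat \<times> nat \<Rightarrow> real"
    define L2 where "L2 w = (\<Sum>c\<in>?K. w c)" for w :: "nat \<times> nat \<Rightarrow> real"
    define L3 where "L3 w = lpp (\<lambda>(i, j). w (p + i, j2 + j)) (m - p) (n - j2)" for w :: "nat \<times> nat \<Rightarrow> real"
    have [measurable]: "L1 \<in> borel_measurable Q" "L3 \<in> borel_measurable Q"
      unfolding L1_def L3_def Q_def split_beta' using p j1(1) j2(1)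
      by (auto intro!: measurable_lpp_reindex simp: cells_def)
    have K: "?K \<subseteq> cells m n" using p j2(1) by (auto simp: cells_def)
    have [measurable]: "L2 \<in> borel_measurable Q"
      unfolding L2_def Q_def by (rule measurable_sum_expQ) (rule K)
    have [measurable]: "(\<lambda>w. lpp w m n) \<in> borel_measurable Q"
      unfolding Q_def by (rule measurable_lpp_expQ) simp
    define s1 where "s1 = (\<Sum>i\<in>{1..p}. 1 / u i) + (\<Sum>j\<in>{1..j1}. 1 / v j) - e * N"
    define s2 where "s2 = (\<Sum>j\<in>{j1 + 1..j2}. 1 / (a p + b j)) - e * N"
    define s3 where "s3 = (\<Sum>i\<in>{p + 1..m}. 1 / u i) + (\<Sum>j\<in>{j2 + 1..n}. 1 / v j) - e * N"
    define E1 where "E1 = {w \<in> space Q. L1 w < s1}"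
    define E2 where "E2 = {w \<in> space Q. L2 w \<le> s2}"
    define E3 where "E3 = {w \<in> space Q. L3 w < s3}"
    have [measurable]: "E1 \<in> events" "E2 \<in> events" "E3 \<in> events"
      unfolding E1_def E2_def E3_def by measurable
    have cN: "exp (- c1 * N) \<le> exp (- c * N)" "exp (- tail_rate r e * N) \<le> exp (- c * N)"
      using N0 by (auto intro!: mult_right_mono simp: c_def)
    have sh: "(\<Sum>i\<in>{q + 1..l}. f i) = (\<Sum>i\<in>{1..l - q}. f (q + i))" if "q \<le> l" for f :: "nat \<Rightarrow> real" and q l
      using sum.shift_bounds_cl_nat_ivl[of f 1 q "l - q"] that by (simp add: add.commute)
    have P1: "prob E1 \<le> C1 * exp (- c * N)"
    proof -
      have "prob E1 = measure (expQ (rates (\<lambda>i. a (0 + i)) (\<lambda>j. b (0 + j))) (cells p j1))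
        {w \<in> space (expQ (rates (\<lambda>i. a (0 + i)) (\<lambda>j. b (0 + j))) (cells p j1)). lpp w p j1 < s1}"
        unfolding E1_def L1_def Q_def by (rule measure_lpp_shift) (use p j1(1) in auto)
      also have "\<dots> \<le> C1 * exp (- c1 * N)"
        using BL[of p a z j1 b N] a b bal1 p j1(1) N by (simp add: s1_def u_def v_def A2_def B2_def)
      also have "\<dots> \<le> C1 * exp (- c * N)" using cN c1 by (intro mult_left_mono) auto
      finally show ?thesis .
    qed
    have P3: "prob E3 \<le> C1 * exp (- c * N)"
    proof -
      have pm: "p \<le> m" using p by simp
      have ab': "\<forall>i\<in>{1..m - p}. r \<le> a (p + i) + z" "\<forall>j\<in>{1..n - j2}. r \<le> b (j2 + j) - z"
        using a b p j2(1) by auto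
      have "prob E3 = measure (expQ (rates (\<lambda>i. a (p + i)) (\<lambda>j. b (j2 + j))) (cells (m - p) (n - j2)))
        {w \<in> space (expQ (rates (\<lambda>i. a (p + i)) (\<lambda>j. b (j2 + j))) (cells (m - p) (n - j2))). lpp w (m - p) (n - j2) < s3}"
        unfolding E3_def L3_def Q_def by (rule measure_lpp_shift) (use p j2(1) in auto)
      also have "\<dots> \<le> C1 * exp (- c1 * N)"
        using BL[of "m - p" "\<lambda>i. a (p + i)" z "n - j2" "\<lambda>j. b (j2 + j)" N] ab' bal2 p j2(1) N
        unfolding s3_def u_def v_def A2_def B2_def sh[OF pm] sh[OF j2(1)] by simp
      also have "\<dots> \<le> C1 * exp (- c * N)" using cN c1 by (intro mult_left_mono) auto
      finally show ?thesis .
    qed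
    \<comment> \<open>The rate a p + b j equals u p + v j, so it exceeds v j. In the balanced pieces
      the mean can therefore be lowered to 1 / (a p + b j), which gives one sum over all
      rows.\<close>
    have ab: "r \<le> a p + b j" "1 / (a p + b j) \<le> 1 / v j" if "j \<in> {1..n}" for j
    proof -
      have "a p + b j = u p + v j" by (simp add: u_def v_def)
      moreover have "r \<le> v j" "r \<le> u p" using u[OF p] v[OF that] by auto
      ultimately show "r \<le> a p + b j" "1 / (a p + b j) \<le> 1 / v j"
        using r by (auto intro!: divide_left_mono)
    qed
    have P2: "prob E2 \<le> exp (- c * N)"
    proof -
      have img: "?K = Pair p ` {j1 + 1..j2}" by auto
      have "(\<Sum>c\<in>?K. 1 / ?R c) = (\<Sum>j\<in>{j1 + 1..j2}. 1 / (a p + b j))"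
        unfolding img by (subst sum.reindex) (auto simp: inj_on_def rates_def)
      moreover have "prob {w \<in> space Q. (\<Sum>c\<in>?K. w c) \<le> (\<Sum>c\<in>?K. 1 / ?R c) - e * N} \<le> exp (- tail_rate r e * N)"
        unfolding Q_def
      proof (rule expQ_sum_lower_tail)
        show "r \<le> ?R c" if "c \<in> ?K" for c using ab(1) that j2(1) by (auto simp: rates_def)
      qed (use K r e N j2(1) in auto)
      ultimately show ?thesis unfolding E2_def L2_def s2_def
        by - (rule order_trans[OF _ cN(2)], simp)
    qed
    define T where "T = (\<Sum>i\<in>{1..m}. 1 / u i) + (\<Sum>j\<in>{1..n}. 1 / (a p + b j)) - \<epsilon> * N"
    have T: "T \<le> s1 + s2 + s3"
    proof -
      have "(\<Sum>i\<in>{1..m}. 1 / u i) = (\<Sum>i\<in>{1..p}. 1 / u i) + (\<Sum>i\<in>{p + 1..m}. 1 / u i)"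
        by (rule sum_split_at) (use p in simp)
      moreover have "(\<Sum>j\<in>{1..n}. 1 / (a p + b j)) = (\<Sum>j\<in>{1..j2}. 1 / (a p + b j)) + (\<Sum>j\<in>{j2 + 1..n}. 1 / (a p + b j))"
        by (rule sum_split_at) (use j2 in simp)
      moreover have "(\<Sum>j\<in>{1..j2}. 1 / (a p + b j)) = (\<Sum>j\<in>{1..j1}. 1 / (a p + b j)) + (\<Sum>j\<in>{j1 + 1..j2}. 1 / (a p + b j))"
        by (rule sum_split_at) (use j12 in simp)
      moreover have "(\<Sum>j\<in>{1..j1}. 1 / (a p + b j)) \<le> (\<Sum>j\<in>{1..j1}. 1 / v j)"
        "(\<Sum>j\<in>{j2 + 1..n}. 1 / (a p + b j)) \<le> (\<Sum>j\<in>{j2 + 1..n}. 1 / v j)"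
        using j1(1) by (auto intro!: sum_mono ab)
      moreover have "\<epsilon> * N = 3 * (e * N)" by (simp add: e_def)
      ultimately show ?thesis unfolding T_def s1_def s2_def s3_def by linarith
    qed
    have incl: "AE w in Q. w \<in> {w \<in> space Q. lpp w m n < T} \<longrightarrow> w \<in> E1 \<union> (E2 \<union> E3)"
      using AE_expQ_nonneg[OF finite_cells(1)[of m n], of ?R, folded Q_def]
    proof eventually_elim
      case (elim w)
      have 1: "L1 w = lpp w p j1" unfolding L1_def by (rule lpp_cong) auto
      have img: "?K = Pair p ` {j1 + 1..j2}" by auto
      have 2: "L2 w = (\<Sum>j\<in>{j1 + 1..j2}. w (p, j))"
        unfolding L2_def img by (subst sum.reindex) (auto simp: inj_on_def)
      have "L1 w + L2 w \<le> lpp w p j2"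
        unfolding 1 2 by (rule lpp_column_extend) (use p j12 in auto)
      moreover have "lpp w p j2 + L3 w \<le> lpp w (p + (m - p)) (j2 + (n - j2))"
        unfolding L3_def by (rule lpp_shift_superadditive) (use p j2(1) elim in auto)
      moreover have "p + (m - p) = m" "j2 + (n - j2) = n" using p j2(1) by auto
      ultimately have "L1 w + L2 w + L3 w \<le> lpp w m n" by simp
      then show ?case using T by (auto simp: E1_def E2_def E3_def)
    qed
    have "prob {w \<in> space Q. lpp w m n < T} \<le> prob (E1 \<union> (E2 \<union> E3))"
      using incl by (intro finite_measure_mono_AE) auto
    also have "\<dots> \<le> prob E1 + (prob E2 + prob E3)"
      by (intro order_trans[OF measure_Un_le] add_mono order_refl) auto
    also have "\<dots> \<le> C1 * exp (- c * N) + (exp (- c * N) + C1 * exp (- c * N))"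
      using P1 P2 P3 by (intro add_mono)
    also have "\<dots> = (1 + 2 * C1) * exp (- c * N)" by (simp add: algebra_simps)
    finally show "\<P>(w in expQ (rates a b) (cells m n). lpp w m n < (\<Sum>i\<in>{1..m}. 1 / (a i + z)) + (\<Sum>j\<in>{1..n}. 1 / (a p + b j)) - \<epsilon> * N) \<le> (1 + 2 * C1) * exp (- c * N)"
      unfolding T_def u_def Q_def .
  qed
qed

text \<open>If the derivative of the stationary mean changes sign on [z0, z1], a zero is balanced.
  Otherwise the mean is smallest at an endpoint: a nonnegative derivative at z0 calls for following
  column \<open>p\<close>, a nonpositive one at z1 for following row \<open>q\<close>. The
  conditions on \<open>p\<close> and \<open>q\<close> say that z0 is almost -a p and z1 almost b q,
  so the replacement costs a second \<epsilon> N.\<close>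

lemma lpp_lower_tail:
  fixes r \<epsilon> :: real
  assumes r: "0 < r" and \<epsilon>: "0 < \<epsilon>"
  shows "\<exists>c>0. \<exists>C>0. \<forall>a b z0 z1 m n N p q. z0 \<le> z1 \<longrightarrow> p \<in> {1..m} \<longrightarrow> q \<in> {1..n} \<longrightarrow>
    (\<forall>i\<in>{1..m}. r \<le> a i + z0) \<longrightarrow> (\<forall>j\<in>{1..n}. r \<le> b j - z1) \<longrightarrow>
    (\<forall>j\<in>{1..n}. 1 / (b j - z0) \<le> 1 / (a p + b j) + \<epsilon>) \<longrightarrow>
    (\<forall>i\<in>{1..m}. 1 / (a i + z1) \<le> 1 / (a i + b q) + \<epsilon>) \<longrightarrow>
    real m \<le> N \<longrightarrow> real n \<le> N \<longrightarrow>
    (\<exists>z\<in>{z0..z1}. \<P>(w in expQ (rates a b) (cells m n). lpp w m n < (\<Sum>i\<in>{1..m}. 1 / (a i + z)) + (\<Sum>j\<in>{1..n}. 1 / (b j - z)) - 2 * \<epsilon> * N) \<le> C * exp (- c * N))"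
proof -
  obtain c1 C1 where c1: "0 < c1" "0 < C1" and BL: "\<And>a b z m n N. (\<forall>i\<in>{1..m}. r \<le> a i + z) \<Longrightarrow> (\<forall>j\<in>{1..n}. r \<le> b j - z) \<Longrightarrow>
    \<bar>(\<Sum>i\<in>{1..m}. (1 / (a i + z))\<^sup>2) - (\<Sum>j\<in>{1..n}. (1 / (b j - z))\<^sup>2)\<bar> \<le> 1 / r\<^sup>2 \<Longrightarrow>
    real m \<le> N \<Longrightarrow> real n \<le> N \<Longrightarrow>
    \<P>(w in expQ (rates a b) (cells m n). lpp w m n < (\<Sum>i\<in>{1..m}. 1 / (a i + z)) + (\<Sum>j\<in>{1..n}. 1 / (b j - z)) - \<epsilon> * N) \<le> C1 * exp (- c1 * N)"
    using lpp_lower_tail_balanced[OF r \<epsilon>] by blast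
  obtain c2 C2 where c2: "0 < c2" "0 < C2" and FL: "\<And>a b z m n N p. p \<in> {1..m} \<Longrightarrow> (\<forall>i\<in>{1..m}. r \<le> a i + z) \<Longrightarrow> (\<forall>j\<in>{1..n}. r \<le> b j - z) \<Longrightarrow>
    (\<Sum>i\<in>{1..m}. (1 / (a i + z))\<^sup>2) \<le> (\<Sum>j\<in>{1..n}. (1 / (b j - z))\<^sup>2) \<Longrightarrow>
    real m \<le> N \<Longrightarrow> real n \<le> N \<Longrightarrow>
    \<P>(w in expQ (rates a b) (cells m n). lpp w m n < (\<Sum>i\<in>{1..m}. 1 / (a i + z)) + (\<Sum>j\<in>{1..n}. 1 / (a p + b j)) - \<epsilon> * N) \<le> C2 * exp (- c2 * N)"
    using lpp_lower_tail_column[OF r \<epsilon>] by blast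
  define c where "c = min c1 c2"
  define C where "C = max C1 C2"
  show ?thesis
  proof (rule exI[of _ c], intro conjI, simp add: c_def c1 c2, rule exI[of _ C], intro conjI allI impI)
    show "0 < C" using c1 by (simp add: C_def)
  next
    fix a b :: "nat \<Rightarrow> real" and z0 z1 :: real and m n :: nat and N :: real and p q :: nat
    assume z01: "z0 \<le> z1" and p: "p \<in> {1..m}" and q: "q \<in> {1..n}"
      and a: "\<forall>i\<in>{1..m}. r \<le> a i + z0" and b: "\<forall>j\<in>{1..n}. r \<le> b j - z1"
      and ap: "\<forall>j\<in>{1..n}. 1 / (b j - z0) \<le> 1 / (a p + b j) + \<epsilon>"
      and bq: "\<forall>i\<in>{1..m}. 1 / (a i + z1) \<le> 1 / (a i + b q) + \<epsilon>"
      and N: "real m \<le> N" "real n \<le> N"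
    have N0: "0 \<le> N" using N by linarith
    let ?Q = "expQ (rates a b) (cells m n)"
    interpret prob_space ?Q by (rule prob_space_expQ)
    define F where "F s = prob {w \<in> space ?Q. lpp w m n < s}" for s
    have Fm: "F s \<le> F s'" if "s \<le> s'" for s s'
      unfolding F_def using that measurable_lpp_expQ[OF subset_refl, of m n "rates a b"]
      by (intro finite_measure_mono) auto
    have a': "\<forall>i\<in>{1..m}. r \<le> a i + z" if "z \<in> {z0..z1}" for z
      using a that by (smt (verit) atLeastAtMost_iff)
    have b': "\<forall>j\<in>{1..n}. r \<le> b j - z" if "z \<in> {z0..z1}" for z
      using b that by (smt (verit) atLeastAtMost_iff)
    have CE: "C1 * exp (- c1 * N) \<le> C * exp (- c * N)" "C2 * exp (- c2 * N) \<le> C * exp (- c * N)"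
      using N0 c1 c2 by (auto simp: c_def C_def intro!: mult_mono mult_right_mono)
    define A where "A z = (\<Sum>i\<in>{1..m}. 1 / (a i + z))" for z
    define B where "B z = (\<Sum>j\<in>{1..n}. 1 / (b j - z))" for z
    \<comment> \<open>This is the derivative of \<open>A z + B z\<close>.\<close>
    define D where "D z = (\<Sum>j\<in>{1..n}. (1 / (b j - z))\<^sup>2) - (\<Sum>i\<in>{1..m}. (1 / (a i + z))\<^sup>2)" for z
    have "\<exists>z\<in>{z0..z1}. F (A z + B z - 2 * \<epsilon> * N) \<le> C * exp (- c * N)"
    proof (cases "0 \<le> D z0")
      case True
      have z: "z0 \<in> {z0..z1}" using z01 by simp
      have "B z0 \<le> (\<Sum>j\<in>{1..n}. 1 / (a p + b j) + \<epsilon>)"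
        unfolding B_def using ap by (intro sum_mono) auto
      also have "\<dots> = (\<Sum>j\<in>{1..n}. 1 / (a p + b j)) + real n * \<epsilon>" by (simp add: sum.distrib)
      also have "real n * \<epsilon> \<le> N * \<epsilon>" using N \<epsilon> by (intro mult_right_mono) auto
      finally have "F (A z0 + B z0 - 2 * \<epsilon> * N) \<le> F (A z0 + (\<Sum>j\<in>{1..n}. 1 / (a p + b j)) - \<epsilon> * N)"
        by (intro Fm) (simp add: algebra_simps)
      also have "\<dots> \<le> C2 * exp (- c2 * N)"
        unfolding F_def A_def using True by (intro FL p a' b' z N) (simp add: D_def)
      finally show ?thesis using CE(2) z by (intro bexI[of _ z0]) auto
    next
      case False
      show ?thesis
      proof (cases "D z1 \<le> 0")
        case True
        have z: "z1 \<in> {z0..z1}" using z01 by simp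
        have "A z1 \<le> (\<Sum>i\<in>{1..m}. 1 / (a i + b q) + \<epsilon>)"
          unfolding A_def using bq by (intro sum_mono) auto
        also have "\<dots> = (\<Sum>i\<in>{1..m}. 1 / (b q + a i)) + real m * \<epsilon>" by (simp add: sum.distrib add.commute)
        also have "real m * \<epsilon> \<le> N * \<epsilon>" using N \<epsilon> by (intro mult_right_mono) auto
        finally have "F (A z1 + B z1 - 2 * \<epsilon> * N) \<le> F (B z1 + (\<Sum>i\<in>{1..m}. 1 / (b q + a i)) - \<epsilon> * N)"
          by (intro Fm) (simp add: algebra_simps)
        \<comment> \<open>The column estimate is applied to the transposed rectangle, where z1
          becomes -z1.\<close>
        also have "\<dots> \<le> C2 * exp (- c2 * N)"
          unfolding F_def measure_lpp_swap[where a=a and b=b and m=m and n=n, symmetric]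
          using FL[of q n b "- z1" m a N] q a'[OF z] b'[OF z] True N by (simp add: B_def D_def)
        finally show ?thesis using CE(2) z by (intro bexI[of _ z1]) auto
      next
        case F2: False
        have "continuous_on {z0..z1} D"
          unfolding D_def
        proof (intro continuous_intros)
          show "\<forall>z\<in>{z0..z1}. b j - z \<noteq> 0" if "j \<in> {1..n}" for j using b' that r by fastforce
          show "\<forall>z\<in>{z0..z1}. a i + z \<noteq> 0" if "i \<in> {1..m}" for i using a' that r by fastforce
        qed
        then obtain z where z: "z0 \<le> z" "z \<le> z1" "D z = 0"
          using IVT'[of D z0 0 z1] False F2 z01 by auto
        then have zz: "z \<in> {z0..z1}" by simp
        have "F (A z + B z - 2 * \<epsilon> * N) \<le> F (A z + B z - \<epsilon> * N)"
          using \<epsilon> N0 by (intro Fm) simp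
        also have "\<dots> \<le> C1 * exp (- c1 * N)"
          unfolding F_def A_def B_def using z(3) r by (intro BL a' b' zz N) (simp add: D_def)
        finally show ?thesis using CE(1) zz by (intro bexI[of _ z]) auto
      qed
    qed
    then show "\<exists>z\<in>{z0..z1}. measure ?Q {w \<in> space ?Q.
      lpp w m n < (\<Sum>i\<in>{1..m}. 1 / (a i + z)) + (\<Sum>j\<in>{1..n}. 1 / (b j - z)) - 2 * \<epsilon> * N} \<le> C * exp (- c * N)"
      unfolding F_def A_def B_def .
  qed
qed

section \<open>Last-passage times on a general probability space\<close>

lemma path_sum_le_lpp:
  assumes "up_right_path m n p" "\<And>c. c \<in> cells m n \<Longrightarrow> 0 \<le> w c"
  shows "(\<Sum>u\<leftarrow>p. w u) \<le> lpp w m n"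
  using assms
proof (induction p arbitrary: m n rule: rev_induct)
  case (snoc c p)
  have c: "c = (m, n)" using snoc.prems(1) by (simp add: up_right_path_def)
  show ?case
  proof (cases "p = []")
    case True
    then have "m = 1" "n = 1" using snoc.prems(1) by (auto simp: up_right_path_def)
    then show ?thesis using True c by simp
  next
    case False
    obtain k l where kl: "last p = (k, l)" by (cases "last p")
    have "(m, n) = (k + 1, l) \<or> (m, n) = (k, l + 1)" "up_right_path k l p"
      using snoc.prems(1) False c kl by (auto simp: up_right_path_def successively_append_iff)
    moreover from this(2) have "1 \<le> k" "1 \<le> l"
      using up_right_steps_bounds[of p] False kl last_in_set[of p] by (auto simp: up_right_path_def)
    ultimately consider "m = Suc k" "n = l" "1 \<le> k" "1 \<le> l" | "m = k" "n = Suc l" "1 \<le> k" "1 \<le> l" by auto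
    then show ?thesis
    proof cases
      case 1
      have "(\<Sum>u\<leftarrow>p. w u) \<le> lpp w k l"
        by (rule snoc.IH) (use \<open>up_right_path k l p\<close> snoc.prems(2) 1 in \<open>auto simp: cells_def\<close>)
      moreover obtain l' where "l = Suc l'" using 1 by (cases l) auto
      ultimately show ?thesis using 1 c by simp
    next
      case 2
      have "(\<Sum>u\<leftarrow>p. w u) \<le> lpp w k l"
        by (rule snoc.IH) (use \<open>up_right_path k l p\<close> snoc.prems(2) 2 in \<open>auto simp: cells_def\<close>)
      moreover obtain k' where "k = Suc k'" using 2 by (cases k) auto
      ultimately show ?thesis using 2 c by simp
    qed
  qed
qed (simp add: up_right_path_def)

lemma lpp_attained:
  assumes "1 \<le> m" "1 \<le> n" "\<And>c. c \<in> cells m n \<Longrightarrow> 0 \<le> w c"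
  shows "\<exists>p. up_right_path m n p \<and> lpp w m n = (\<Sum>u\<leftarrow>p. w u)"
  using assms
proof (induction w m n rule: lpp.induct)
  case (3 w i j)
  have ext: "\<exists>p. up_right_path (Suc i) (Suc j) p \<and> lpp w (Suc i) (Suc j) = (\<Sum>u\<leftarrow>p. w u)"
    if "up_right_path k l p" "lpp w (Suc i) (Suc j) = w (Suc i, Suc j) + (\<Sum>u\<leftarrow>p. w u)"
      "(Suc i, Suc j) = (k + 1, l) \<or> (Suc i, Suc j) = (k, l + 1)" for k l p
    using that
    by (intro exI[of _ "p @ [(Suc i, Suc j)]"]) (auto simp: up_right_path_def successively_append_iff)
  have nn: "0 \<le> lpp w i (Suc j)" "0 \<le> lpp w (Suc i) j"
    using 3(5) by (auto intro!: lpp_nonneg simp: cells_def)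
  show ?case
  proof (cases "i = 0 \<and> j = 0")
    case True
    then show ?thesis
      by (intro exI[of _ "[(1, 1)]"]) (simp add: up_right_path_def)
  next
    case False
    show ?thesis
    \<comment> \<open>The value 0 outside the rectangle may tie with a genuine predecessor; asking
      for i \<noteq> 0 selects the one that is the end of a path.\<close>
    proof (cases "lpp w (Suc i) j \<le> lpp w i (Suc j) \<and> i \<noteq> 0")
      case True
      then obtain p where "up_right_path i (Suc j) p" "lpp w i (Suc j) = (\<Sum>u\<leftarrow>p. w u)"
        using 3(1) 3(5) by (auto simp: cells_def)
      then show ?thesis using True by (intro ext) auto
    next
      case F2: False
      then have le: "lpp w i (Suc j) \<le> lpp w (Suc i) j" using nn by auto
      have "j \<noteq> 0"
      proof
        assume "j = 0"
        with False F2 le nn show False by auto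
      qed
      then obtain p where "up_right_path (Suc i) j p" "lpp w (Suc i) j = (\<Sum>u\<leftarrow>p. w u)"
        using 3(2) 3(5) by (auto simp: cells_def)
      then show ?thesis using le by (intro ext) auto
    qed
  qed
qed auto

lemma last_passage_eq_lpp:
  assumes "1 \<le> m" "1 \<le> n" "\<And>c. c \<in> cells m n \<Longrightarrow> 0 \<le> w c"
  shows "last_passage w m n = lpp w m n"
  unfolding last_passage_def
proof (rule Max_eqI)
  show "finite ((\<lambda>p. \<Sum>u\<leftarrow>p. w u) ` {p. up_right_path m n p})"
    using finite_up_right_paths by simp
  show "y \<le> lpp w m n" if "y \<in> (\<lambda>p. \<Sum>u\<leftarrow>p. w u) ` {p. up_right_path m n p}" for y
    using that path_sum_le_lpp assms(3) by auto
  show "lpp w m n \<in> (\<lambda>p. \<Sum>u\<leftarrow>p. w u) ` {p. up_right_path m n p}"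
    using lpp_attained[of m n w] assms by auto
qed

section \<open>From abstract weight arrays to the product law\<close>

lemma distr_expQ_of_indep:
  fixes X :: "'i \<Rightarrow> 'b \<Rightarrow> real"
  assumes M: "prob_space M" and K: "finite K" "K \<noteq> {}"
    and indep: "prob_space.indep_vars M (\<lambda>_. borel) X K"
    and distr: "\<And>c. c \<in> K \<Longrightarrow> distributed M lborel (X c) (exponential_density (\<rho> c))"
    and \<rho>: "\<And>c. c \<in> K \<Longrightarrow> 0 < \<rho> c"
  shows "distr M (PiM K (\<lambda>_. borel)) (\<lambda>\<xi>. \<lambda>c\<in>K. X c \<xi>) = expQ \<rho> K"
proof -
  interpret prob_space M by fact
  have rv: "X c \<in> borel_measurable M" if "c \<in> K" for c
    using distributed_measurable[OF distr[OF that]] by simp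
  have "distr M (PiM K (\<lambda>_. borel)) (\<lambda>\<xi>. \<lambda>c\<in>K. X c \<xi>) = PiM K (\<lambda>c. distr M borel (X c))"
    using indep_vars_iff_distr_eq_PiM'[of K X "\<lambda>_. borel"] indep rv K by simp
  also have "\<dots> = expQ \<rho> K"
    unfolding expQ_def
  proof (rule PiM_cong[OF refl])
    fix c assume c: "c \<in> K"
    have "distr M borel (X c) = distr M lborel (X c)"
      by (rule distr_cong) simp_all
    also have "\<dots> = density lborel (\<lambda>s. ennreal (exponential_density (\<rho> c) s))"
      by (rule distributed_distr_eq_density[OF distr[OF c]])
    also have "\<dots> = expm (\<rho> c)" using \<rho>[OF c] by (simp add: expm_def)
    finally show "distr M borel (X c) = expm (\<rho> c)" .
  qed
  finally show ?thesis .
qed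

text \<open>Independence and the marginals determine the law of a single array, so the probability
  of an event of this array can be computed under \<open>expQ\<close>. No joint law of different
  arrays enters.\<close>

lemma measure_indep_family:
  fixes X :: "'i \<Rightarrow> 'b \<Rightarrow> real"
  assumes M: "prob_space M" and K: "finite K" "K \<noteq> {}"
    and indep: "prob_space.indep_vars M (\<lambda>_. borel) X K"
    and distr: "\<And>c. c \<in> K \<Longrightarrow> distributed M lborel (X c) (exponential_density (\<rho> c))"
    and \<rho>: "\<And>c. c \<in> K \<Longrightarrow> 0 < \<rho> c"
    and S: "{w \<in> space (expQ \<rho> K). P w} \<in> sets (expQ \<rho> K)"
    and P: "\<And>w. P (restrict w K) \<longleftrightarrow> P w"
  shows "{\<xi> \<in> space M. P (\<lambda>c. X c \<xi>)} \<in> sets M"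
    "\<P>(\<xi> in M. P (\<lambda>c. X c \<xi>)) = \<P>(w in expQ \<rho> K. P w)"
proof -
  have rv: "X c \<in> borel_measurable M" if "c \<in> K" for c
    using distributed_measurable[OF distr[OF that]] by simp
  have meas: "(\<lambda>\<xi>. \<lambda>c\<in>K. X c \<xi>) \<in> M \<rightarrow>\<^sub>M PiM K (\<lambda>_. borel)"
    by (rule measurable_restrict) (rule rv)
  let ?S = "{w \<in> space (expQ \<rho> K). P w}"
  have S': "?S \<in> sets (PiM K (\<lambda>_. borel))" using S by (simp add: sets_expQ)
  have eq: "(\<lambda>\<xi>. \<lambda>c\<in>K. X c \<xi>) -` ?S \<inter> space M = {\<xi> \<in> space M. P (\<lambda>c. X c \<xi>)}"
    using P[of "\<lambda>c. X c \<xi>" for \<xi>] by (auto simp: space_expQ)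
  show "{\<xi> \<in> space M. P (\<lambda>c. X c \<xi>)} \<in> sets M"
    using measurable_sets[OF meas S'] unfolding eq .
  show "\<P>(\<xi> in M. P (\<lambda>c. X c \<xi>)) = measure (expQ \<rho> K) ?S"
  proof -
    have "distr M (PiM K (\<lambda>_. borel)) (\<lambda>\<xi>. \<lambda>c\<in>K. X c \<xi>) = expQ \<rho> K"
      by (rule distr_expQ_of_indep) (use assms in auto)
    then show ?thesis using measure_distr[OF meas S'] unfolding eq by simp
  qed
qed

text \<open>The antidiagonal m + n = k has k + 1 points and (k + 1) exp (-c k) is summable. A union
  bound on each antidiagonal and the convergence half of Borel--Cantelli ask nothing about the
  dependence between the events.\<close>

lemma borel_cantelli_grid:
  assumes M: "prob_space M" and E: "\<And>m n. E m n \<in> sets M"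
    and le: "\<And>m n. measure M (E m n) \<le> C * exp (- c * real (m + n))" and c: "0 < c"
  shows "AE \<xi> in M. \<exists>N. \<forall>m n. N \<le> m + n \<longrightarrow> \<xi> \<notin> E m n"
proof -
  interpret prob_space M by fact
  define U where "U k = (\<Union>m\<in>{..k}. E m (k - m))" for k
  have U: "U k \<in> sets M" for k unfolding U_def using E by auto
  have "AE \<xi> in M. eventually (\<lambda>k. \<xi> \<in> space M - U k) sequentially"
  proof (rule borel_cantelli_AE1[OF U])
    show "emeasure M (U k) < \<infinity>" for k by (simp add: less_top[symmetric])
    show "summable (\<lambda>k. measure M (U k))"
    proof (rule summable_comparison_test')
      show "summable (\<lambda>k. C * (of_nat (Suc k) * exp (- c) ^ k))"
        using geometric_deriv_sums[of "exp (- c)"] c by (intro summable_mult) (auto simp: sums_iff)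
      show "norm (measure M (U k)) \<le> C * (of_nat (Suc k) * exp (- c) ^ k)" if "k \<ge> 0" for k
      proof -
        have "measure M (U k) \<le> (\<Sum>m\<in>{..k}. measure M (E m (k - m)))"
          unfolding U_def using E by (intro measure_subadditive_finite) auto
        also have "\<dots> \<le> (\<Sum>m\<in>{..k}. C * exp (- c * real k))"
          using le[of m "k - m" for m] by (intro sum_mono) (metis atMost_iff le_add_diff_inverse)
        also have "\<dots> = C * (of_nat (Suc k) * exp (- c) ^ k)"
          by (simp add: exp_of_nat_mult[symmetric] mult_ac)
        finally show ?thesis by simp
      qed
    qed
  qed
  then show ?thesis
  proof eventually_elim
    case (elim \<xi>)
    then obtain N where N: "\<And>k. N \<le> k \<Longrightarrow> \<xi> \<notin> U k" by (auto simp: eventually_sequentially)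
    have "\<xi> \<notin> E m n" if "N \<le> m + n" for m n
      using N[OF that] unfolding U_def by (auto dest: bspec[of _ _ m])
    then show ?case by blast
  qed
qed

section \<open>Vague convergence of empirical measures\<close>

text \<open>As the image of a uniform distribution, the empirical measure integrates a function to
  its plain average over the parameters.\<close>

lemma empirical_eq_distr:
  assumes "1 \<le> m"
  shows "empirical c m = distr (measure_pmf (pmf_of_set {1..m})) borel (c m)"
proof (rule measure_eqI)
  fix A assume "A \<in> sets (empirical c m)"
  then have A: "A \<in> sets borel" by simp
  have "emeasure (distr (measure_pmf (pmf_of_set {1..m})) borel (c m)) A = ennreal (real (card ({1..m} \<inter> c m -` A)) / real m)"
    using assms A by (subst emeasure_distr) (auto simp: emeasure_pmf_of_set ennreal_divide_numeral)
  also have "\<dots> = ennreal (1 / real m) * ennreal (real (card ({1..m} \<inter> c m -` A)))"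
    using assms by (simp add: ennreal_mult[symmetric])
  also have "ennreal (real (card ({1..m} \<inter> c m -` A))) = (\<Sum>i=1..m. emeasure (return borel (c m i)) A)"
  proof -
    have "(\<Sum>i=1..m. emeasure (return borel (c m i)) A) = (\<Sum>i\<in>{1..m}. if i \<in> c m -` A then 1 else 0)"
      using A by (intro sum.cong) (auto simp: indicator_def)
    also have "\<dots> = of_nat (card ({1..m} \<inter> c m -` A))"
      by (subst sum.inter_restrict[symmetric]) auto
    finally show ?thesis by (simp add: ennreal_of_nat_eq_real_of_nat)
  qed
  also have "ennreal (1 / real m) * \<dots> = emeasure (empirical c m) A"
    by (rule emeasure_empirical[OF A, symmetric])
  finally show "emeasure (empirical c m) A = emeasure (distr (measure_pmf (pmf_of_set {1..m})) borel (c m)) A" ..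
qed simp

lemma integral_empirical:
  fixes f :: "real \<Rightarrow> real"
  assumes "1 \<le> m" "f \<in> borel_measurable borel"
  shows "(LINT s|empirical c m. f s) = (\<Sum>i\<in>{1..m}. f (c m i)) / real m"
  unfolding empirical_eq_distr[OF assms(1)]
  by (subst integral_distr) (use assms in \<open>auto simp: integral_pmf_of_set\<close>)

lemma min_param_le: "i \<in> {1..m} \<Longrightarrow> min_param c m \<le> c m i"
  unfolding min_param_def by (intro Min_le) auto

lemma min_param_attained: "1 \<le> m \<Longrightarrow> \<exists>i\<in>{1..m}. c m i = min_param c m"
proof -
  assume "1 \<le> m"
  then have "min_param c m \<in> c m ` {1..m}" unfolding min_param_def by (intro Min_in) auto
  then show ?thesis by (metis imageE)
qed

text \<open>One collection of parameters with its limits, to be instantiated for the columns and for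
  the rows. The integrals of 1 / (s - z) against \<beta> are then the case -z of those of 1 / (s +
  z).\<close>

locale vague_limit =
  fixes c :: "nat \<Rightarrow> nat \<Rightarrow> real" and \<mu> :: "real measure" and \<cc> :: ereal
  assumes sub: "subprob_space \<mu>" and sets_\<mu>: "sets \<mu> = sets borel"
    and conv: "vague_conv (empirical c) \<mu>"
    and lim: "(\<lambda>m. ereal (min_param c m)) \<longlonglongrightarrow> \<cc>"
begin

lemma finite_\<mu>: "finite_measure \<mu>"
  using sub by (rule subprob_space.axioms)

lemma eventually_param_ge:
  assumes "ereal t < \<cc>"
  shows "\<forall>\<^sub>F m in sequentially. 1 \<le> m \<and> (\<forall>i\<in>{1..m}. t < c m i)"
proof -
  have "\<forall>\<^sub>F m in sequentially. ereal t < ereal (min_param c m)"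
    using order_tendstoD(1)[OF lim assms] .
  then show ?thesis using eventually_ge_at_top[of 1]
    by eventually_elim (use min_param_le in \<open>auto intro: less_le_trans\<close>)
qed

lemma eventually_integral_empirical:
  fixes f :: "real \<Rightarrow> real"
  assumes "continuous_on UNIV f" "(f \<longlongrightarrow> 0) at_infinity"
  shows "(\<lambda>m. (\<Sum>i\<in>{1..m}. f (c m i)) / real m) \<longlonglongrightarrow> (LINT s|\<mu>. f s)"
proof -
  have "(\<lambda>m. LINT s|empirical c m. f s) \<longlonglongrightarrow> (LINT s|\<mu>. f s)"
    using conv assms by (auto simp: vague_conv_def)
  then show ?thesis
  proof (rule Lim_transform_eventually)
    show "\<forall>\<^sub>F m in sequentially. (LINT s|empirical c m. f s) = (\<Sum>i\<in>{1..m}. f (c m i)) / real m"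
      using eventually_ge_at_top[of 1]
      by eventually_elim (intro integral_empirical borel_measurable_continuous_onI assms)
  qed
qed

text \<open>Test with a function that vanishes on [t, \<infinity>), is positive below t and decays
  at infinity. For large m all parameters lie above t, so its empirical averages are eventually 0,
  and so is the limit.\<close>

lemma AE_ge:
  assumes t: "ereal t < \<cc>"
  shows "AE s in \<mu>. t \<le> s"
proof -
  interpret finite_measure \<mu> by (rule finite_\<mu>)
  define f where "f s = max 0 (t - s) / (1 + (t - s)\<^sup>2)" for s :: real
  have pos: "0 < 1 + (t - s)\<^sup>2" for s by (simp add: add_pos_nonneg)
  have cf: "continuous_on UNIV f"
    unfolding f_def using pos by (intro continuous_intros) (auto simp: less_imp_neq[symmetric])
  have f0: "0 \<le> f s" for s using pos[of s] by (simp add: f_def)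
  have f1: "f s \<le> 1" for s
  proof -
    have "t - s \<le> 1 + (t - s)\<^sup>2" using sum_squares_bound[of 1 "t - s"] by (simp add: power2_eq_square) (smt (verit) mult_less_0_iff not_square_less_zero)
    then show ?thesis using pos[of s] by (simp add: f_def)
  qed
  have "(f \<longlongrightarrow> 0) at_infinity"
  proof (rule tendstoI)
    fix e :: real assume e: "0 < e"
    show "\<forall>\<^sub>F s in at_infinity. dist (f s) 0 < e"
      unfolding eventually_at_infinity
    proof (intro exI[of _ "\<bar>t\<bar> + 1 / e + 1"] allI impI)
      fix s :: real assume s: "\<bar>t\<bar> + 1 / e + 1 \<le> norm s"
      show "dist (f s) 0 < e"
      proof (cases "t \<le> s")
        case True then show ?thesis using e by (simp add: f_def)
      next
        case False
        then have u: "1 / e < t - s" using s e by auto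
        then have "0 < t - s" using e by (smt (verit) divide_pos_pos)
        have "1 < e * (t - s)" using u e by (simp add: field_simps)
        then have "t - s < e * (t - s) * (t - s)" using \<open>0 < t - s\<close> by simp
        also have "\<dots> \<le> e * (1 + (t - s)\<^sup>2)" using e by (simp add: power2_eq_square algebra_simps)
        finally have "f s < e" using pos[of s] \<open>0 < t - s\<close> by (simp add: f_def field_simps)
        then show ?thesis using f0 by simp
      qed
    qed
  qed
  from eventually_integral_empirical[OF cf this]
  have l: "(\<lambda>m. (\<Sum>i\<in>{1..m}. f (c m i)) / real m) \<longlonglongrightarrow> (LINT s|\<mu>. f s)" .
  have "\<forall>\<^sub>F m in sequentially. (\<Sum>i\<in>{1..m}. f (c m i)) / real m = 0"
    using eventually_param_ge[OF t]
    by eventually_elim (auto simp: f_def intro!: sum.neutral)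
  then have "(LINT s|\<mu>. f s) = 0"
    using l tendsto_unique[OF _ l, of 0] by (simp add: tendsto_eventually)
  moreover have mf: "f \<in> borel_measurable \<mu>"
    using borel_measurable_continuous_onI[OF cf] by (simp add: measurable_cong_sets[OF sets_\<mu> refl])
  moreover have "integrable \<mu> f"
    by (rule integrable_const_bound[of _ 1]) (use f0 f1 mf in auto)
  ultimately have "AE s in \<mu>. f s = 0"
    using integral_nonneg_eq_0_iff_AE[of \<mu> f] f0 by simp
  then show ?thesis
  proof eventually_elim
    case (elim s)
    then show ?case using pos[of s] by (auto simp: f_def max_def split: if_splits)
  qed
qed

text \<open>1 / (s + z) is not an admissible test function because of its pole. It is left unchanged
  on [t, \<infinity>), where eventually all parameters and almost all of \<mu> lie, and cut off
  linearly to 0 on [t - 1, t]. It decays at infinity, so mass escaping there does no harm and vague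
  convergence suffices.\<close>

lemma recip_sum_tendsto:
  assumes z: "ereal (- z) < \<cc>"
  shows "(\<lambda>m. (\<Sum>i\<in>{1..m}. 1 / (c m i + z)) / real m) \<longlonglongrightarrow> (LINT s|\<mu>. 1 / (s + z))"
proof -
  obtain t where t: "- z < t" "ereal t < \<cc>"
    using ereal_dense2[OF z] by auto
  define f where "f s = max 0 (1 - max 0 (t - s)) / (max s t + z)" for s :: real
  have pos: "0 < max s t + z" for s using t by auto
  have cf: "continuous_on UNIV f"
    unfolding f_def using pos by (intro continuous_intros) (auto simp: less_imp_neq[symmetric])
  have fe: "f s = 1 / (s + z)" if "t \<le> s" for s using that by (simp add: f_def)
  have "(f \<longlongrightarrow> 0) at_infinity"
  proof (rule tendstoI)
    fix e :: real assume e: "0 < e"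
    show "\<forall>\<^sub>F s in at_infinity. dist (f s) 0 < e"
      unfolding eventually_at_infinity
    proof (intro exI[of _ "\<bar>t\<bar> + \<bar>z\<bar> + 1 / e + 1"] allI impI)
      fix s :: real assume s: "\<bar>t\<bar> + \<bar>z\<bar> + 1 / e + 1 \<le> norm s"
      have "0 < 1 / e" using e by simp
      show "dist (f s) 0 < e"
      proof (cases "t \<le> s")
        case True
        then have "0 \<le> s" using s \<open>0 < 1 / e\<close> unfolding real_norm_def by linarith
        then have u: "1 / e < s + z" using s \<open>0 < 1 / e\<close> by auto
        have "0 < s + z" using u \<open>0 < 1 / e\<close> by linarith
        then show ?thesis using u e True by (simp add: fe field_simps)
      next
        case False
        then have "1 \<le> t - s" using s \<open>0 < 1 / e\<close> unfolding real_norm_def by linarith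
        then have "f s = 0" by (simp add: f_def)
        then show ?thesis using e by simp
      qed
    qed
  qed
  from eventually_integral_empirical[OF cf this]
  have l: "(\<lambda>m. (\<Sum>i\<in>{1..m}. f (c m i)) / real m) \<longlonglongrightarrow> (LINT s|\<mu>. f s)" .
  have "(LINT s|\<mu>. f s) = (LINT s|\<mu>. 1 / (s + z))"
  proof (rule integral_cong_AE)
    show "f \<in> borel_measurable \<mu>"
      using borel_measurable_continuous_onI[OF cf] by (simp add: measurable_cong_sets[OF sets_\<mu> refl])
    show "(\<lambda>s. 1 / (s + z)) \<in> borel_measurable \<mu>"
      by (simp add: measurable_cong_sets[OF sets_\<mu> refl])
    show "AE s in \<mu>. f s = 1 / (s + z)" using AE_ge[OF t(2)] by eventually_elim (rule fe)
  qed
  moreover have "\<forall>\<^sub>F m in sequentially. (\<Sum>i\<in>{1..m}. f (c m i)) / real m = (\<Sum>i\<in>{1..m}. 1 / (c m i + z)) / real m"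
    using eventually_param_ge[OF t(2)]
    by eventually_elim (auto intro!: arg_cong2[where f="(/)"] sum.cong fe)
  ultimately show ?thesis using l by (auto elim: Lim_transform_eventually)
qed

lemma borel_measurable_recip: "(\<lambda>s. 1 / (s + z)) \<in> borel_measurable \<mu>"
  by (simp add: measurable_cong_sets[OF sets_\<mu> refl])

lemma measure_le_1: "measure \<mu> (space \<mu>) \<le> 1"
  using subprob_space.subprob_measure_le_1[OF sub] .

lemma integrable_recip:
  assumes z: "ereal (- z) < \<cc>"
  shows "integrable \<mu> (\<lambda>s. 1 / (s + z))"
proof -
  interpret finite_measure \<mu> by (rule finite_\<mu>)
  obtain t where t: "- z < t" "ereal t < \<cc>"
    using ereal_dense2[OF z] by auto
  show ?thesis
  proof (rule integrable_const_bound[of _ "1 / (t + z)"])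
    show "AE s in \<mu>. norm (1 / (s + z)) \<le> 1 / (t + z)"
      using AE_ge[OF t(2)] by eventually_elim (use t in \<open>auto intro!: divide_left_mono\<close>)
  qed (rule borel_measurable_recip)
qed

lemma recip_nonneg:
  assumes z: "ereal (- z) < \<cc>"
  shows "0 \<le> (LINT s|\<mu>. 1 / (s + z))"
  by (rule integral_nonneg_AE) (use AE_ge[OF z] in eventually_elim, simp)

lemma recip_le:
  assumes "ereal t < \<cc>" "0 < t + z"
  shows "(LINT s|\<mu>. 1 / (s + z)) \<le> 1 / (t + z)"
proof -
  interpret finite_measure \<mu> by (rule finite_\<mu>)
  have z: "ereal (- z) < \<cc>" using assms by (auto intro: less_trans[of _ "ereal t"])
  have "(LINT s|\<mu>. 1 / (s + z)) \<le> (LINT s|\<mu>. 1 / (t + z))"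
  proof (intro integral_mono_AE integrable_recip[OF z] integrable_const)
    show "AE s in \<mu>. 1 / (s + z) \<le> 1 / (t + z)"
      using AE_ge[OF assms(1)] by eventually_elim (use assms in \<open>auto intro!: divide_left_mono\<close>)
  qed
  also have "\<dots> = measure \<mu> (space \<mu>) * (1 / (t + z))" by simp
  also have "\<dots> \<le> 1 * (1 / (t + z))" using measure_le_1 assms by (intro mult_right_mono) auto
  finally show ?thesis by simp
qed

lemma recip_antimono:
  assumes z: "ereal (- z) < \<cc>" "z \<le> z'"
  shows "(LINT s|\<mu>. 1 / (s + z')) \<le> (LINT s|\<mu>. 1 / (s + z))"
proof -
  obtain t where t: "- z < t" "ereal t < \<cc>"
    using ereal_dense2[OF z(1)] by auto
  have "ereal (- z') < \<cc>" using z by (auto intro: le_less_trans[of _ "ereal (- z)"])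
  then show ?thesis
  proof (intro integral_mono_AE integrable_recip z)
    show "AE s in \<mu>. 1 / (s + z') \<le> 1 / (s + z)"
      using AE_ge[OF t(2)] by eventually_elim (use t z in \<open>auto intro!: divide_left_mono\<close>)
  qed
qed

lemma recip_lipschitz:
  assumes "ereal t < \<cc>" "0 < r" "r \<le> t + z" "z \<le> z'"
  shows "(LINT s|\<mu>. 1 / (s + z)) \<le> (LINT s|\<mu>. 1 / (s + z')) + (z' - z) / r\<^sup>2"
proof -
  interpret finite_measure \<mu> by (rule finite_\<mu>)
  have z: "ereal (- z) < \<cc>" "ereal (- z') < \<cc>"
    using assms by (auto intro: le_less_trans[of _ "ereal t"])
  have "(LINT s|\<mu>. 1 / (s + z)) \<le> (LINT s|\<mu>. 1 / (s + z') + (z' - z) / r\<^sup>2)"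
  proof (intro integral_mono_AE integrable_recip z Bochner_Integration.integrable_add)
    show "AE s in \<mu>. 1 / (s + z) \<le> 1 / (s + z') + (z' - z) / r\<^sup>2"
      using AE_ge[OF assms(1)]
    proof eventually_elim
      case (elim s)
      have s: "r \<le> s + z" "r \<le> s + z'" using elim assms by auto
      have "1 / (s + z) - 1 / (s + z') = (z' - z) / ((s + z) * (s + z'))"
        using s assms by (simp add: field_simps)
      also have "\<dots> \<le> (z' - z) / r\<^sup>2"
        using s assms by (intro divide_left_mono) (auto simp: power2_eq_square intro!: mult_mono mult_pos_pos)
      finally show ?case by simp
    qed
  qed simp
  also have "\<dots> = (LINT s|\<mu>. 1 / (s + z')) + measure \<mu> (space \<mu>) * ((z' - z) / r\<^sup>2)"
    by (subst Bochner_Integration.integral_add) (use integrable_recip[OF z(2)] in auto)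
  also have "measure \<mu> (space \<mu>) * ((z' - z) / r\<^sup>2) \<le> 1 * ((z' - z) / r\<^sup>2)"
    using measure_le_1 assms by (intro mult_right_mono) auto
  finally show ?thesis by simp
qed

lemma null_of_AE_False:
  assumes "AE s in \<mu>. False"
  shows "\<mu> = null_measure borel"
proof (rule measure_eqI)
  have "emeasure \<mu> (space \<mu>) = 0"
    using assms by (simp add: AE_iff_measurable[OF sets.top, of \<mu> "\<lambda>_. False"])
  then show "emeasure \<mu> A = emeasure (null_measure borel) A" if "A \<in> sets \<mu>" for A
    using emeasure_space[of \<mu> A] by simp
qed (simp add: sets_\<mu>)

lemma recip_pos:
  assumes z: "ereal (- z) < \<cc>" and nz: "\<mu> \<noteq> null_measure borel"
  shows "0 < (LINT s|\<mu>. 1 / (s + z))"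
proof (rule ccontr)
  assume "\<not> ?thesis"
  then have "(LINT s|\<mu>. 1 / (s + z)) = 0" using recip_nonneg[OF z] by linarith
  obtain t where t: "- z < t" "ereal t < \<cc>"
    using ereal_dense2[OF z(1)] by auto
  have "AE s in \<mu>. 0 \<le> 1 / (s + z)" using AE_ge[OF z] by eventually_elim simp
  then have "AE s in \<mu>. 1 / (s + z) = 0"
    using integral_nonneg_eq_0_iff_AE[OF integrable_recip[OF z]] \<open>(LINT s|\<mu>. 1 / (s + z)) = 0\<close> by blast
  then have "AE s in \<mu>. False" using AE_ge[OF t(2)] by eventually_elim (use t in auto)
  then show False using nz null_of_AE_False by blast
qed

lemma null_of_infinite:
  assumes "\<cc> = \<infinity>"
  shows "\<mu> = null_measure borel"
proof (rule null_of_AE_False)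
  have "AE s in \<mu>. \<forall>k::nat. real k \<le> s" unfolding AE_all_countable using AE_ge assms by simp
  then show "AE s in \<mu>. False"
    by eventually_elim (use reals_Archimedean2 not_le in blast)
qed

end

lemma recip_null: "(LINT s|null_measure borel. 1 / (s + z :: real)) = 0"
  by simp

section \<open>Almost sure bounds\<close>

text \<open>The lower tail bound provides some z depending on (m, n), so uniformity in z is needed.
  On a finite grid the pointwise limit applies; z is rounded up to a grid point, which lowers the
  finite sum by monotonicity and the integral only by the Lipschitz bound.\<close>

lemma (in vague_limit) recip_sum_uniform_lower:
  assumes z0: "ereal (- z0) < \<cc>" and \<epsilon>: "0 < \<epsilon>"
  shows "\<forall>\<^sub>F m in sequentially. \<forall>z\<in>{z0..z1}. real m * ((LINT s|\<mu>. 1 / (s + z)) - \<epsilon>) \<le> (\<Sum>i\<in>{1..m}. 1 / (c m i + z))"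
proof -
  obtain t where t: "- z0 < t" "ereal t < \<cc>"
    using ereal_dense2[OF z0] by auto
  define r where "r = t + z0"
  have r: "0 < r" using t by (simp add: r_def)
  define h where "h = \<epsilon> * r\<^sup>2 / 2"
  have h: "0 < h" using r \<epsilon> by (simp add: h_def)
  define K where "K = nat \<lceil>(z1 - z0) / h\<rceil>"
  have "\<forall>\<^sub>F m in sequentially. (LINT s|\<mu>. 1 / (s + (z0 + real k * h))) - \<epsilon> / 2 < (\<Sum>i\<in>{1..m}. 1 / (c m i + (z0 + real k * h))) / real m" for k
  proof (rule order_tendstoD(1)[OF recip_sum_tendsto])
    show "ereal (- (z0 + real k * h)) < \<cc>"
      using h z0 by (intro le_less_trans[OF _ z0]) simp
  qed (use \<epsilon> in simp)
  then have "\<forall>\<^sub>F m in sequentially. \<forall>k\<in>{..K}. (LINT s|\<mu>. 1 / (s + (z0 + real k * h))) - \<epsilon> / 2 < (\<Sum>i\<in>{1..m}. 1 / (c m i + (z0 + real k * h))) / real m"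
    by (intro eventually_ball_finite) auto
  then show ?thesis using eventually_param_ge[OF t(2)]
  proof eventually_elim
    case (elim m)
    show ?case
    proof
      fix z assume z: "z \<in> {z0..z1}"
      define k where "k = nat \<lceil>(z - z0) / h\<rceil>"
      define g where "g = z0 + real k * h"
      have "(z - z0) / h \<le> (z1 - z0) / h" using z h by (intro divide_right_mono) auto
      then have kK: "k \<in> {..K}" unfolding k_def K_def by (simp only: atMost_iff) (intro nat_mono ceiling_mono)
      have "0 \<le> (z - z0) / h" using z h by simp
      then have "(z - z0) / h \<le> real k" "real k < (z - z0) / h + 1"
        unfolding k_def by (auto simp: of_nat_nat) linarith
      then have g: "z \<le> g" "g \<le> z + h" using h unfolding g_def by (auto simp: field_simps)
      have m: "0 < real m" using elim(2) by simp
      have "(LINT s|\<mu>. 1 / (s + z)) \<le> (LINT s|\<mu>. 1 / (s + g)) + (g - z) / r\<^sup>2"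
        using t r z g by (intro recip_lipschitz[of t]) (auto simp: r_def)
      also have "(g - z) / r\<^sup>2 \<le> \<epsilon> / 2"
      proof -
        have "(g - z) / r\<^sup>2 \<le> h / r\<^sup>2" using g by (intro divide_right_mono) auto
        then show ?thesis using r by (simp add: h_def)
      qed
      finally have "(LINT s|\<mu>. 1 / (s + z)) - \<epsilon> \<le> (LINT s|\<mu>. 1 / (s + g)) - \<epsilon> / 2" by simp
      also have "\<dots> \<le> (\<Sum>i\<in>{1..m}. 1 / (c m i + g)) / real m"
        using elim(1) kK unfolding g_def by (auto intro: less_imp_le)
      also have "\<dots> \<le> (\<Sum>i\<in>{1..m}. 1 / (c m i + z)) / real m"
      proof (intro divide_right_mono sum_mono divide_left_mono)
        fix i assume "i \<in> {1..m}"
        then have "t < c m i" using elim(2) by blast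
        then show "c m i + z \<le> c m i + g" "0 < (c m i + g) * (c m i + z)" using g t z by auto
      qed auto
      finally show "real m * ((LINT s|\<mu>. 1 / (s + z)) - \<epsilon>) \<le> (\<Sum>i\<in>{1..m}. 1 / (c m i + z))"
        using m by (simp add: field_simps)
    qed
  qed
qed

lemma (in vague_limit) recip_sum_upper:
  assumes z: "ereal (- z) < \<cc>" and \<epsilon>: "0 < \<epsilon>"
  shows "\<forall>\<^sub>F m in sequentially. (\<forall>i\<in>{1..m}. 0 < c m i + z) \<and> (\<Sum>i\<in>{1..m}. 1 / (c m i + z)) \<le> real m * ((LINT s|\<mu>. 1 / (s + z)) + \<epsilon>)"
proof -
  have "\<forall>\<^sub>F m in sequentially. (\<Sum>i\<in>{1..m}. 1 / (c m i + z)) / real m < (LINT s|\<mu>. 1 / (s + z)) + \<epsilon>"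
    by (rule order_tendstoD(2)[OF recip_sum_tendsto[OF z]]) (use \<epsilon> in simp)
  then show ?thesis using eventually_param_ge[OF z]
  proof eventually_elim
    case (elim m)
    then have "0 < real m" by simp
    then show ?case using elim by (auto simp: field_simps)
  qed
qed

text \<open>The hypotheses are packaged so that exchanging rows and columns is just another
  interpretation; statements about columns and about the vertical axis are obtained in this
  way.\<close>

locale inhomogeneous_lpp =
  fixes a b :: "nat \<Rightarrow> nat \<Rightarrow> real"
    and \<alpha> \<beta> :: "real measure"
    and \<aa> \<bb> :: ereal
    and \<omega> :: "nat \<Rightarrow> nat \<Rightarrow> nat \<times> nat \<Rightarrow> (nat \<times> nat \<Rightarrow> real) \<Rightarrow> real"
  assumes pos: "\<And>m n i j. 1 \<le> m \<Longrightarrow> 1 \<le> n \<Longrightarrow> i \<in> {1..m} \<Longrightarrow> j \<in> {1..n} \<Longrightarrow> 0 < a m i + b n j"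
    and indep: "\<And>m n. 1 \<le> m \<Longrightarrow> 1 \<le> n \<Longrightarrow>
      prob_space.indep_vars exp_product_space (\<lambda>_. borel) (\<omega> m n) ({1..m} \<times> {1..n})"
    and distr: "\<And>m n i j. 1 \<le> m \<Longrightarrow> 1 \<le> n \<Longrightarrow> i \<in> {1..m} \<Longrightarrow> j \<in> {1..n} \<Longrightarrow>
      distributed exp_product_space lborel (\<omega> m n (i, j)) (exponential_density (a m i + b n j))"
    and sub_\<alpha>: "subprob_space \<alpha>" "sets \<alpha> = sets borel"
    and sub_\<beta>: "subprob_space \<beta>" "sets \<beta> = sets borel"
    and conv_\<alpha>: "vague_conv (empirical a) \<alpha>"
    and conv_\<beta>: "vague_conv (empirical b) \<beta>"
    and \<aa>: "\<aa> \<noteq> -\<infinity>" "(\<lambda>m. ereal (min_param a m)) \<longlonglongrightarrow> \<aa>"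
    and \<bb>: "\<bb> \<noteq> -\<infinity>" "(\<lambda>n. ereal (min_param b n)) \<longlonglongrightarrow> \<bb>"
    and pos_lim: "0 < \<aa> + \<bb>"
begin

sublocale A: vague_limit a \<alpha> \<aa>
  by (intro vague_limit.intro sub_\<alpha> conv_\<alpha> \<aa>)

sublocale B: vague_limit b \<beta> \<bb>
  by (intro vague_limit.intro sub_\<beta> conv_\<beta> \<bb>)

sublocale P: prob_space exp_product_space
  by (rule prob_space_exp_product_space)

section \<open>Passage times of the given arrays\<close>

definition G :: "nat \<Rightarrow> nat \<Rightarrow> (nat \<times> nat \<Rightarrow> real) \<Rightarrow> real" where
  "G m n \<xi> = lpp (\<lambda>u. \<omega> m n u \<xi>) m n"

lemma AE_weights_nonneg:
  "AE \<xi> in exp_product_space. \<forall>m n. 1 \<le> m \<longrightarrow> 1 \<le> n \<longrightarrow> (\<forall>u\<in>cells m n. 0 \<le> \<omega> m n u \<xi>)"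
proof -
  have "AE \<xi> in exp_product_space. \<forall>u\<in>cells m n. 0 \<le> \<omega> m n u \<xi>" if mn: "1 \<le> m" "1 \<le> n" for m n
  proof (rule eventually_ball_finite[OF finite_cells(1)], rule ballI)
    fix u assume "u \<in> cells m n"
    then obtain i j where u: "u = (i, j)" "i \<in> {1..m}" "j \<in> {1..n}" by (auto simp: cells_def)
    note d = distr[OF mn u(2,3), folded u(1)]
    show "AE \<xi> in exp_product_space. 0 \<le> \<omega> m n u \<xi>"
    proof (rule AE_distrD[where f="\<omega> m n u" and P="\<lambda>x. 0 \<le> x" and M'=lborel])
      show "\<omega> m n u \<in> measurable exp_product_space lborel" by (rule distributed_measurable[OF d])
      show "AE x in distr exp_product_space lborel (\<omega> m n u). 0 \<le> x"
        unfolding distributed_distr_eq_density[OF d]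
        by (auto simp: AE_density exponential_density_def)
    qed
  qed
  then show ?thesis by (auto simp: AE_all_countable)
qed

lemma AE_last_passage:
  "AE \<xi> in exp_product_space. \<forall>m n. 1 \<le> m \<longrightarrow> 1 \<le> n \<longrightarrow>
    last_passage (\<lambda>u. \<omega> m n u \<xi>) m n = G m n \<xi> \<and> 0 \<le> G m n \<xi>"
  using AE_weights_nonneg
  by eventually_elim (auto simp: G_def intro!: last_passage_eq_lpp lpp_nonneg)

lemma G_law:
  assumes mn: "1 \<le> m" "1 \<le> n" and I: "I \<in> sets borel"
  shows "{\<xi> \<in> space exp_product_space. G m n \<xi> \<in> I} \<in> P.events"
    "P.prob {\<xi> \<in> space exp_product_space. G m n \<xi> \<in> I} =
      \<P>(w in expQ (rates (a m) (b n)) (cells m n). lpp w m n \<in> I)"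
proof -
  have *: "cells m n \<noteq> {}" using mn by (auto simp: cells_def)
  have S: "{w \<in> space (expQ (rates (a m) (b n)) (cells m n)). lpp w m n \<in> I} \<in> sets (expQ (rates (a m) (b n)) (cells m n))"
    using measurable_sets[OF measurable_lpp_expQ[OF subset_refl, of m n "rates (a m) (b n)"] I]
    by (simp add: vimage_def Int_def conj_commute)
  have P: "lpp (restrict w (cells m n)) m n \<in> I \<longleftrightarrow> lpp w m n \<in> I" for w
    using lpp_cong[of m n "restrict w (cells m n)" w] by simp
  have i: "P.indep_vars (\<lambda>_. borel) (\<omega> m n) (cells m n)"
    unfolding cells_def by (rule indep[OF mn])
  have d: "distributed exp_product_space lborel (\<omega> m n u) (exponential_density (rates (a m) (b n) u))"
    "0 < rates (a m) (b n) u" if "u \<in> cells m n" for u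
    using that distr[OF mn] pos[OF mn] by (auto simp: cells_def rates_def)
  note M = measure_indep_family[where M=exp_product_space and X="\<omega> m n" and P="\<lambda>w. lpp w m n \<in> I"
      and K="cells m n" and \<rho>="rates (a m) (b n)"]
  show "{\<xi> \<in> space exp_product_space. G m n \<xi> \<in> I} \<in> P.events"
    unfolding G_def by (rule M(1)) (fact prob_space_exp_product_space finite_cells * i d S P)+
  show "P.prob {\<xi> \<in> space exp_product_space. G m n \<xi> \<in> I} =
      \<P>(w in expQ (rates (a m) (b n)) (cells m n). lpp w m n \<in> I)"
    unfolding G_def by (rule M(2)) (fact prob_space_exp_product_space finite_cells * i d S P)+
qed

text \<open>When the mean is below s by the factor 1 - \<kappa>, the Chernoff exponent at fixed
  \<theta> is -\<theta> \<kappa> s up to a constant, and s grows linearly in m + n.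
  \<open>C0\<close> and \<open>C1\<close> leave room for the additive errors of rounding.\<close>

lemma AE_upper:
  fixes W :: "nat \<Rightarrow> nat \<Rightarrow> bool" and s :: "nat \<Rightarrow> nat \<Rightarrow> real"
  assumes \<theta>: "0 < \<theta>" "0 < \<kappa>" "0 < d"
    and W: "\<And>m n. W m n \<Longrightarrow> 1 \<le> m \<and> 1 \<le> n \<and> (\<forall>i\<in>{1..m}. 0 < a m i + u) \<and> (\<forall>j\<in>{1..n}. 0 < b n j - u - \<theta>)"
    and mean: "\<And>m n. W m n \<Longrightarrow> (\<Sum>i\<in>{1..m}. 1 / (a m i + u)) + (\<Sum>j\<in>{1..n}. 1 / (b n j - u - \<theta>)) \<le> (1 - \<kappa>) * s m n + C0"
    and s: "\<And>m n. W m n \<Longrightarrow> d * real (m + n) - C1 \<le> s m n"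
  shows "AE \<xi> in exp_product_space. \<exists>N. \<forall>m n. W m n \<longrightarrow> N \<le> m + n \<longrightarrow> G m n \<xi> \<le> s m n"
proof -
  define E where "E m n = (if W m n then {\<xi> \<in> space exp_product_space. G m n \<xi> \<in> {s m n..}} else {})" for m n
  have "AE \<xi> in exp_product_space. \<exists>N. \<forall>m n. N \<le> m + n \<longrightarrow> \<xi> \<notin> E m n"
  proof (rule borel_cantelli_grid[OF prob_space_exp_product_space])
    show "E m n \<in> P.events" for m n
      using G_law(1)[of m n "{s m n..}"] W[of m n] by (auto simp: E_def)
    show "0 < \<theta> * \<kappa> * d" using \<theta> by simp
    show "P.prob (E m n) \<le> exp (\<theta> * C0 + \<theta> * \<kappa> * C1) * exp (- (\<theta> * \<kappa> * d) * real (m + n))" for m n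
    proof (cases "W m n")
      case True
      note w = W[OF True]
      have "P.prob (E m n) = \<P>(w in expQ (rates (a m) (b n)) (cells m n). s m n \<le> lpp w m n)"
        using G_law(2)[of m n "{s m n..}"] w True by (simp add: E_def)
      also have "\<dots> \<le> exp (\<theta> * ((\<Sum>i\<in>{1..m}. 1 / (a m i + u)) + (\<Sum>j\<in>{1..n}. 1 / (b n j - u - \<theta>)) - s m n))"
        using w \<theta> by (intro lpp_upper_tail) auto
      also have "\<dots> \<le> exp (\<theta> * ((1 - \<kappa>) * s m n + C0 - s m n))"
        using mean[OF True] \<theta> by simp
      also have "\<theta> * ((1 - \<kappa>) * s m n + C0 - s m n) = \<theta> * C0 - \<theta> * \<kappa> * s m n"
        by (simp add: algebra_simps)
      also have "exp (\<theta> * C0 - \<theta> * \<kappa> * s m n) \<le> exp (\<theta> * C0 - \<theta> * \<kappa> * (d * real (m + n) - C1))"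
        using s[OF True] \<theta> by simp
      also have "\<dots> = exp (\<theta> * C0 + \<theta> * \<kappa> * C1) * exp (- (\<theta> * \<kappa> * d) * real (m + n))"
        unfolding exp_add[symmetric] by (simp add: algebra_simps)
      finally show ?thesis .
    qed (simp add: E_def)
  qed
  then show ?thesis using AE_space
    by eventually_elim (fastforce simp: E_def)
qed

lemma AE_lower:
  fixes W :: "nat \<Rightarrow> nat \<Rightarrow> bool" and s :: "nat \<Rightarrow> nat \<Rightarrow> real"
  assumes c: "0 < c" "0 \<le> C"
    and W: "\<And>m n. W m n \<Longrightarrow> 1 \<le> m \<and> 1 \<le> n"
    and le: "\<And>m n. W m n \<Longrightarrow> \<P>(w in expQ (rates (a m) (b n)) (cells m n). lpp w m n < s m n) \<le> C * exp (- c * real (m + n))"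
  shows "AE \<xi> in exp_product_space. \<exists>N. \<forall>m n. W m n \<longrightarrow> N \<le> m + n \<longrightarrow> s m n \<le> G m n \<xi>"
proof -
  define E where "E m n = (if W m n then {\<xi> \<in> space exp_product_space. G m n \<xi> \<in> {..<s m n}} else {})" for m n
  have "AE \<xi> in exp_product_space. \<exists>N. \<forall>m n. N \<le> m + n \<longrightarrow> \<xi> \<notin> E m n"
  proof (rule borel_cantelli_grid[OF prob_space_exp_product_space _ _ c(1)])
    show "E m n \<in> P.events" for m n
      using G_law(1)[of m n "{..<s m n}"] W[of m n] by (auto simp: E_def)
    show "P.prob (E m n) \<le> C * exp (- c * real (m + n))" for m n
      using G_law(2)[of m n "{..<s m n}"] W[of m n] le[of m n] c by (auto simp: E_def)
  qed
  then show ?thesis using AE_space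
    by eventually_elim (fastforce simp: E_def not_less)
qed

lemma nat_ceiling_bounds:
  assumes "0 < (x :: real)"
  shows "x \<le> real (nat \<lceil>x\<rceil>)" "real (nat \<lceil>x\<rceil>) < x + 1" "1 \<le> nat \<lceil>x\<rceil>"
  using assms by (auto simp: of_nat_nat) linarith+

text \<open>Strict inequality at z leaves a slack \<delta>: a quarter pays for the shift by
  \<theta>, a quarter for replacing sums by integrals, and half remains as the exponential
  margin.\<close>

lemma AE_upper_interior:
  assumes xy: "0 < x" "0 < y" and z: "- \<aa> < ereal z" "ereal z < \<bb>"
    and lt: "x * (LINT s|\<alpha>. 1 / (s + z)) + y * (LINT s|\<beta>. 1 / (s - z)) < 1"
  shows "AE \<xi> in exp_product_space. \<forall>\<^sub>F t in at_top. G (nat \<lceil>x * t\<rceil>) (nat \<lceil>y * t\<rceil>) \<xi> \<le> t"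
proof -
  define IA where "IA = (LINT s|\<alpha>. 1 / (s + z))"
  define IB where "IB \<theta> = (LINT s|\<beta>. 1 / (s + (- z - \<theta>)))" for \<theta>
  have IB0: "IB 0 = (LINT s|\<beta>. 1 / (s - z))" by (simp add: IB_def)
  define \<delta> where "\<delta> = 1 - (x * IA + y * IB 0)"
  have \<delta>: "0 < \<delta>" using lt by (simp add: \<delta>_def IA_def IB0)
  have za: "ereal (- z) < \<aa>" using z by (metis ereal_uminus_less_reorder uminus_ereal.simps(1))
  \<comment> \<open>A point strictly between z and \<bb> keeps the \<beta> integral controlled at
    the shifted parameter z + \<theta>, with \<open>r\<close> half of the available gap.\<close>
  obtain t0 where t0: "z < t0" "ereal t0 < \<bb>" using ereal_dense2[OF z(2)] by auto
  define r where "r = (t0 - z) / 2"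
  have r: "0 < r" using t0 by (simp add: r_def)
  define \<theta> where "\<theta> = min r (\<delta> * r\<^sup>2 / (4 * y))"
  have \<theta>: "0 < \<theta>" "\<theta> \<le> r" using r \<delta> xy by (auto simp: \<theta>_def)
  have "\<theta> \<le> \<delta> * r\<^sup>2 / (4 * y)" by (simp add: \<theta>_def)
  then have \<theta>y: "y * (\<theta> / r\<^sup>2) \<le> \<delta> / 4" using xy r by (simp add: field_simps)
  have zb: "ereal (- (- z - \<theta>)) < \<bb>"
    using \<theta> r t0 by (intro le_less_trans[OF _ t0(2)]) (auto simp: r_def)
  have "IB \<theta> \<le> IB 0 + \<theta> / r\<^sup>2"
    unfolding IB_def using B.recip_lipschitz[OF t0(2) r, of "- z - \<theta>" "- z - 0"] \<theta> t0 by (simp add: r_def)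
  then have "y * IB \<theta> \<le> y * (IB 0 + \<theta> / r\<^sup>2)"
    by (rule mult_left_mono) (use xy in simp)
  then have "y * IB \<theta> \<le> y * IB 0 + y * (\<theta> / r\<^sup>2)"
    by (simp only: distrib_left)
  moreover have "x * IA + y * IB 0 = 1 - \<delta>" by (simp add: \<delta>_def)
  ultimately have sl: "x * IA + y * IB \<theta> \<le> 1 - 3 / 4 * \<delta>" using \<theta>y by linarith
  define \<epsilon> where "\<epsilon> = \<delta> / (4 * (x + y))"
  have \<epsilon>: "0 < \<epsilon>" using \<delta> xy by (simp add: \<epsilon>_def)
  have \<epsilon>xy: "\<epsilon> * (x + y) = \<delta> / 4" using xy by (simp add: \<epsilon>_def field_simps)
  have "\<forall>\<^sub>F m in sequentially.
     ((\<forall>i\<in>{1..m}. 0 < a m i + z) \<and> (\<Sum>i\<in>{1..m}. 1 / (a m i + z)) \<le> real m * (IA + \<epsilon>)) \<and>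
     ((\<forall>i\<in>{1..m}. 0 < b m i + (- z - \<theta>)) \<and> (\<Sum>i\<in>{1..m}. 1 / (b m i + (- z - \<theta>))) \<le> real m * (IB \<theta> + \<epsilon>))"
    unfolding IA_def IB_def by (rule eventually_conj[OF A.recip_sum_upper[OF za \<epsilon>] B.recip_sum_upper[OF zb \<epsilon>]])
  then obtain n0 where "\<forall>m\<ge>n0.
     ((\<forall>i\<in>{1..m}. 0 < a m i + z) \<and> (\<Sum>i\<in>{1..m}. 1 / (a m i + z)) \<le> real m * (IA + \<epsilon>)) \<and>
     ((\<forall>i\<in>{1..m}. 0 < b m i + (- z - \<theta>)) \<and> (\<Sum>i\<in>{1..m}. 1 / (b m i + (- z - \<theta>))) \<le> real m * (IB \<theta> + \<epsilon>))"
    unfolding eventually_sequentially ..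
  then have n0: "\<And>m. n0 \<le> m \<Longrightarrow> (\<forall>i\<in>{1..m}. 0 < a m i + z) \<and> (\<Sum>i\<in>{1..m}. 1 / (a m i + z)) \<le> real m * (IA + \<epsilon>)"
     "\<And>m. n0 \<le> m \<Longrightarrow> (\<forall>i\<in>{1..m}. 0 < b m i + (- z - \<theta>)) \<and> (\<Sum>i\<in>{1..m}. 1 / (b m i + (- z - \<theta>))) \<le> real m * (IB \<theta> + \<epsilon>)"
    by blast+
  define W where "W m n \<longleftrightarrow> 1 \<le> m \<and> 1 \<le> n \<and> n0 \<le> m \<and> n0 \<le> n" for m n
  \<comment> \<open>Every t with m = ceiling (x t) and n = ceiling (y t) is at least s m n. Bounding
    G by s m n thus covers a continuum of times by countably many events.\<close>
  define s where "s m n = max ((real m - 1) / x) ((real n - 1) / y)" for m n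
  define c1 where "c1 = min (1 / x) (1 / y) / 2"
  have IA0: "0 \<le> IA" unfolding IA_def by (rule A.recip_nonneg[OF za])
  have IBn: "0 \<le> IB \<theta>" unfolding IB_def by (rule B.recip_nonneg[OF zb])
  have sx: "real m \<le> x * s m n + 1" "real n \<le> y * s m n + 1" for m n
  proof -
    have "(real m - 1) / x \<le> s m n" "(real n - 1) / y \<le> s m n" by (auto simp: s_def)
    then show "real m \<le> x * s m n + 1" "real n \<le> y * s m n + 1" using xy by (simp_all add: field_simps)
  qed
  have "AE \<xi> in exp_product_space. \<exists>N. \<forall>m n. W m n \<longrightarrow> N \<le> m + n \<longrightarrow> G m n \<xi> \<le> s m n"
  proof (rule AE_upper[where \<theta>=\<theta> and \<kappa>="\<delta> / 2" and d=c1 and u=z])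
    show "0 < c1" using xy by (simp add: c1_def)
    show "1 \<le> m \<and> 1 \<le> n \<and> (\<forall>i\<in>{1..m}. 0 < a m i + z) \<and> (\<forall>j\<in>{1..n}. 0 < b n j - z - \<theta>)" if "W m n" for m n
      using that n0(1)[of m] n0(2)[of n] by (auto simp: W_def algebra_simps)
    show "(\<Sum>i\<in>{1..m}. 1 / (a m i + z)) + (\<Sum>j\<in>{1..n}. 1 / (b n j - z - \<theta>)) \<le> (1 - \<delta> / 2) * s m n + (IA + \<epsilon> + (IB \<theta> + \<epsilon>))"
      if w: "W m n" for m n
    proof -
      have s0: "0 \<le> s m n" using w xy by (auto simp: W_def s_def le_max_iff_disj)
      have "(\<Sum>i\<in>{1..m}. 1 / (a m i + z)) + (\<Sum>j\<in>{1..n}. 1 / (b n j - z - \<theta>)) \<le> real m * (IA + \<epsilon>) + real n * (IB \<theta> + \<epsilon>)"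
        using w n0(1)[of m] n0(2)[of n] by (intro add_mono) (auto simp: W_def algebra_simps)
      also have "\<dots> \<le> (x * s m n + 1) * (IA + \<epsilon>) + (y * s m n + 1) * (IB \<theta> + \<epsilon>)"
        using sx IA0 IBn \<epsilon> by (intro add_mono mult_right_mono) auto
      also have "\<dots> = s m n * (x * IA + y * IB \<theta> + \<epsilon> * (x + y)) + (IA + \<epsilon> + (IB \<theta> + \<epsilon>))"
        by (simp add: algebra_simps)
      also have "\<dots> \<le> s m n * (1 - \<delta> / 2) + (IA + \<epsilon> + (IB \<theta> + \<epsilon>))"
        using sl s0 unfolding \<epsilon>xy by (intro add_right_mono mult_left_mono) auto
      finally show ?thesis by (simp add: mult.commute)
    qed
    show "c1 * real (m + n) - 2 * c1 \<le> s m n" if "W m n" for m n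
    proof -
      have p: "0 \<le> real m - 1" "0 \<le> real n - 1" using that by (auto simp: W_def)
      have "2 * (c1 * (real m - 1)) \<le> (real m - 1) / x" "2 * (c1 * (real n - 1)) \<le> (real n - 1) / y"
        using mult_right_mono[OF min.cobounded1[of "1 / x" "1 / y"] p(1)]
          mult_right_mono[OF min.cobounded2[of "1 / x" "1 / y"] p(2)] by (auto simp: c1_def)
      then have "2 * (c1 * (real m - 1)) \<le> s m n" "2 * (c1 * (real n - 1)) \<le> s m n"
        unfolding s_def by linarith+
      then show ?thesis by (simp add: algebra_simps)
    qed
  qed (use \<theta> \<delta> in auto)
  then show ?thesis
  proof eventually_elim
    case (elim \<xi>)
    then obtain N where N: "\<And>m n. W m n \<Longrightarrow> N \<le> m + n \<Longrightarrow> G m n \<xi> \<le> s m n" by blast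
    show ?case
      using eventually_gt_at_top[of "0 :: real"] eventually_ge_at_top[of "real (n0 + N) / x"] eventually_ge_at_top[of "real (n0 + N) / y"]
    proof eventually_elim
      case (elim t)
      have xt: "0 < x * t" "0 < y * t" using elim xy by auto
      note ce = nat_ceiling_bounds[OF xt(1)] nat_ceiling_bounds[OF xt(2)]
      have "real (n0 + N) \<le> x * t" "real (n0 + N) \<le> y * t" using elim xy by (auto simp: field_simps)
      then have "n0 + N \<le> nat \<lceil>x * t\<rceil>" "n0 + N \<le> nat \<lceil>y * t\<rceil>"
        using ce by linarith+
      then have "W (nat \<lceil>x * t\<rceil>) (nat \<lceil>y * t\<rceil>)" "N \<le> nat \<lceil>x * t\<rceil> + nat \<lceil>y * t\<rceil>"
        using ce by (auto simp: W_def)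
      from N[OF this] have "G (nat \<lceil>x * t\<rceil>) (nat \<lceil>y * t\<rceil>) \<xi> \<le> s (nat \<lceil>x * t\<rceil>) (nat \<lceil>y * t\<rceil>)" .
      also have "\<dots> \<le> t" unfolding s_def using ce xy by (auto simp: field_simps)
      finally show ?case .
    qed
  qed
qed

text \<open>With the number \<open>k\<close> of rows fixed, their contribution to the mean is a
  constant, so z need not lie below \<bb>: it only has to stay below the smallest parameter of these
  rows. This is how the supremum of the minima enters on the axis.\<close>

lemma AE_upper_row:
  assumes x: "0 < x" and k: "1 \<le> k" and z: "- \<aa> < ereal z" "z < min_param b k"
    and lt: "x * (LINT s|\<alpha>. 1 / (s + z)) < 1"
  shows "AE \<xi> in exp_product_space. \<forall>\<^sub>F t in at_top. G (nat \<lceil>x * t\<rceil>) k \<xi> \<le> t"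
proof -
  define IA where "IA = (LINT s|\<alpha>. 1 / (s + z))"
  define \<delta> where "\<delta> = 1 - x * IA"
  have \<delta>: "0 < \<delta>" using lt by (simp add: \<delta>_def IA_def)
  have za: "ereal (- z) < \<aa>" using z by (metis ereal_uminus_less_reorder uminus_ereal.simps(1))
  define \<theta> where "\<theta> = (min_param b k - z) / 2"
  have \<theta>: "0 < \<theta>" using z by (simp add: \<theta>_def)
  have bk: "0 < b k j - z - \<theta>" if "j \<in> {1..k}" for j
    using min_param_le[OF that, of b] z by (simp add: \<theta>_def field_simps)
  define K0 where "K0 = (\<Sum>j\<in>{1..k}. 1 / (b k j - z - \<theta>))"
  define \<epsilon> where "\<epsilon> = \<delta> / (2 * x)"
  have \<epsilon>: "0 < \<epsilon>" using \<delta> x by (simp add: \<epsilon>_def)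
  obtain n0 where n0: "\<And>m. n0 \<le> m \<Longrightarrow> (\<forall>i\<in>{1..m}. 0 < a m i + z) \<and> (\<Sum>i\<in>{1..m}. 1 / (a m i + z)) \<le> real m * (IA + \<epsilon>)"
    using A.recip_sum_upper[OF za \<epsilon>, folded IA_def] unfolding eventually_sequentially by blast
  define W where "W m n \<longleftrightarrow> 1 \<le> m \<and> n = k \<and> n0 \<le> m" for m n
  define s where "s m n = (real m - 1) / x" for m n :: nat
  have IA0: "0 \<le> IA" unfolding IA_def by (rule A.recip_nonneg[OF za])
  have "AE \<xi> in exp_product_space. \<exists>N. \<forall>m n. W m n \<longrightarrow> N \<le> m + n \<longrightarrow> G m n \<xi> \<le> s m n"
  proof (rule AE_upper[where \<theta>=\<theta> and \<kappa>="\<delta> / 2" and d="1 / x" and u=z])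
    show "1 \<le> m \<and> 1 \<le> n \<and> (\<forall>i\<in>{1..m}. 0 < a m i + z) \<and> (\<forall>j\<in>{1..n}. 0 < b n j - z - \<theta>)" if "W m n" for m n
      using that n0(1)[of m] bk k by (auto simp: W_def)
    show "(\<Sum>i\<in>{1..m}. 1 / (a m i + z)) + (\<Sum>j\<in>{1..n}. 1 / (b n j - z - \<theta>)) \<le> (1 - \<delta> / 2) * s m n + (IA + \<epsilon> + K0)"
      if w: "W m n" for m n
    proof -
      have "(\<Sum>i\<in>{1..m}. 1 / (a m i + z)) + (\<Sum>j\<in>{1..n}. 1 / (b n j - z - \<theta>)) \<le> real m * (IA + \<epsilon>) + K0"
        using w n0(1)[of m] by (auto simp: W_def K0_def)
      also have "real m = x * s m n + 1" using x by (simp add: s_def)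
      also have "(x * s m n + 1) * (IA + \<epsilon>) + K0 = s m n * (x * IA + \<delta> / 2) + (IA + \<epsilon> + K0)"
      proof -
        have "x * \<epsilon> = \<delta> / 2" using x by (simp add: \<epsilon>_def)
        moreover have "(x * s m n + 1) * (IA + \<epsilon>) + K0 = s m n * (x * IA + x * \<epsilon>) + (IA + \<epsilon> + K0)"
          by algebra
        ultimately show ?thesis by simp
      qed
      also have "x * IA + \<delta> / 2 = 1 - \<delta> / 2" by (simp add: \<delta>_def field_simps)
      finally show ?thesis by (simp add: mult.commute)
    qed
    show "1 / x * real (m + n) - (1 + real k) / x \<le> s m n" if "W m n" for m n
      using that x by (simp add: W_def s_def field_simps)
  qed (use \<theta> \<delta> x in auto)
  then show ?thesis
  proof eventually_elim
    case (elim \<xi>)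
    then obtain N where N: "\<And>m n. W m n \<Longrightarrow> N \<le> m + n \<Longrightarrow> G m n \<xi> \<le> s m n" by blast
    show ?case
      using eventually_gt_at_top[of "0 :: real"] eventually_ge_at_top[of "real (n0 + N) / x"]
    proof eventually_elim
      case (elim t)
      have xt: "0 < x * t" using elim x by auto
      note ce = nat_ceiling_bounds[OF xt]
      have "real (n0 + N) \<le> x * t" using elim x by (auto simp: field_simps)
      then have "n0 + N \<le> nat \<lceil>x * t\<rceil>" using ce by linarith
      then have "W (nat \<lceil>x * t\<rceil>) k" "N \<le> nat \<lceil>x * t\<rceil> + k"
        using ce by (auto simp: W_def)
      from N[OF this] have "G (nat \<lceil>x * t\<rceil>) k \<xi> \<le> s (nat \<lceil>x * t\<rceil>) k" .
      also have "\<dots> \<le> t" unfolding s_def using ce x by (auto simp: field_simps)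
      finally show ?case .
    qed
  qed
qed

text \<open>The path runs along the single row \<open>q\<close> of minimal parameter. Its rates are
  at most a i + v and may be arbitrarily close to 0, hence the dominated version of the lower
  tail.\<close>

lemma AE_lower_row:
  assumes v: "\<And>n. 1 \<le> n \<Longrightarrow> min_param b n \<le> v" "ereal (- v) < \<aa>" and K: "0 < K" and \<epsilon>: "0 < \<epsilon>"
  shows "AE \<xi> in exp_product_space. \<exists>N. \<forall>m n. 1 \<le> m \<longrightarrow> 1 \<le> n \<longrightarrow> N \<le> m + n \<longrightarrow> real n \<le> K * real m \<longrightarrow>
    real m * ((LINT s|\<alpha>. 1 / (s + v)) - \<epsilon>) \<le> G m n \<xi>"
proof -
  define IA where "IA = (LINT s|\<alpha>. 1 / (s + v))"
  obtain t where t: "- v < t" "ereal t < \<aa>" using ereal_dense2[OF v(2)] by auto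
  define r where "r = t + v"
  have r: "0 < r" using t by (simp add: r_def)
  have e2: "0 < \<epsilon> / 2" using \<epsilon> by simp
  have "\<forall>\<^sub>F m in sequentially. real m * (IA - \<epsilon> / 2) \<le> (\<Sum>i\<in>{1..m}. 1 / (a m i + v)) \<and> (\<forall>i\<in>{1..m}. t < a m i)"
    using A.recip_sum_uniform_lower[OF v(2) e2, of v] A.eventually_param_ge[OF t(2)]
    by eventually_elim (simp add: IA_def)
  then obtain n0 where "\<forall>m\<ge>n0. real m * (IA - \<epsilon> / 2) \<le> (\<Sum>i\<in>{1..m}. 1 / (a m i + v)) \<and> (\<forall>i\<in>{1..m}. t < a m i)"
    unfolding eventually_sequentially ..
  then have n0: "\<And>m. n0 \<le> m \<Longrightarrow> real m * (IA - \<epsilon> / 2) \<le> (\<Sum>i\<in>{1..m}. 1 / (a m i + v))"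
    "\<And>m. n0 \<le> m \<Longrightarrow> \<forall>i\<in>{1..m}. t < a m i" by blast+
  define W where "W m n \<longleftrightarrow> 1 \<le> m \<and> 1 \<le> n \<and> n0 \<le> m \<and> real n \<le> K * real m" for m n
  \<comment> \<open>In the region n \<le> K m the total m + n is at most (1 + K) m, which turns
    decay in m into decay in m + n.\<close>
  define c where "c = tail_rate r (\<epsilon> / 2) / (1 + K)"
  have "AE \<xi> in exp_product_space. \<exists>N. \<forall>m n. W m n \<longrightarrow> N \<le> m + n \<longrightarrow> real m * (IA - \<epsilon>) \<le> G m n \<xi>"
  proof (rule AE_lower[where c=c and C=1])
    show "0 < c" using tail_rate_pos[OF r e2] K by (simp add: c_def)
    show "1 \<le> m \<and> 1 \<le> n" if "W m n" for m n using that by (simp add: W_def)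
    fix m n assume w: "W m n"
    then have mn: "1 \<le> m" "1 \<le> n" "n0 \<le> m" "real n \<le> K * real m" by (auto simp: W_def)
    obtain q where q: "q \<in> {1..n}" "b n q = min_param b n" using min_param_attained[OF mn(2)] by blast
    let ?R = "rates (a m) (b n)"
    let ?J = "cells m n"
    let ?K = "{1..m} \<times> {q}"
    define \<rho>' where "\<rho>' = (\<lambda>(i, j :: nat). a m i + v)"
    interpret Q: prob_space "expQ ?R ?J" by (rule prob_space_expQ)
    have img: "?K = (\<lambda>i. (i, q)) ` {1..m}" by auto
    have s1: "(\<Sum>c\<in>?K. f c) = (\<Sum>i\<in>{1..m}. f (i, q))" for f :: "nat \<times> nat \<Rightarrow> real"
      unfolding img by (subst sum.reindex) (auto simp: inj_on_def)
    have KJ: "?K \<subseteq> ?J" using q by (auto simp: cells_def)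
    have tail: "Q.prob {w \<in> space (expQ ?R ?J). (\<Sum>c\<in>?K. w c) \<le> (\<Sum>c\<in>?K. 1 / \<rho>' c) - \<epsilon> / 2 * real m}
      \<le> exp (- tail_rate r (\<epsilon> / 2) * real m)"
    proof (rule expQ_sum_lower_tail_dominated[OF finite_cells(1) KJ r _ _ _ e2])
      show "r \<le> \<rho>' c" if "c \<in> ?K" for c
        using that n0(2)[OF mn(3)] by (auto simp: \<rho>'_def r_def intro: less_imp_le)
      show "0 < ?R c" if "c \<in> ?K" for c using that pos[OF mn(1,2) _ q(1)] by (auto simp: rates_def)
      show "?R c \<le> \<rho>' c" if "c \<in> ?K" for c using that v(1)[OF mn(2)] q by (auto simp: rates_def \<rho>'_def)
    qed simp
    have le: "real m * (IA - \<epsilon>) \<le> (\<Sum>c\<in>?K. 1 / \<rho>' c) - \<epsilon> / 2 * real m"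
      using n0(1)[OF mn(3)] unfolding s1 by (simp add: \<rho>'_def algebra_simps)
    have mS: "(\<lambda>w. \<Sum>c\<in>?K. w c) \<in> borel_measurable (expQ ?R ?J)" by (rule measurable_sum_expQ[OF KJ])
    have "AE w in expQ ?R ?J. w \<in> {w \<in> space (expQ ?R ?J). lpp w m n < real m * (IA - \<epsilon>)} \<longrightarrow>
      w \<in> {w \<in> space (expQ ?R ?J). (\<Sum>c\<in>?K. w c) \<le> (\<Sum>c\<in>?K. 1 / \<rho>' c) - \<epsilon> / 2 * real m}"
      using AE_expQ_nonneg[OF finite_cells(1)[of m n], of ?R]
    proof eventually_elim
      case (elim w)
      have "(\<Sum>i\<in>{1..m}. w (i, q)) \<le> lpp w m q"
        using lpp_column_extend[of q 0 m "\<lambda>(i, j). w (j, i)"] q unfolding lpp_swap by simp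
      also have "\<dots> \<le> lpp w m n" by (rule lpp_mono) (use q elim in auto)
      finally show ?case using le unfolding s1 by auto
    qed
    then have "Q.prob {w \<in> space (expQ ?R ?J). lpp w m n < real m * (IA - \<epsilon>)} \<le>
      Q.prob {w \<in> space (expQ ?R ?J). (\<Sum>c\<in>?K. w c) \<le> (\<Sum>c\<in>?K. 1 / \<rho>' c) - \<epsilon> / 2 * real m}"
      by (rule Q.finite_measure_mono_AE) (use mS in measurable)
    also note tail
    also have "exp (- tail_rate r (\<epsilon> / 2) * real m) \<le> 1 * exp (- c * real (m + n))"
    proof -
      have "real (m + n) \<le> (1 + K) * real m" using mn by (simp add: algebra_simps)
      then have "c * real (m + n) \<le> c * ((1 + K) * real m)"
        using tail_rate_pos[OF r e2] K by (intro mult_left_mono) (auto simp: c_def)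
      also have "\<dots> = tail_rate r (\<epsilon> / 2) * real m" using K by (simp add: c_def)
      finally show ?thesis by simp
    qed
    finally show "Q.prob {w \<in> space (expQ ?R ?J). lpp w m n < real m * (IA - \<epsilon>)} \<le> 1 * exp (- c * real (m + n))" .
  qed simp
  then show ?thesis
  proof eventually_elim
    case (elim \<xi>)
    then obtain N where N: "\<And>m n. W m n \<Longrightarrow> N \<le> m + n \<Longrightarrow> real m * (IA - \<epsilon>) \<le> G m n \<xi>" by blast
    \<comment> \<open>In this region a large m + n forces m \<ge> n0.\<close>
    define N' where "N' = max N (nat \<lceil>real n0 * (1 + K)\<rceil>)"
    have "real m * (IA - \<epsilon>) \<le> G m n \<xi>" if mn: "1 \<le> m" "1 \<le> n" "N' \<le> m + n" "real n \<le> K * real m" for m n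
    proof -
      have "real n0 * (1 + K) \<le> real (m + n)"
        using mn(3) unfolding N'_def by linarith
      also have "\<dots> \<le> real m * (1 + K)" using mn(4) by (simp add: algebra_simps)
      finally have "n0 \<le> m" using K by simp
      then show ?thesis using mn by (intro N) (auto simp: W_def N'_def)
    qed
    then show ?case unfolding IA_def by blast
  qed
qed

text \<open>Minimal parameters converge to A0 and B0, so the extremal column and row meet the
  conditions of \<open>lpp_lower_tail\<close> at z0 and z1. The error is split in three: two parts
  for the tail bound, one for passing from sums to integrals.\<close>

lemma AE_lower_cone:
  assumes ab: "\<aa> = ereal A0" "\<bb> = ereal B0" and \<kappa>: "0 < \<kappa>" and \<epsilon>: "0 < \<epsilon>"
  shows "AE \<xi> in exp_product_space. \<exists>N. \<forall>m n. 1 \<le> m \<longrightarrow> 1 \<le> n \<longrightarrow> N \<le> m + n \<longrightarrow>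
    \<kappa> * real m \<le> real n \<longrightarrow> \<kappa> * real n \<le> real m \<longrightarrow>
    shape_fun \<alpha> \<beta> \<aa> \<bb> (real m) (real n) - \<epsilon> * real (m + n) \<le> G m n \<xi>"
proof -
  define d where "d = A0 + B0"
  have d: "0 < d" using pos_lim ab by (simp add: d_def)
  define \<epsilon>1 where "\<epsilon>1 = \<epsilon> / 3"
  have \<epsilon>1: "0 < \<epsilon>1" using \<epsilon> by (simp add: \<epsilon>1_def)
  \<comment> \<open>h \<le> d / 8 keeps z0 \<le> z1 and all denominators below at least d / 2. For
    the minimal column, a p + z0 is at most 3h, so reciprocals differ by at most 3h / (d / 2)^2,
    which the second bound makes at most \<epsilon>1.\<close>
  define h where "h = min (d / 8) (\<epsilon>1 * d\<^sup>2 / 12)"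
  have h: "0 < h" "h \<le> d / 8" using d \<epsilon>1 by (auto simp: h_def)
  have "h \<le> \<epsilon>1 * d\<^sup>2 / 12" by (simp add: h_def)
  then have h2: "3 * h / (d / 2 * (d / 2)) \<le> \<epsilon>1" using d by (simp add: field_simps power2_eq_square)
  define z0 where "z0 = 2 * h - A0"
  define z1 where "z1 = B0 - 2 * h"
  have z01: "z0 \<le> z1" using h by (simp add: z0_def z1_def d_def)
  have za: "ereal (- z0) < \<aa>" using h ab by (simp add: z0_def)
  have zb: "ereal (- (- z1)) < \<bb>" using h ab by (simp add: z1_def)
  have eA: "\<forall>\<^sub>F m in sequentially. (\<forall>i\<in>{1..m}. A0 - h < a m i) \<and> min_param a m < A0 + h \<and>
    (\<forall>z\<in>{z0..z1}. real m * ((LINT s|\<alpha>. 1 / (s + z)) - \<epsilon>1) \<le> (\<Sum>i\<in>{1..m}. 1 / (a m i + z)))"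
  proof -
    have "\<forall>\<^sub>F m in sequentially. ereal (min_param a m) < ereal (A0 + h)"
      using order_tendstoD(2)[OF \<aa>(2), of "ereal (A0 + h)"] h ab by simp
    moreover have "\<forall>\<^sub>F m in sequentially. 1 \<le> m \<and> (\<forall>i\<in>{1..m}. A0 - h < a m i)"
      using A.eventually_param_ge[of "A0 - h"] h ab by simp
    ultimately show ?thesis using A.recip_sum_uniform_lower[OF za \<epsilon>1, of z1]
      by eventually_elim simp
  qed
  have eB: "\<forall>\<^sub>F n in sequentially. (\<forall>j\<in>{1..n}. B0 - h < b n j) \<and> min_param b n < B0 + h \<and>
    (\<forall>z\<in>{- z1..- z0}. real n * ((LINT s|\<beta>. 1 / (s + z)) - \<epsilon>1) \<le> (\<Sum>j\<in>{1..n}. 1 / (b n j + z)))"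
  proof -
    have "\<forall>\<^sub>F m in sequentially. ereal (min_param b m) < ereal (B0 + h)"
      using order_tendstoD(2)[OF \<bb>(2), of "ereal (B0 + h)"] h ab by simp
    moreover have "\<forall>\<^sub>F m in sequentially. 1 \<le> m \<and> (\<forall>i\<in>{1..m}. B0 - h < b m i)"
      using B.eventually_param_ge[of "B0 - h"] h ab by simp
    ultimately show ?thesis using B.recip_sum_uniform_lower[OF zb \<epsilon>1, of "- z0"]
      by eventually_elim simp
  qed
  from eA obtain m0 where "\<forall>m\<ge>m0. (\<forall>i\<in>{1..m}. A0 - h < a m i) \<and> min_param a m < A0 + h \<and>
    (\<forall>z\<in>{z0..z1}. real m * ((LINT s|\<alpha>. 1 / (s + z)) - \<epsilon>1) \<le> (\<Sum>i\<in>{1..m}. 1 / (a m i + z)))"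
    unfolding eventually_sequentially ..
  then have m0: "\<And>m i. m0 \<le> m \<Longrightarrow> i \<in> {1..m} \<Longrightarrow> A0 - h < a m i" "\<And>m. m0 \<le> m \<Longrightarrow> min_param a m < A0 + h"
    "\<And>m z. m0 \<le> m \<Longrightarrow> z \<in> {z0..z1} \<Longrightarrow> real m * ((LINT s|\<alpha>. 1 / (s + z)) - \<epsilon>1) \<le> (\<Sum>i\<in>{1..m}. 1 / (a m i + z))"
    by blast+
  from eB obtain n0 where "\<forall>n\<ge>n0. (\<forall>j\<in>{1..n}. B0 - h < b n j) \<and> min_param b n < B0 + h \<and>
    (\<forall>z\<in>{- z1..- z0}. real n * ((LINT s|\<beta>. 1 / (s + z)) - \<epsilon>1) \<le> (\<Sum>j\<in>{1..n}. 1 / (b n j + z)))"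
    unfolding eventually_sequentially ..
  then have n0: "\<And>m i. n0 \<le> m \<Longrightarrow> i \<in> {1..m} \<Longrightarrow> B0 - h < b m i" "\<And>m. n0 \<le> m \<Longrightarrow> min_param b m < B0 + h"
    "\<And>m z. n0 \<le> m \<Longrightarrow> z \<in> {- z1..- z0} \<Longrightarrow> real m * ((LINT s|\<beta>. 1 / (s + z)) - \<epsilon>1) \<le> (\<Sum>i\<in>{1..m}. 1 / (b m i + z))"
    by blast+
  define W where "W m n \<longleftrightarrow> 1 \<le> m \<and> 1 \<le> n \<and> m0 \<le> m \<and> n0 \<le> n" for m n
  define S where "S m n = shape_fun \<alpha> \<beta> \<aa> \<bb> (real m) (real n) - \<epsilon> * real (m + n)" for m n
  obtain c C where cC: "0 < c" "0 < C" and LT: "\<And>a b z0 z1 m n N p q. z0 \<le> z1 \<Longrightarrow> p \<in> {1..m} \<Longrightarrow> q \<in> {1..n} \<Longrightarrow>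
    (\<forall>i\<in>{1..m}. h \<le> a i + z0) \<Longrightarrow> (\<forall>j\<in>{1..n}. h \<le> b j - z1) \<Longrightarrow>
    (\<forall>j\<in>{1..n}. 1 / (b j - z0) \<le> 1 / (a p + b j) + \<epsilon>1) \<Longrightarrow>
    (\<forall>i\<in>{1..m}. 1 / (a i + z1) \<le> 1 / (a i + b q) + \<epsilon>1) \<Longrightarrow>
    real m \<le> N \<Longrightarrow> real n \<le> N \<Longrightarrow>
    (\<exists>z\<in>{z0..z1}. \<P>(w in expQ (rates a b) (cells m n). lpp w m n < (\<Sum>i\<in>{1..m}. 1 / (a i + z)) + (\<Sum>j\<in>{1..n}. 1 / (b j - z)) - 2 * \<epsilon>1 * N) \<le> C * exp (- c * N))"
    using lpp_lower_tail[OF h(1) \<epsilon>1] by blast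
  have "AE \<xi> in exp_product_space. \<exists>N. \<forall>m n. W m n \<longrightarrow> N \<le> m + n \<longrightarrow> S m n \<le> G m n \<xi>"
  proof (rule AE_lower[where c=c and C=C])
    show "1 \<le> m \<and> 1 \<le> n" if "W m n" for m n using that by (simp add: W_def)
    fix m n assume w: "W m n"
    then have mn: "1 \<le> m" "1 \<le> n" "m0 \<le> m" "n0 \<le> n" by (auto simp: W_def)
    obtain p where p: "p \<in> {1..m}" "a m p = min_param a m" using min_param_attained[OF mn(1)] by blast
    obtain q where q: "q \<in> {1..n}" "b n q = min_param b n" using min_param_attained[OF mn(2)] by blast
    have rd: "1 / x \<le> 1 / y + \<epsilon>1" if "d / 2 \<le> x" "d / 2 \<le> y" "y - x \<le> 3 * h" for x y
    proof -
      have xy: "0 < x" "0 < y" using that d by auto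
      have "1 / x - 1 / y = (y - x) / (x * y)" using xy by (simp add: field_simps)
      also have "\<dots> \<le> 3 * h / (x * y)" using that xy by (intro divide_right_mono) auto
      also have "\<dots> \<le> 3 * h / (d / 2 * (d / 2))"
        using that xy d h by (intro divide_left_mono mult_mono) auto
      finally show ?thesis using h2 by simp
    qed
    have "\<exists>z\<in>{z0..z1}. \<P>(w in expQ (rates (a m) (b n)) (cells m n). lpp w m n < (\<Sum>i\<in>{1..m}. 1 / (a m i + z)) + (\<Sum>j\<in>{1..n}. 1 / (b n j - z)) - 2 * \<epsilon>1 * real (m + n)) \<le> C * exp (- c * real (m + n))"
    proof (rule LT[OF z01 p(1) q(1)]; (intro ballI)?)
      show "h \<le> a m i + z0" if "i \<in> {1..m}" for i using m0(1)[OF mn(3) that] by (simp add: z0_def)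
      show "h \<le> b n j - z1" if "j \<in> {1..n}" for j using n0(1)[OF mn(4) that] by (simp add: z1_def)
      show "1 / (b n j - z0) \<le> 1 / (a m p + b n j) + \<epsilon>1" if "j \<in> {1..n}" for j
      proof (rule rd)
        have "A0 - h < a m p" "a m p < A0 + h" "B0 - h < b n j"
          using m0(1)[OF mn(3) p(1)] m0(2)[OF mn(3)] p(2) n0(1)[OF mn(4) that] by auto
        then show "d / 2 \<le> b n j - z0" "d / 2 \<le> a m p + b n j" "a m p + b n j - (b n j - z0) \<le> 3 * h"
          using h by (auto simp: z0_def d_def)
      qed
      show "1 / (a m i + z1) \<le> 1 / (a m i + b n q) + \<epsilon>1" if "i \<in> {1..m}" for i
      proof (rule rd)
        have "B0 - h < b n q" "b n q < B0 + h" "A0 - h < a m i"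
          using n0(1)[OF mn(4) q(1)] n0(2)[OF mn(4)] q(2) m0(1)[OF mn(3) that] by auto
        then show "d / 2 \<le> a m i + z1" "d / 2 \<le> a m i + b n q" "a m i + b n q - (a m i + z1) \<le> 3 * h"
          using h by (auto simp: z1_def d_def)
      qed
    qed auto
    then obtain z where z: "z \<in> {z0..z1}" and
      pr: "\<P>(w in expQ (rates (a m) (b n)) (cells m n). lpp w m n < (\<Sum>i\<in>{1..m}. 1 / (a m i + z)) + (\<Sum>j\<in>{1..n}. 1 / (b n j - z)) - 2 * \<epsilon>1 * real (m + n)) \<le> C * exp (- c * real (m + n))" ..
    have zab: "- \<aa> < ereal z" "ereal z < \<bb>" using z h ab by (auto simp: z0_def z1_def)
    \<comment> \<open>\<open>shape_fun\<close> is an infimum, hence at most the value at whichever z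
      the tail bound returned.\<close>
    have "shape_fun \<alpha> \<beta> \<aa> \<bb> (real m) (real n) \<le> real m * (LINT s|\<alpha>. 1 / (s + z)) + real n * (LINT s|\<beta>. 1 / (s - z))"
      unfolding shape_fun_def
    proof (rule cINF_lower)
      show "bdd_below ((\<lambda>z. real m * (LINT s|\<alpha>. 1 / (s + z)) + real n * (LINT s|\<beta>. 1 / (s - z))) ` {z. - \<aa> < ereal z \<and> ereal z < \<bb>})"
      proof (rule bdd_belowI2)
        fix z assume "z \<in> {z. - \<aa> < ereal z \<and> ereal z < \<bb>}"
        then show "0 \<le> real m * (LINT s|\<alpha>. 1 / (s + z)) + real n * (LINT s|\<beta>. 1 / (s - z))"
          using A.recip_nonneg[of z] B.recip_nonneg[of "- z"] ab by simp
      qed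
    qed (use zab in simp)
    also have "\<dots> \<le> ((\<Sum>i\<in>{1..m}. 1 / (a m i + z)) + real m * \<epsilon>1) + ((\<Sum>j\<in>{1..n}. 1 / (b n j - z)) + real n * \<epsilon>1)"
    proof (rule add_mono)
      show "real m * (LINT s|\<alpha>. 1 / (s + z)) \<le> (\<Sum>i\<in>{1..m}. 1 / (a m i + z)) + real m * \<epsilon>1"
        using m0(3)[OF mn(3) z] by (simp add: right_diff_distrib)
      show "real n * (LINT s|\<beta>. 1 / (s - z)) \<le> (\<Sum>j\<in>{1..n}. 1 / (b n j - z)) + real n * \<epsilon>1"
        using n0(3)[OF mn(4), of "- z"] z by (simp add: right_diff_distrib)
    qed
    finally have "shape_fun \<alpha> \<beta> \<aa> \<bb> (real m) (real n) \<le>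
      ((\<Sum>i\<in>{1..m}. 1 / (a m i + z)) + real m * \<epsilon>1) + ((\<Sum>j\<in>{1..n}. 1 / (b n j - z)) + real n * \<epsilon>1)" .
    moreover have "\<epsilon> * real (m + n) = 3 * (real m * \<epsilon>1) + 3 * (real n * \<epsilon>1)"
      by (simp add: \<epsilon>1_def algebra_simps)
    moreover have "2 * \<epsilon>1 * real (m + n) = 2 * (real m * \<epsilon>1) + 2 * (real n * \<epsilon>1)"
      by (simp add: algebra_simps)
    ultimately have "S m n \<le> (\<Sum>i\<in>{1..m}. 1 / (a m i + z)) + (\<Sum>j\<in>{1..n}. 1 / (b n j - z)) - 2 * \<epsilon>1 * real (m + n)"
      unfolding S_def by linarith
    then have "\<P>(w in expQ (rates (a m) (b n)) (cells m n). lpp w m n < S m n) \<le>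
      \<P>(w in expQ (rates (a m) (b n)) (cells m n). lpp w m n < (\<Sum>i\<in>{1..m}. 1 / (a m i + z)) + (\<Sum>j\<in>{1..n}. 1 / (b n j - z)) - 2 * \<epsilon>1 * real (m + n))"
      using measurable_lpp_expQ[OF subset_refl, of m n "rates (a m) (b n)"]
      by (intro finite_measure.finite_measure_mono prob_space.finite_measure prob_space_expQ) auto
    with pr show "\<P>(w in expQ (rates (a m) (b n)) (cells m n). lpp w m n < S m n) \<le> C * exp (- c * real (m + n))"
      by (rule order_trans[rotated])
  qed (use cC in auto)
  then show ?thesis
  proof eventually_elim
    case (elim \<xi>)
    then obtain N where N: "\<And>m n. W m n \<Longrightarrow> N \<le> m + n \<Longrightarrow> S m n \<le> G m n \<xi>" by blast
    \<comment> \<open>In the cone m and n are comparable, so a large m + n makes both of them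
      large.\<close>
    define N' where "N' = max N (nat \<lceil>real (max m0 n0) * (1 + 1 / \<kappa>)\<rceil>)"
    have "S m n \<le> G m n \<xi>" if mn: "1 \<le> m" "1 \<le> n" "N' \<le> m + n" "\<kappa> * real m \<le> real n" "\<kappa> * real n \<le> real m" for m n
    proof -
      have N': "real (max m0 n0) * (1 + 1 / \<kappa>) \<le> real m + real n"
        using mn(3) unfolding N'_def by linarith
      have k: "0 < 1 + 1 / \<kappa>" using \<kappa> by (simp add: add_pos_pos)
      have "real m + real n \<le> real m * (1 + 1 / \<kappa>)" "real m + real n \<le> real n * (1 + 1 / \<kappa>)"
        using mn \<kappa> by (simp_all add: field_simps)
      with N' have "real (max m0 n0) * (1 + 1 / \<kappa>) \<le> real m * (1 + 1 / \<kappa>)" "real (max m0 n0) * (1 + 1 / \<kappa>) \<le> real n * (1 + 1 / \<kappa>)" by linarith+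
      then have "max m0 n0 \<le> m" "max m0 n0 \<le> n" using k by (simp_all only: mult_le_cancel_right_pos of_nat_le_iff)
      then show ?thesis using mn by (intro N) (auto simp: W_def N'_def)
    qed
    then show ?case unfolding S_def by blast
  qed
qed

end

section \<open>From last-passage bounds to the Hausdorff limit\<close>

text \<open>The flags \<open>X\<close> and \<open>Y\<close> tell which coordinates the window truncates at \<open>C\<close>; \<open>p\<close> and \<open>q\<close> are the
  reciprocals of the axis intercepts.\<close>

locale shape_limit =
  fixes \<gamma> :: "real \<Rightarrow> real \<Rightarrow> real" and p q C :: real and g :: "nat \<Rightarrow> nat \<Rightarrow> real"
    and X Y :: bool
  assumes hom: "\<And>l x y. 0 < l \<Longrightarrow> 0 < x \<Longrightarrow> 0 < y \<Longrightarrow> \<gamma> (l * x) (l * y) = l * \<gamma> x y"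
    and mono: "\<And>x y x' y'. 0 < x \<Longrightarrow> x \<le> x' \<Longrightarrow> 0 < y \<Longrightarrow> y \<le> y' \<Longrightarrow> \<gamma> x y \<le> \<gamma> x' y'"
    and ge: "\<And>x y. 0 < x \<Longrightarrow> 0 < y \<Longrightarrow> x * p \<le> \<gamma> x y" "\<And>x y. 0 < x \<Longrightarrow> 0 < y \<Longrightarrow> y * q \<le> \<gamma> x y"
    and pq: "0 \<le> p" "0 \<le> q" "\<not> X \<Longrightarrow> 0 < p" "\<not> Y \<Longrightarrow> 0 < q"
    and C: "0 < C"
    and row: "\<And>K \<epsilon>. 0 < K \<Longrightarrow> 0 < \<epsilon> \<Longrightarrow> \<exists>N. \<forall>m n. 1 \<le> m \<longrightarrow> 1 \<le> n \<longrightarrow> N \<le> m + n \<longrightarrow>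
      real n \<le> K * real m \<longrightarrow> real m * (p - \<epsilon>) \<le> g m n"
    and column: "\<And>K \<epsilon>. 0 < K \<Longrightarrow> 0 < \<epsilon> \<Longrightarrow> \<exists>N. \<forall>m n. 1 \<le> m \<longrightarrow> 1 \<le> n \<longrightarrow> N \<le> m + n \<longrightarrow>
      real m \<le> K * real n \<longrightarrow> real n * (q - \<epsilon>) \<le> g m n"
    and cone: "\<And>\<kappa> \<epsilon>. 0 < \<kappa> \<Longrightarrow> 0 < \<epsilon> \<Longrightarrow> \<exists>N. \<forall>m n. 1 \<le> m \<longrightarrow> 1 \<le> n \<longrightarrow> N \<le> m + n \<longrightarrow>
      \<kappa> * real m \<le> real n \<longrightarrow> \<kappa> * real n \<le> real m \<longrightarrow> \<gamma> (real m) (real n) - \<epsilon> * real (m + n) \<le> g m n"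
    and up: "\<And>x y. x \<in> \<rat> \<Longrightarrow> y \<in> \<rat> \<Longrightarrow> 0 < x \<Longrightarrow> 0 < y \<Longrightarrow> \<gamma> x y < 1 \<Longrightarrow>
      \<forall>\<^sub>F t in at_top. g (nat \<lceil>x * t\<rceil>) (nat \<lceil>y * t\<rceil>) \<le> t"
    and up_row: "\<And>x. x \<in> \<rat> \<Longrightarrow> 0 < x \<Longrightarrow> x * p < 1 \<Longrightarrow> \<exists>k\<ge>1. \<forall>\<^sub>F t in at_top. g (nat \<lceil>x * t\<rceil>) k \<le> t"
    and up_column: "\<And>y. y \<in> \<rat> \<Longrightarrow> 0 < y \<Longrightarrow> y * q < 1 \<Longrightarrow> \<exists>k\<ge>1. \<forall>\<^sub>F t in at_top. g k (nat \<lceil>y * t\<rceil>) \<le> t"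
begin

definition S :: "(real \<times> real) set" where
  "S = {(x, y). 0 \<le> x \<and> 0 \<le> y \<and> (X \<longrightarrow> x \<le> C) \<and> (Y \<longrightarrow> y \<le> C)}"

definition L :: "(real \<times> real) set" where
  "L = {(x, y). 0 < x \<and> 0 < y \<and> \<gamma> x y \<le> 1} \<union>
     ({(x, 0) | x. 0 \<le> x \<and> x * p \<le> 1} \<union> {(0, y) | y. 0 \<le> y \<and> y * q \<le> 1})"

definition R :: "real \<Rightarrow> (real \<times> real) set" where
  "R t = {(x, y). 0 < x \<and> 0 < y \<and> g (nat \<lceil>x\<rceil>) (nat \<lceil>y\<rceil>) \<le> t}"

definition Rs :: "real \<Rightarrow> (real \<times> real) set" where
  "Rs t = closure ((\<lambda>u. u /\<^sub>R t) ` R t)"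

section \<open>The limit set and the window\<close>

lemma L_iff: "(x, y) \<in> L \<longleftrightarrow> (0 < x \<and> 0 < y \<and> \<gamma> x y \<le> 1) \<or> (y = 0 \<and> 0 \<le> x \<and> x * p \<le> 1) \<or> (x = 0 \<and> 0 \<le> y \<and> y * q \<le> 1)"
  by (auto simp: L_def)

lemma L_bounds:
  assumes "(x, y) \<in> L"
  shows "0 \<le> x" "0 \<le> y" "x * p \<le> 1" "y * q \<le> 1"
proof -
  have "0 \<le> x \<and> 0 \<le> y \<and> x * p \<le> 1 \<and> y * q \<le> 1"
    using assms ge[of x y] unfolding L_iff by auto
  then show "0 \<le> x" "0 \<le> y" "x * p \<le> 1" "y * q \<le> 1" by auto
qed

lemma dist_le_sum: "dist (x, y) (x', y') \<le> \<bar>x - x'\<bar> + \<bar>y - y'\<bar>" for x y x' y' :: real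
  unfolding dist_Pair_Pair by (rule order_trans[OF sqrt_sum_squares_le_sum_abs]) (simp add: dist_real_def)

lemma S_nonneg: "(x, y) \<in> S \<Longrightarrow> 0 \<le> x \<and> 0 \<le> y"
  by (simp add: S_def)

lemma closed_S: "closed S"
proof -
  have "S = ({x. 0 \<le> x} \<inter> {x. X \<longrightarrow> x \<le> C}) \<times> ({y. 0 \<le> y} \<inter> {y. Y \<longrightarrow> y \<le> C})"
    by (auto simp: S_def)
  moreover have "closed {x. X \<longrightarrow> x \<le> C}" "closed {x. Y \<longrightarrow> x \<le> C}"
    by (cases X; cases Y; simp add: closed_Collect_le)+
  ultimately show ?thesis
    by (auto intro!: closed_Times closed_Int closed_Collect_le)
qed

lemma closed_L: "closed L"
  unfolding closed_sequential_limits
proof (intro allI impI, elim conjE)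
  fix f l assume f: "\<forall>n. f n \<in> L" and lim: "f \<longlonglongrightarrow> l"
  obtain x y where l: "l = (x, y)" by (cases l)
  define u where "u n = fst (f n)" for n
  define v where "v n = snd (f n)" for n
  have uv: "(u n, v n) \<in> L" for n using f by (simp add: u_def v_def)
  have lu: "u \<longlonglongrightarrow> x" using tendsto_fst[OF lim] l by (simp add: u_def[abs_def])
  have lv: "v \<longlonglongrightarrow> y" using tendsto_snd[OF lim] l by (simp add: v_def[abs_def])
  have x0: "0 \<le> x" by (rule LIMSEQ_le_const[OF lu]) (use L_bounds[OF uv] in auto)
  have y0: "0 \<le> y" by (rule LIMSEQ_le_const[OF lv]) (use L_bounds[OF uv] in auto)
  have xp: "x * p \<le> 1" by (rule LIMSEQ_le_const2[OF tendsto_mult_right[OF lu]]) (use L_bounds[OF uv] in auto)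
  have yq: "y * q \<le> 1" by (rule LIMSEQ_le_const2[OF tendsto_mult_right[OF lv]]) (use L_bounds[OF uv] in auto)
  show "l \<in> L"
  proof (cases "0 < x \<and> 0 < y")
    case False
    then show ?thesis using x0 y0 xp yq unfolding l L_iff by auto
  next
    case True
    have "\<gamma> x y \<le> 1 + e" if e: "0 < e" for e
    proof -
      have "x < (1 + e) * x" "y < (1 + e) * y" using True e by auto
      have "x / (1 + e) < x" "y / (1 + e) < y" using True e by (auto simp: field_simps)
      then have "\<forall>\<^sub>F n in sequentially. x / (1 + e) < u n" "\<forall>\<^sub>F n in sequentially. y / (1 + e) < v n"
        using order_tendstoD(1)[OF lu] order_tendstoD(1)[OF lv] by auto
      then have "\<forall>\<^sub>F n in sequentially. x / (1 + e) < u n \<and> y / (1 + e) < v n" by (rule eventually_conj)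
      then obtain n where n: "x / (1 + e) < u n" "y / (1 + e) < v n"
        unfolding eventually_sequentially by blast
      then have pos: "0 < u n" "0 < v n" using True e by (auto intro: less_trans[rotated])
      then have "\<gamma> (u n) (v n) \<le> 1" using uv[of n] by (simp add: L_iff)
      have "\<gamma> x y \<le> \<gamma> ((1 + e) * u n) ((1 + e) * v n)"
        using True n e by (intro mono) (auto simp: field_simps)
      also have "\<dots> = (1 + e) * \<gamma> (u n) (v n)" using pos e by (intro hom) auto
      also have "\<dots> \<le> (1 + e) * 1" using \<open>\<gamma> (u n) (v n) \<le> 1\<close> e by (intro mult_left_mono) auto
      finally show ?thesis by simp
    qed
    then have "\<gamma> x y \<le> 1" by (rule field_le_epsilon)
    then show ?thesis using True unfolding l L_iff by simp
  qed
qed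

lemma hausdorff_dom_L: "hausdorff_dom (S \<inter> L)"
proof -
  define M where "M = C + 1 / p + 1 / q"
  have "x \<in> {0..M} \<and> y \<in> {0..M}" if "(x, y) \<in> S \<inter> L" for x y
  proof -
    have "(x, y) \<in> S" using that by simp
    then have S: "0 \<le> x \<and> 0 \<le> y \<and> (X \<longrightarrow> x \<le> C) \<and> (Y \<longrightarrow> y \<le> C)" by (simp add: S_def)
    have L: "x * p \<le> 1" "y * q \<le> 1" using that L_bounds[of x y] by auto
    have "\<not> X \<Longrightarrow> x \<le> 1 / p" "\<not> Y \<Longrightarrow> y \<le> 1 / q" using L pq by (auto simp: field_simps)
    then have "x \<le> C \<or> x \<le> 1 / p" "y \<le> C \<or> y \<le> 1 / q" using S by blast+
    moreover have "0 \<le> 1 / p" "0 \<le> 1 / q" using pq by auto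
    ultimately have "x \<le> M" "y \<le> M" using C unfolding M_def by linarith+
    then show ?thesis using S by simp
  qed
  then have "S \<inter> L \<subseteq> {0..M} \<times> {0..M}" by auto
  then have "bounded (S \<inter> L)" by (rule bounded_subset[rotated]) (intro bounded_Times bounded_closed_interval)
  moreover have "(0, 0) \<in> S \<inter> L" using C by (auto simp: S_def L_iff)
  ultimately show ?thesis unfolding hausdorff_dom_def using closed_S closed_L by blast
qed

text \<open>A point of the closure is within 1 / t of the scaled cluster, that is within one lattice
  unit before scaling; the ceiling adds another unit on one side, whence the offsets 2 and
  1.\<close>

lemma Rs_cell:
  assumes t: "0 < t" and xy: "(x, y) \<in> Rs t"
  shows "\<exists>m n. 1 \<le> m \<and> 1 \<le> n \<and> g m n \<le> t \<and> real m \<le> x * t + 2 \<and> x * t \<le> real m + 1 \<and>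
    real n \<le> y * t + 2 \<and> y * t \<le> real n + 1"
proof -
  have "\<exists>r\<in>(\<lambda>u. u /\<^sub>R t) ` R t. dist r (x, y) < 1 / t"
    using xy t unfolding Rs_def closure_approachable by simp
  then obtain x' y' where r: "(x', y') \<in> R t" "dist ((x', y') /\<^sub>R t) (x, y) < 1 / t" by auto
  have "dist (x' / t) x < 1 / t" "dist (y' / t) y < 1 / t"
    using dist_fst_le[of "(x', y') /\<^sub>R t" "(x, y)"] dist_snd_le[of "(x', y') /\<^sub>R t" "(x, y)"] r(2)
    by (auto simp: divide_inverse mult.commute)
  then have d: "\<bar>x' - x * t\<bar> < 1" "\<bar>y' - y * t\<bar> < 1"
    using t by (auto simp: dist_real_def abs_less_iff field_simps)
  have pos: "0 < x'" "0 < y'" "g (nat \<lceil>x'\<rceil>) (nat \<lceil>y'\<rceil>) \<le> t" using r(1) by (auto simp: R_def)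
  have cx: "x' \<le> real (nat \<lceil>x'\<rceil>)" "real (nat \<lceil>x'\<rceil>) < x' + 1" "1 \<le> nat \<lceil>x'\<rceil>"
    "y' \<le> real (nat \<lceil>y'\<rceil>)" "real (nat \<lceil>y'\<rceil>) < y' + 1" "1 \<le> nat \<lceil>y'\<rceil>"
    using pos by (auto simp: of_nat_nat) linarith+
  show ?thesis
    by (rule exI[of _ "nat \<lceil>x'\<rceil>"], rule exI[of _ "nat \<lceil>y'\<rceil>"]) (use cx d pos(3) in linarith)
qed

text \<open>Only the larger coordinate needs a bound. Either the window truncates it, or its axis
  constant is positive and the row or column estimate with K = 1 bounds it by a multiple of
  t.\<close>

lemma ex_cell_bound:
  "\<exists>M>0. \<forall>\<^sub>F t in at_top. \<forall>m n. 1 \<le> m \<longrightarrow> 1 \<le> n \<longrightarrow> g m n \<le> t \<longrightarrow> (X \<longrightarrow> real m \<le> C * t + 2) \<longrightarrow>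
    (Y \<longrightarrow> real n \<le> C * t + 2) \<longrightarrow> real m \<le> M * t \<and> real n \<le> M * t"
proof -
  \<comment> \<open>If p = 0 then the flag \<open>X\<close> holds and the value 1 is a mere
    placeholder; the same goes for q and \<open>Y\<close>.\<close>
  define p' where "p' = (if p = 0 then 1 else p)"
  define q' where "q' = (if q = 0 then 1 else q)"
  have p': "0 < p'" "0 < q'" using pq by (auto simp: p'_def q'_def)
  obtain N1 where N1: "\<forall>m n. 1 \<le> m \<longrightarrow> 1 \<le> n \<longrightarrow> N1 \<le> m + n \<longrightarrow> real n \<le> 1 * real m \<longrightarrow> real m * (p - p' / 2) \<le> g m n"
    using row[OF zero_less_one half_gt_zero[OF p'(1)]] by blast
  obtain N2 where N2: "\<forall>m n. 1 \<le> m \<longrightarrow> 1 \<le> n \<longrightarrow> N2 \<le> m + n \<longrightarrow> real m \<le> 1 * real n \<longrightarrow> real n * (q - q' / 2) \<le> g m n"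
    using column[OF zero_less_one half_gt_zero[OF p'(2)]] by blast
  define M where "M = C + 2 + real N1 + real N2 + 2 / p' + 2 / q'"
  have M0: "0 < M" using C p' by (simp add: M_def add_pos_pos add_pos_nonneg)
  show ?thesis
  proof (rule exI[of _ M], intro conjI M0)
    show "\<forall>\<^sub>F t in at_top. \<forall>m n. 1 \<le> m \<longrightarrow> 1 \<le> n \<longrightarrow> g m n \<le> t \<longrightarrow> (X \<longrightarrow> real m \<le> C * t + 2) \<longrightarrow>
      (Y \<longrightarrow> real n \<le> C * t + 2) \<longrightarrow> real m \<le> M * t \<and> real n \<le> M * t"
      using eventually_ge_at_top[of 1]
    proof (eventually_elim, intro allI impI)
      fix t :: real and m n :: nat
      assume t: "1 \<le> t" and mn: "1 \<le> m" "1 \<le> n" "g m n \<le> t" "X \<longrightarrow> real m \<le> C * t + 2" "Y \<longrightarrow> real n \<le> C * t + 2"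
      have b: "C * t + 2 \<le> M * t" "real N1 \<le> M * t" "real N2 \<le> M * t" "2 / p' * t \<le> M * t" "2 / q' * t \<le> M * t"
      proof -
        have "C * t + 2 \<le> C * t + 2 * t" using t by simp
        also have "\<dots> \<le> M * t" using t p' by (simp add: M_def algebra_simps add_nonneg_nonneg)
        finally show "C * t + 2 \<le> M * t" .
        have "real N1 * 1 \<le> real N1 * t" "real N2 * 1 \<le> real N2 * t"
          using mult_left_mono[of 1 t "real N1"] mult_left_mono[of 1 t "real N2"] t by auto
        moreover have "real N1 \<le> M" "real N2 \<le> M" "2 / p' \<le> M" "2 / q' \<le> M"
        proof -
          have "0 < 2 / p'" "0 < 2 / q'" using p' by auto
          then show "real N1 \<le> M" "real N2 \<le> M" "2 / p' \<le> M" "2 / q' \<le> M" using C unfolding M_def by linarith+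
        qed
        then have "real N1 * t \<le> M * t" "real N2 * t \<le> M * t" "2 / p' * t \<le> M * t" "2 / q' * t \<le> M * t"
          using t by (auto intro: mult_right_mono simp del: times_divide_eq_left)
        ultimately show "real N1 \<le> M * t" "real N2 \<le> M * t" "2 / p' * t \<le> M * t" "2 / q' * t \<le> M * t" by auto
      qed
      have m: "real m \<le> M * t" if "n \<le> m"
      proof (cases X)
        case True
        then show ?thesis using mn b by linarith
      next
        case False
        then have p: "p' = p" "0 < p" using pq by (auto simp: p'_def)
        show ?thesis
        proof (cases "N1 \<le> m + n")
          case True
          then have "real m * (p / 2) \<le> t" using N1[rule_format, of m n] mn that p by auto
          then have "real m \<le> 2 / p' * t" using p by (simp add: field_simps)
          then show ?thesis using b by linarith
        next
          case False
          then have "real m \<le> real N1" by simp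
          then show ?thesis using b by linarith
        qed
      qed
      have n: "real n \<le> M * t" if "m \<le> n"
      proof (cases Y)
        case True
        then show ?thesis using mn b by linarith
      next
        case False
        then have p: "q' = q" "0 < q" using pq by (auto simp: q'_def)
        show ?thesis
        proof (cases "N2 \<le> m + n")
          case True
          then have "real n * (q / 2) \<le> t" using N2[rule_format, of m n] mn that p by auto
          then have "real n \<le> 2 / q' * t" using p by (simp add: field_simps)
          then show ?thesis using b by linarith
        next
          case False
          then have "real n \<le> real N2" by simp
          then show ?thesis using b by linarith
        qed
      qed
      show "real m \<le> M * t \<and> real n \<le> M * t"
        using m n by (cases "n \<le> m") (force intro: order_trans[of _ "real m"] order_trans[of _ "real n"])+
    qed
  qed
qed

lemma ex_Rs_bound:
  "\<exists>M>0. \<forall>\<^sub>F t in at_top. \<forall>x y. (x, y) \<in> S \<inter> Rs t \<longrightarrow>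
    (\<exists>m n. 1 \<le> m \<and> 1 \<le> n \<and> g m n \<le> t \<and> real m \<le> M * t \<and> real n \<le> M * t \<and> real m \<le> x * t + 2 \<and> real n \<le> y * t + 2 \<and>
    x * t \<le> real m + 1 \<and> y * t \<le> real n + 1 \<and> x \<le> M + 1 \<and> y \<le> M + 1)"
proof -
  obtain M where M: "0 < M" and ev: "\<forall>\<^sub>F t in at_top. \<forall>m n. 1 \<le> m \<longrightarrow> 1 \<le> n \<longrightarrow> g m n \<le> t \<longrightarrow> (X \<longrightarrow> real m \<le> C * t + 2) \<longrightarrow>
    (Y \<longrightarrow> real n \<le> C * t + 2) \<longrightarrow> real m \<le> M * t \<and> real n \<le> M * t"
    using ex_cell_bound by blast
  show ?thesis
  proof (rule exI[of _ M], intro conjI M)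
    show "\<forall>\<^sub>F t in at_top. \<forall>x y. (x, y) \<in> S \<inter> Rs t \<longrightarrow>
      (\<exists>m n. 1 \<le> m \<and> 1 \<le> n \<and> g m n \<le> t \<and> real m \<le> M * t \<and> real n \<le> M * t \<and> real m \<le> x * t + 2 \<and> real n \<le> y * t + 2 \<and>
      x * t \<le> real m + 1 \<and> y * t \<le> real n + 1 \<and> x \<le> M + 1 \<and> y \<le> M + 1)"
      using ev eventually_ge_at_top[of 1]
    proof (eventually_elim, intro allI impI)
      fix t x y :: real
      assume E: "\<forall>m n. 1 \<le> m \<longrightarrow> 1 \<le> n \<longrightarrow> g m n \<le> t \<longrightarrow> (X \<longrightarrow> real m \<le> C * t + 2) \<longrightarrow>
        (Y \<longrightarrow> real n \<le> C * t + 2) \<longrightarrow> real m \<le> M * t \<and> real n \<le> M * t" and t: "1 \<le> t" and xy: "(x, y) \<in> S \<inter> Rs t"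
      obtain m n where mn: "1 \<le> m" "1 \<le> n" "g m n \<le> t" "real m \<le> x * t + 2" "x * t \<le> real m + 1"
        "real n \<le> y * t + 2" "y * t \<le> real n + 1"
        using Rs_cell[of t x y] t xy by auto
      have "X \<longrightarrow> x * t \<le> C * t" "Y \<longrightarrow> y * t \<le> C * t" using xy t by (auto simp: S_def)
      then have b: "real m \<le> M * t" "real n \<le> M * t" using E mn by (meson add_mono_thms_linordered_semiring(3) order_trans)+
      then have "x * t \<le> (M + 1) * t" "y * t \<le> (M + 1) * t" using mn t by (auto simp: distrib_right)
      then have "x \<le> M + 1" "y \<le> M + 1" using t by auto
      then show "\<exists>m n. 1 \<le> m \<and> 1 \<le> n \<and> g m n \<le> t \<and> real m \<le> M * t \<and> real n \<le> M * t \<and> real m \<le> x * t + 2 \<and> real n \<le> y * t + 2 \<and>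
        x * t \<le> real m + 1 \<and> y * t \<le> real n + 1 \<and> x \<le> M + 1 \<and> y \<le> M + 1"
        using mn b by blast
    qed
  qed
qed

lemma eventually_hausdorff_dom_Rs: "\<forall>\<^sub>F t in at_top. hausdorff_dom (S \<inter> Rs t)"
proof -
  obtain M where "\<forall>\<^sub>F t in at_top. \<forall>x y. (x, y) \<in> S \<inter> Rs t \<longrightarrow>
    (\<exists>m n. 1 \<le> m \<and> 1 \<le> n \<and> g m n \<le> t \<and> real m \<le> M * t \<and> real n \<le> M * t \<and> real m \<le> x * t + 2 \<and> real n \<le> y * t + 2 \<and>
    x * t \<le> real m + 1 \<and> y * t \<le> real n + 1 \<and> x \<le> M + 1 \<and> y \<le> M + 1)"
    using ex_Rs_bound by blast
  then have "\<forall>\<^sub>F t in at_top. \<forall>x y. (x, y) \<in> S \<inter> Rs t \<longrightarrow> x \<le> M + 1 \<and> y \<le> M + 1"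
    by eventually_elim blast
  then show ?thesis
    using eventually_ge_at_top[of "1 / C"] eventually_ge_at_top[of "g 1 1"] eventually_gt_at_top[of 0]
  proof eventually_elim
    case (elim t)
    have "S \<inter> Rs t \<subseteq> {0..M + 1} \<times> {0..M + 1}"
      using elim(1) S_nonneg by fastforce
    then have "bounded (S \<inter> Rs t)" by (rule bounded_subset[rotated]) (intro bounded_Times bounded_closed_interval)
    moreover have "closed (S \<inter> Rs t)" by (intro closed_Int closed_S) (simp add: Rs_def)
    moreover have "(1 / t, 1 / t) \<in> S \<inter> Rs t"
    proof
      show "(1 / t, 1 / t) \<in> S" using elim C by (auto simp: S_def field_simps)
      have "(1, 1) \<in> R t" using elim by (simp add: R_def)
      then have "(1, 1) /\<^sub>R t \<in> (\<lambda>u. u /\<^sub>R t) ` R t" by blast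
      moreover have "(1, 1) /\<^sub>R t = (1 / t, 1 / t)" by (simp add: inverse_eq_divide)
      ultimately have "(1 / t, 1 / t) \<in> (\<lambda>u. u /\<^sub>R t) ` R t" by (simp only:)
      then show "(1 / t, 1 / t) \<in> Rs t" unfolding Rs_def by (rule subsetD[OF closure_subset])
    qed
    ultimately show ?case unfolding hausdorff_dom_def by blast
  qed
qed

section \<open>The scaled cluster lies close to the limit set\<close>

lemma S_down: "(x, y) \<in> S \<Longrightarrow> 0 \<le> x' \<Longrightarrow> x' \<le> x \<Longrightarrow> 0 \<le> y' \<Longrightarrow> y' \<le> y \<Longrightarrow> (x', y') \<in> S"
  by (auto simp: S_def)

text \<open>Near an axis the one-line estimate shows that x c exceeds 1 only slightly, so moving x
  back to 1 / c changes little. The function \<open>f\<close> is abstract so that both axes can use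
  the lemma.\<close>

lemma axis_excess:
  assumes "0 < e" "0 < M" "0 \<le> c"
    and low: "\<And>K \<epsilon>. 0 < K \<Longrightarrow> 0 < \<epsilon> \<Longrightarrow> \<exists>N. \<forall>m n. 1 \<le> m \<longrightarrow> 1 \<le> n \<longrightarrow> N \<le> m + n \<longrightarrow>
      real n \<le> K * real m \<longrightarrow> real m * (c - \<epsilon>) \<le> f m n"
  shows "\<forall>\<^sub>F t in at_top. \<forall>m n x. 1 \<le> m \<longrightarrow> 1 \<le> n \<longrightarrow> f m n \<le> t \<longrightarrow> real m \<le> M * t \<longrightarrow> real n \<le> t \<longrightarrow> 0 \<le> x \<longrightarrow>
     real m \<le> x * t + 2 \<longrightarrow> x * t \<le> real m + 1 \<longrightarrow> (\<exists>x'. 0 \<le> x' \<and> x' \<le> x \<and> x' * c \<le> 1 \<and> x - x' \<le> e)"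
proof (cases "c = 0")
  case True
  then show ?thesis using assms(1) by (intro always_eventually allI impI) (auto intro!: exI[of _ _])
next
  case False
  then have c: "0 < c" using assms by simp
  define \<epsilon> where "\<epsilon> = e * c / (2 * M)"
  have \<epsilon>: "0 < \<epsilon>" using assms c by (simp add: \<epsilon>_def)
  obtain N where N: "\<forall>m n. 1 \<le> m \<longrightarrow> 1 \<le> n \<longrightarrow> N \<le> m + n \<longrightarrow> real n \<le> (2 * c) * real m \<longrightarrow> real m * (c - \<epsilon>) \<le> f m n"
    using low[of "2 * c" \<epsilon>] c \<epsilon> by auto
  show ?thesis
    using eventually_ge_at_top[of "2 / e"] eventually_ge_at_top[of "2 * c"] eventually_ge_at_top[of "2 * c * real N"]
  proof (eventually_elim, intro allI impI)
    fix t x :: real and m n :: nat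
    assume t: "2 / e \<le> t" "2 * c \<le> t" "2 * c * real N \<le> t"
      and mn: "1 \<le> m" "1 \<le> n" "f m n \<le> t" "real m \<le> M * t" "real n \<le> t" "0 \<le> x" "real m \<le> x * t + 2" "x * t \<le> real m + 1"
    have t0: "0 < t" using t c by linarith
    show "\<exists>x'. 0 \<le> x' \<and> x' \<le> x \<and> x' * c \<le> 1 \<and> x - x' \<le> e"
    proof (cases "x * c \<le> 1")
      case True
      then show ?thesis using mn assms by (intro exI[of _ x]) auto
    next
      case False
      \<comment> \<open>If x c > 1, the cell satisfies t \<le> 2 c m; together with n \<le> t this
        places it in the region n \<le> 2 c m in which the estimate was taken.\<close>
      then have "t \<le> (x * c) * t" using t0 by simp
      also have "\<dots> = c * (x * t)" by simp
      also have "\<dots> \<le> c * (real m + 1)" using mn c by (intro mult_left_mono) auto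
      finally have tm: "t \<le> 2 * c * real m" using t by (simp add: algebra_simps)
      then have "2 * c * real N \<le> 2 * c * real m" using t by linarith
      then have "N \<le> m" using c by simp
      then have "real m * (c - \<epsilon>) \<le> t" using N[rule_format, of m n] mn tm by auto
      then have "real m * c \<le> t + \<epsilon> * real m" by (simp add: algebra_simps)
      also have "\<dots> \<le> t + \<epsilon> * (M * t)" using mn \<epsilon> by (intro add_left_mono mult_left_mono) auto
      also have "\<epsilon> * (M * t) = e * c * t / 2" using assms by (simp add: \<epsilon>_def)
      finally have mc: "real m * c \<le> t + e * c * t / 2" .
      have "x * t * c \<le> (real m + 1) * c" using mn c by (intro mult_right_mono) auto
      also have "\<dots> \<le> t + e * c * t / 2 + c" using mc by (simp add: algebra_simps)
      finally have "x * t * c \<le> t + e * c * t / 2 + c" .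
      moreover have "c \<le> e * c * t / 2" using t assms c by (simp add: field_simps)
      moreover have "x * c * t = x * t * c" "(1 + e * c) * t = t + e * c * t / 2 + e * c * t / 2"
        by (simp_all add: algebra_simps)
      ultimately have "x * c * t \<le> (1 + e * c) * t" by linarith
      then have "x * c \<le> 1 + e * c" using t0 by simp
      then have "x - 1 / c \<le> e" using c by (simp add: field_simps)
      then show ?thesis using c False by (intro exI[of _ "1 / c"]) (auto simp: field_simps)
    qed
  qed
qed

text \<open>A cell with n \<le> \<kappa> t or m \<le> \<kappa> t is projected to the axis. All
  others lie in a fixed cone, where the lower bound makes \<gamma> at most slightly above 1 and a
  small contraction towards the origin reaches the limit set. Both moves stay in the window since it
  is closed under decreasing coordinates.\<close>

lemma Rs_subset_neighborhood:
  assumes e: "0 < e"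
  shows "\<forall>\<^sub>F t in at_top. S \<inter> Rs t \<subseteq> (\<Union>u\<in>S \<inter> L. ball u e)"
proof -
  obtain M where M: "0 < M" and ev: "\<forall>\<^sub>F t in at_top. \<forall>x y. (x, y) \<in> S \<inter> Rs t \<longrightarrow>
    (\<exists>m n. 1 \<le> m \<and> 1 \<le> n \<and> g m n \<le> t \<and> real m \<le> M * t \<and> real n \<le> M * t \<and> real m \<le> x * t + 2 \<and> real n \<le> y * t + 2 \<and>
    x * t \<le> real m + 1 \<and> y * t \<le> real n + 1 \<and> x \<le> M + 1 \<and> y \<le> M + 1)"
    using ex_Rs_bound by blast
  \<comment> \<open>With n \<le> \<kappa> t the projected height is at most \<kappa> + 1 / t, below
    e / 2.\<close>
  define \<kappa> where "\<kappa> = min 1 (e / 4)"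
  have \<kappa>: "0 < \<kappa>" "\<kappa> \<le> 1" "\<kappa> \<le> e / 4" using e by (auto simp: \<kappa>_def)
  have e4: "0 < e / 4" using e by simp
  have axr: "\<forall>\<^sub>F t in at_top. \<forall>m n x. 1 \<le> m \<longrightarrow> 1 \<le> n \<longrightarrow> g m n \<le> t \<longrightarrow> real m \<le> M * t \<longrightarrow> real n \<le> t \<longrightarrow> 0 \<le> x \<longrightarrow>
     real m \<le> x * t + 2 \<longrightarrow> x * t \<le> real m + 1 \<longrightarrow> (\<exists>x'. 0 \<le> x' \<and> x' \<le> x \<and> x' * p \<le> 1 \<and> x - x' \<le> e / 4)"
    by (rule axis_excess[OF e4 M pq(1)]) (rule row)
  have axc: "\<forall>\<^sub>F t in at_top. \<forall>m n x. 1 \<le> m \<longrightarrow> 1 \<le> n \<longrightarrow> g n m \<le> t \<longrightarrow> real m \<le> M * t \<longrightarrow> real n \<le> t \<longrightarrow> 0 \<le> x \<longrightarrow>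
     real m \<le> x * t + 2 \<longrightarrow> x * t \<le> real m + 1 \<longrightarrow> (\<exists>x'. 0 \<le> x' \<and> x' \<le> x \<and> x' * q \<le> 1 \<and> x - x' \<le> e / 4)"
  proof (rule axis_excess[OF e4 M pq(2), of "\<lambda>m n. g n m"])
    fix K \<epsilon> :: real assume "0 < K" "0 < \<epsilon>"
    from column[OF this] obtain N where "\<forall>m n. 1 \<le> m \<longrightarrow> 1 \<le> n \<longrightarrow> N \<le> m + n \<longrightarrow> real m \<le> K * real n \<longrightarrow> real n * (q - \<epsilon>) \<le> g m n"
      by blast
    then show "\<exists>N. \<forall>m n. 1 \<le> m \<longrightarrow> 1 \<le> n \<longrightarrow> N \<le> m + n \<longrightarrow> real n \<le> K * real m \<longrightarrow> real m * (q - \<epsilon>) \<le> g n m"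
      by (intro exI[of _ N]) (simp add: add.commute)
  qed
  \<comment> \<open>The cone error is \<sigma> t, as m + n \<le> 2 M t. The contraction moves a
    point by at most 3 \<sigma> (x + y), and x + y \<le> 2 (M + 1).\<close>
  define \<sigma> where "\<sigma> = min 1 (e / (16 * (M + 1)))"
  have \<sigma>: "0 < \<sigma>" "\<sigma> \<le> 1" "\<sigma> \<le> e / (16 * (M + 1))" using e M by (auto simp: \<sigma>_def)
  have \<sigma>M: "3 * \<sigma> * (2 * (M + 1)) < e"
  proof -
    have "\<sigma> * (16 * (M + 1)) \<le> e" using \<sigma>(3) M by (simp add: field_simps)
    moreover have "\<sigma> * (16 * (M + 1)) = 3 * \<sigma> * (2 * (M + 1)) + 10 * (\<sigma> * (M + 1))" by (simp add: algebra_simps)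
    moreover have "0 < \<sigma> * (M + 1)" using \<sigma> M by simp
    ultimately show ?thesis by linarith
  qed
  have "0 < \<kappa> / M" "0 < \<sigma> / (2 * M)" using \<kappa> \<sigma> M by auto
  from cone[OF this] obtain N where N: "\<forall>m n. 1 \<le> m \<longrightarrow> 1 \<le> n \<longrightarrow> N \<le> m + n \<longrightarrow>
      \<kappa> / M * real m \<le> real n \<longrightarrow> \<kappa> / M * real n \<le> real m \<longrightarrow> \<gamma> (real m) (real n) - \<sigma> / (2 * M) * real (m + n) \<le> g m n"
    by blast
  show ?thesis
    using ev axr axc eventually_ge_at_top[of 1] eventually_gt_at_top[of "4 / e"] eventually_ge_at_top[of "1 / (\<kappa> * \<sigma>)"]
      eventually_ge_at_top[of "real N / \<kappa>"] eventually_ge_at_top[of "2 / \<kappa>"]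
  proof (eventually_elim, intro subsetI)
    fix t :: real and u :: "real \<times> real"
    assume ev: "\<forall>x y. (x, y) \<in> S \<inter> Rs t \<longrightarrow>
    (\<exists>m n. 1 \<le> m \<and> 1 \<le> n \<and> g m n \<le> t \<and> real m \<le> M * t \<and> real n \<le> M * t \<and> real m \<le> x * t + 2 \<and> real n \<le> y * t + 2 \<and>
    x * t \<le> real m + 1 \<and> y * t \<le> real n + 1 \<and> x \<le> M + 1 \<and> y \<le> M + 1)"
      and axr: "\<forall>m n x. 1 \<le> m \<longrightarrow> 1 \<le> n \<longrightarrow> g m n \<le> t \<longrightarrow> real m \<le> M * t \<longrightarrow> real n \<le> t \<longrightarrow> 0 \<le> x \<longrightarrow>
     real m \<le> x * t + 2 \<longrightarrow> x * t \<le> real m + 1 \<longrightarrow> (\<exists>x'. 0 \<le> x' \<and> x' \<le> x \<and> x' * p \<le> 1 \<and> x - x' \<le> e / 4)"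
      and axc: "\<forall>m n x. 1 \<le> m \<longrightarrow> 1 \<le> n \<longrightarrow> g n m \<le> t \<longrightarrow> real m \<le> M * t \<longrightarrow> real n \<le> t \<longrightarrow> 0 \<le> x \<longrightarrow>
     real m \<le> x * t + 2 \<longrightarrow> x * t \<le> real m + 1 \<longrightarrow> (\<exists>x'. 0 \<le> x' \<and> x' \<le> x \<and> x' * q \<le> 1 \<and> x - x' \<le> e / 4)"
      and t: "1 \<le> t" "4 / e < t" "1 / (\<kappa> * \<sigma>) \<le> t" "real N / \<kappa> \<le> t" "2 / \<kappa> \<le> t" and u: "u \<in> S \<inter> Rs t"
    obtain x y where xy: "u = (x, y)" by (cases u)
    have S: "(x, y) \<in> S" "0 \<le> x" "0 \<le> y" using u xy by (auto simp: S_def)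
    obtain m n where mn: "1 \<le> m" "1 \<le> n" "g m n \<le> t" "real m \<le> M * t" "real n \<le> M * t" "real m \<le> x * t + 2"
      "real n \<le> y * t + 2" "x * t \<le> real m + 1" "y * t \<le> real n + 1" "x \<le> M + 1" "y \<le> M + 1"
      using ev u xy by blast
    have t1: "1 / t < e / 4" using t e by (simp add: field_simps)
    have small: "s < e / 4 + e / 4" if "s * t \<le> real l + 1" "real l \<le> \<kappa> * t" for s l
    proof -
      have "s * t \<le> (\<kappa> + 1 / t) * t" using that t by (simp add: distrib_right)
      then have "s \<le> \<kappa> + 1 / t" using t by simp
      then show ?thesis using \<kappa> t1 by linarith
    qed
    have \<kappa>t: "\<kappa> * t \<le> t" using \<kappa> t by simp
    consider "real n \<le> \<kappa> * t" | "real m \<le> \<kappa> * t" | "\<kappa> * t < real m" "\<kappa> * t < real n" by linarith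
    then have "\<exists>v\<in>S \<inter> L. dist v u < e"
    proof cases
      case 1
      then have "real n \<le> t" using \<kappa>t by linarith
      then obtain x' where x': "0 \<le> x'" "x' \<le> x" "x' * p \<le> 1" "x - x' \<le> e / 4"
        using axr mn S by blast
      have "(x', 0) \<in> S \<inter> L" using x' S_down[OF S(1), of x' 0] S by (auto simp: L_iff)
      moreover have "dist (x', 0) u < e"
        using dist_le_sum[of x' 0 x y] x' S small[OF mn(9) 1] e unfolding xy by auto
      ultimately show ?thesis by blast
    next
      case 2
      then have "real m \<le> t" using \<kappa>t by linarith
      then obtain y' where y': "0 \<le> y'" "y' \<le> y" "y' * q \<le> 1" "y - y' \<le> e / 4"
        using axc mn S by blast
      have "(0, y') \<in> S \<inter> L" using y' S_down[OF S(1), of 0 y'] S by (auto simp: L_iff)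
      moreover have "dist (0, y') u < e"
        using dist_le_sum[of 0 y' x y] y' S small[OF mn(8) 2] e unfolding xy by auto
      ultimately show ?thesis by blast
    next
      case 3
      have t0: "0 < t" using t by simp
      have \<kappa>2: "2 \<le> \<kappa> * t" using t \<kappa> by (simp add: field_simps)
      have "0 < x * t" "0 < y * t" using 3 \<kappa>2 mn by linarith+
      then have xy0: "0 < x" "0 < y" using t0 by (simp_all add: zero_less_mult_iff)
      have "real N \<le> \<kappa> * t" using t \<kappa> by (simp add: field_simps)
      then have Nmn: "N \<le> m + n" using 3 by linarith
      have "\<kappa> / M * real m \<le> \<kappa> / M * (M * t)" "\<kappa> / M * real n \<le> \<kappa> / M * (M * t)"
        by (rule mult_left_mono[OF mn(4)], use \<kappa> M in simp, rule mult_left_mono[OF mn(5)], use \<kappa> M in simp)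
      then have "\<kappa> / M * real m \<le> real n" "\<kappa> / M * real n \<le> real m" using 3 M by auto
      then have "\<gamma> (real m) (real n) - \<sigma> / (2 * M) * real (m + n) \<le> g m n"
        using N mn Nmn by blast
      moreover have "\<sigma> / (2 * M) * real (m + n) \<le> \<sigma> / (2 * M) * (2 * M * t)"
        using mn \<sigma> M by (intro mult_left_mono) auto
      moreover have "\<sigma> / (2 * M) * (2 * M * t) = \<sigma> * t" using M by simp
      ultimately have gmn: "\<gamma> (real m) (real n) \<le> (1 + \<sigma>) * t" using mn by (simp add: algebra_simps)
      have one: "1 \<le> \<sigma> * (\<kappa> * t)" using t \<kappa> \<sigma> by (simp add: field_simps)
      have "\<sigma> * (\<kappa> * t) \<le> \<sigma> * real m" "\<sigma> * (\<kappa> * t) \<le> \<sigma> * real n" using 3 \<sigma> by (auto intro!: mult_left_mono)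
      then have up: "x * t \<le> (1 + \<sigma>) * real m" "y * t \<le> (1 + \<sigma>) * real n"
        using one mn by (auto simp: distrib_right)
      \<comment> \<open>One factor 1 + \<sigma> comes from the cone estimate, the other from
        rounding (x t, y t) to the lattice point (m, n).\<close>
      define \<rho> where "\<rho> = 1 / (1 + \<sigma>)\<^sup>2"
      have sp: "0 < (1 + \<sigma>)\<^sup>2" "1 \<le> (1 + \<sigma>)\<^sup>2" using \<sigma> by auto
      have \<rho>: "0 < \<rho>" "\<rho> \<le> 1" using sp by (auto simp: \<rho>_def)
      have "t * \<gamma> x y = \<gamma> (t * x) (t * y)" using hom t0 xy0 by simp
      also have "\<dots> \<le> \<gamma> ((1 + \<sigma>) * real m) ((1 + \<sigma>) * real n)"
        using up t0 xy0 by (intro mono) (auto simp: mult.commute)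
      also have "\<dots> = (1 + \<sigma>) * \<gamma> (real m) (real n)" using \<sigma> mn by (intro hom) auto
      also have "\<dots> \<le> (1 + \<sigma>) * ((1 + \<sigma>) * t)" using gmn \<sigma> by (intro mult_left_mono) auto
      finally have "t * \<gamma> x y \<le> t * (1 + \<sigma>)\<^sup>2" by (simp add: power2_eq_square mult_ac)
      then have "\<gamma> x y \<le> (1 + \<sigma>)\<^sup>2" using t0 by simp
      then have "\<gamma> (\<rho> * x) (\<rho> * y) \<le> 1" using hom[OF \<rho>(1) xy0] sp by (simp add: \<rho>_def)
      then have "(\<rho> * x, \<rho> * y) \<in> S \<inter> L"
        using S_down[OF S(1), of "\<rho> * x" "\<rho> * y"] \<rho> xy0 by (auto simp: L_iff mult_left_le_one_le)
      moreover have "dist (\<rho> * x, \<rho> * y) u < e"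
      proof -
        have "1 - \<rho> = \<rho> * ((1 + \<sigma>)\<^sup>2 - 1)" using sp by (simp add: \<rho>_def right_diff_distrib)
        also have "\<dots> \<le> 1 * ((1 + \<sigma>)\<^sup>2 - 1)" using \<rho> sp by (intro mult_right_mono) auto
        also have "\<dots> = 2 * \<sigma> + \<sigma> * \<sigma>" by (simp add: power2_eq_square algebra_simps)
        also have "\<dots> \<le> 2 * \<sigma> + \<sigma> * 1" using \<sigma> by (intro add_left_mono mult_left_mono) auto
        finally have r: "1 - \<rho> \<le> 3 * \<sigma>" by simp
        have "dist (\<rho> * x, \<rho> * y) u \<le> \<bar>\<rho> * x - x\<bar> + \<bar>\<rho> * y - y\<bar>" unfolding xy by (rule dist_le_sum)
        also have "\<dots> = (1 - \<rho>) * (x + y)"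
        proof -
          have "\<rho> * x \<le> x" "\<rho> * y \<le> y" using \<rho> xy0 by (auto simp: mult_left_le_one_le)
          then show ?thesis by (simp add: algebra_simps)
        qed
        also have "\<dots> \<le> 3 * \<sigma> * (2 * (M + 1))" using r mn xy0 \<sigma> \<rho> by (intro mult_mono) auto
        also note \<sigma>M
        finally show ?thesis .
      qed
      ultimately show ?thesis by blast
    qed
    then show "u \<in> (\<Union>u\<in>S \<inter> L. ball u e)" by auto
  qed
qed

section \<open>Points of the limit set are approached by the scaled cluster\<close>

lemma rational_below:
  assumes "0 < (x :: real)" "0 < d"
  shows "\<exists>x'\<in>\<rat>. 0 < x' \<and> x' < x \<and> x - x' < d"
proof -
  have "max 0 (x - d) < x" using assms by simp
  from Rats_dense_in_real[OF this] show ?thesis by auto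
qed

lemma Rs_memI: "0 < t \<Longrightarrow> 0 < x \<Longrightarrow> 0 < y \<Longrightarrow> g (nat \<lceil>x * t\<rceil>) (nat \<lceil>y * t\<rceil>) \<le> t \<Longrightarrow> (x, y) \<in> Rs t"
proof -
  assume t: "0 < t" "0 < x" "0 < y" "g (nat \<lceil>x * t\<rceil>) (nat \<lceil>y * t\<rceil>) \<le> t"
  then have "(x * t, y * t) \<in> R t" by (simp add: R_def)
  then have "(x * t, y * t) /\<^sub>R t \<in> (\<lambda>u. u /\<^sub>R t) ` R t" by blast
  moreover have "(x * t, y * t) /\<^sub>R t = (x, y)" using t by simp
  ultimately have "(x, y) \<in> (\<lambda>u. u /\<^sub>R t) ` R t" by (simp only:)
  then show ?thesis unfolding Rs_def by (rule subsetD[OF closure_subset])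
qed

text \<open>The upper bounds hold almost surely only for countably many points, and only strictly
  below the intercept with a positive coordinate. At x = 0 the approximation must therefore come
  from the right, elsewhere it comes from the left.\<close>

lemma rational_on_axis:
  assumes "0 \<le> x" "Z \<longrightarrow> x \<le> C" "x * c \<le> 1" "0 \<le> c" "0 < d"
  shows "\<exists>x'\<in>\<rat>. 0 < x' \<and> \<bar>x - x'\<bar> < d \<and> (Z \<longrightarrow> x' \<le> C) \<and> x' * c < 1"
proof (cases "x = 0")
  case True
  define z where "z = min C (1 / (c + 1))"
  have z: "0 < z" using C assms by (simp add: z_def)
  obtain x' where x': "x' \<in> \<rat>" "0 < x'" "x' < min d z" using Rats_dense_in_real[of 0 "min d z"] assms(5) z by auto
  have "x' * (c + 1) < 1" using x' assms(4) by (auto simp: z_def field_simps)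
  then have "x' * c < 1" using x' by (simp add: distrib_left)
  then show ?thesis using x' True by (intro bexI[of _ x']) (auto simp: z_def)
next
  case False
  then obtain x' where x': "x' \<in> \<rat>" "0 < x'" "x' < x" "x - x' < d" using rational_below[of x d] assms by auto
  have "x' * c < 1"
  proof (cases "c = 0")
    case False
    then have "x' * c < x * c" using assms x' by simp
    then show ?thesis using assms by linarith
  qed simp
  then show ?thesis using x' assms by (intro bexI[of _ x']) auto
qed

text \<open>Interior points are approached strictly from below by rational points. An axis point is
  approached along a fixed lattice row or column, whose scaled distance k / t from the axis tends to
  0.\<close>

lemma eventually_Rs_near:
  assumes xy: "(x, y) \<in> S \<inter> L" and e: "0 < e"
  shows "\<forall>\<^sub>F t in at_top. \<exists>v\<in>S \<inter> Rs t. dist (x, y) v < e"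
proof -
  have S: "(x, y) \<in> S" using xy by simp
  then have Sx: "0 \<le> x" "0 \<le> y" "X \<longrightarrow> x \<le> C" "Y \<longrightarrow> y \<le> C" by (simp_all add: S_def)
  have e2: "0 < e / 2" using e by simp
  from xy consider "0 < x" "0 < y" "\<gamma> x y \<le> 1" | "y = 0" "x * p \<le> 1" | "x = 0" "y * q \<le> 1"
    by (auto simp: L_iff)
  then show ?thesis
  proof cases
    case 1
    obtain x' where x': "x' \<in> \<rat>" "0 < x'" "x' < x" "x - x' < e / 2" using rational_below[OF 1(1) e2] by auto
    obtain y' where y': "y' \<in> \<rat>" "0 < y'" "y' < y" "y - y' < e / 2" using rational_below[OF 1(2) e2] by auto
    \<comment> \<open>Both coordinates shrink by at least the factor l < 1, so homogeneity turns
      \<gamma> \<le> 1 into a strict inequality.\<close>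
    define l where "l = max (x' / x) (y' / y)"
    have l: "0 < l" "l < 1" using x' y' 1 by (auto simp: l_def less_max_iff_disj)
    have "x' / x \<le> l" "y' / y \<le> l" by (auto simp: l_def)
    then have lx: "x' \<le> l * x" "y' \<le> l * y" using 1 by (simp_all add: field_simps)
    have "\<gamma> x' y' \<le> \<gamma> (l * x) (l * y)" using lx x' y' by (intro mono)
    also have "\<dots> = l * \<gamma> x y" using l 1 by (intro hom)
    also have "\<dots> \<le> l * 1" using l 1 by (intro mult_left_mono) auto
    finally have "\<gamma> x' y' < 1" using l by simp
    from up[OF x'(1) y'(1) x'(2) y'(2) this] show ?thesis
      using eventually_gt_at_top[of 0]
    proof eventually_elim
      case (elim t)
      have "(x', y') \<in> S \<inter> Rs t"
        using S_down[OF S, of x' y'] x' y' Rs_memI[OF elim(2) x'(2) y'(2) elim(1)] by auto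
      moreover have "dist (x, y) (x', y') < e"
        using dist_le_sum[of x y x' y'] x' y' by auto
      ultimately show ?case by blast
    qed
  next
    case 2
    obtain x' where x': "x' \<in> \<rat>" "0 < x'" "\<bar>x - x'\<bar> < e / 2" "X \<longrightarrow> x' \<le> C" "x' * p < 1"
      using rational_on_axis[OF Sx(1,3) 2(2) pq(1) e2] by blast
    obtain k where k: "1 \<le> k" "\<forall>\<^sub>F t in at_top. g (nat \<lceil>x' * t\<rceil>) k \<le> t" using up_row[OF x'(1,2,5)] by blast
    show ?thesis
      using k(2) eventually_gt_at_top[of 0] eventually_ge_at_top[of "real k / C"] eventually_gt_at_top[of "real k / (e / 2)"]
    proof eventually_elim
      case (elim t)
      have k0: "0 < real k / t" using k elim by simp
      have "nat \<lceil>real k / t * t\<rceil> = k" using elim by simp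
      then have "(x', real k / t) \<in> Rs t" using elim by (intro Rs_memI[OF elim(2) x'(2) k0]) simp
      moreover have "real k / t \<le> C" "real k / t < e / 2" using elim C e by (auto simp: field_simps)
      moreover from this have "(x', real k / t) \<in> S" using x' k0 by (simp add: S_def)
      moreover have "dist (x, y) (x', real k / t) < e"
      proof -
        have "\<bar>y - real k / t\<bar> < e / 2" using \<open>real k / t < e / 2\<close> k0 2 by (simp only: abs_less_iff) linarith
        then show ?thesis using dist_le_sum[of x y x' "real k / t"] x'(3) by linarith
      qed
      ultimately show ?case by blast
    qed
  next
    case 3
    obtain y' where y': "y' \<in> \<rat>" "0 < y'" "\<bar>y - y'\<bar> < e / 2" "Y \<longrightarrow> y' \<le> C" "y' * q < 1"
      using rational_on_axis[OF Sx(2,4) 3(2) pq(2) e2] by blast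
    obtain k where k: "1 \<le> k" "\<forall>\<^sub>F t in at_top. g k (nat \<lceil>y' * t\<rceil>) \<le> t" using up_column[OF y'(1,2,5)] by blast
    show ?thesis
      using k(2) eventually_gt_at_top[of 0] eventually_ge_at_top[of "real k / C"] eventually_gt_at_top[of "real k / (e / 2)"]
    proof eventually_elim
      case (elim t)
      have k0: "0 < real k / t" using k elim by simp
      have "nat \<lceil>real k / t * t\<rceil> = k" using elim by simp
      then have "(real k / t, y') \<in> Rs t" using elim by (intro Rs_memI[OF elim(2) k0 y'(2)]) simp
      moreover have "real k / t \<le> C" "real k / t < e / 2" using elim C e by (auto simp: field_simps)
      moreover from this have "(real k / t, y') \<in> S" using y' k0 by (simp add: S_def)
      moreover have "dist (x, y) (real k / t, y') < e"
      proof -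
        have "\<bar>x - real k / t\<bar> < e / 2" using \<open>real k / t < e / 2\<close> k0 3 by (simp only: abs_less_iff) linarith
        then show ?thesis using dist_le_sum[of x y "real k / t" y'] y'(3) by linarith
      qed
      ultimately show ?case by blast
    qed
  qed
qed

text \<open>The target set does not depend on t and is compact, so a finite net turns the pointwise
  approximation into a uniform one.\<close>

lemma L_subset_neighborhood:
  assumes e: "0 < e"
  shows "\<forall>\<^sub>F t in at_top. S \<inter> L \<subseteq> (\<Union>u\<in>S \<inter> Rs t. ball u e)"
proof -
  have "compact (S \<inter> L)" using hausdorff_dom_L unfolding hausdorff_dom_def compact_eq_bounded_closed by blast
  moreover have "S \<inter> L \<subseteq> (\<Union>u\<in>S \<inter> L. ball u (e / 2))" using e by auto
  ultimately obtain F where F: "F \<subseteq> S \<inter> L" "finite F" "S \<inter> L \<subseteq> (\<Union>u\<in>F. ball u (e / 2))"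
    using compactE_image[of "S \<inter> L" "S \<inter> L" "\<lambda>u. ball u (e / 2)"] by (metis open_ball)
  have "\<forall>\<^sub>F t in at_top. \<forall>u\<in>F. \<exists>v\<in>S \<inter> Rs t. dist u v < e / 2"
  proof (rule eventually_ball_finite[OF F(2)], rule ballI)
    fix u assume "u \<in> F"
    then have "(fst u, snd u) \<in> S \<inter> L" using F by auto
    from eventually_Rs_near[OF this half_gt_zero[OF e]]
    show "\<forall>\<^sub>F t in at_top. \<exists>v\<in>S \<inter> Rs t. dist u v < e / 2" by simp
  qed
  then show ?thesis
  proof eventually_elim
    case (elim t)
    show ?case
    proof
      fix w assume "w \<in> S \<inter> L"
      then obtain u where u: "u \<in> F" "dist u w < e / 2" using F(3) by auto
      then obtain v where v: "v \<in> S \<inter> Rs t" "dist u v < e / 2" using elim by blast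
      have "dist v w < e" using u v dist_triangle_half_r[of u v e w] by blast
      then show "w \<in> (\<Union>u\<in>S \<inter> Rs t. ball u e)" using v by auto
    qed
  qed
qed

theorem hausdorff_limit:
  "(\<forall>\<^sub>F t in at_top. hausdorff_dom (S \<inter> Rs t) \<and> hausdorff_dom (S \<inter> L)) \<and>
   ((\<lambda>t. hausdorff_dist (S \<inter> Rs t) (S \<inter> L)) \<longlongrightarrow> 0) at_top"
proof
  show "\<forall>\<^sub>F t in at_top. hausdorff_dom (S \<inter> Rs t) \<and> hausdorff_dom (S \<inter> L)"
    using eventually_hausdorff_dom_Rs hausdorff_dom_L by simp
  show "((\<lambda>t. hausdorff_dist (S \<inter> Rs t) (S \<inter> L)) \<longlongrightarrow> 0) at_top"
  proof (rule tendstoI)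
    fix e :: real assume e: "0 < e"
    show "\<forall>\<^sub>F t in at_top. dist (hausdorff_dist (S \<inter> Rs t) (S \<inter> L)) 0 < e"
      using Rs_subset_neighborhood[OF half_gt_zero[OF e]] L_subset_neighborhood[OF half_gt_zero[OF e]]
    proof eventually_elim
      case (elim t)
      let ?D = "{\<epsilon>. 0 < \<epsilon> \<and> S \<inter> Rs t \<subseteq> (\<Union>u\<in>S \<inter> L. ball u \<epsilon>) \<and> S \<inter> L \<subseteq> (\<Union>u\<in>S \<inter> Rs t. ball u \<epsilon>)}"
      have D: "e / 2 \<in> ?D" using elim e by auto
      then have "Inf ?D \<le> e / 2" by (intro cInf_lower bdd_belowI[of _ 0]) auto
      moreover have "0 \<le> Inf ?D" by (rule cInf_greatest) (use D in blast, auto)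
      ultimately show ?case using e by (simp add: hausdorff_dist_def)
    qed
  qed
qed

end

section \<open>The limit shape\<close>

lemma min_param_le_sup: "1 \<le> m \<Longrightarrow> ereal (min_param c m) \<le> sup_min_param c"
  unfolding sup_min_param_def by (rule SUP_upper) simp

lemma lim_le_sup_min_param:
  assumes "(\<lambda>m. ereal (min_param c m)) \<longlonglongrightarrow> \<cc>"
  shows "\<cc> \<le> sup_min_param c"
  by (rule LIMSEQ_le_const2[OF assms]) (use min_param_le_sup in blast)

lemma sup_min_param_finite:
  assumes "(\<lambda>m. ereal (min_param c m)) \<longlonglongrightarrow> \<cc>" "\<cc> \<noteq> \<infinity>" "\<cc> \<noteq> -\<infinity>"
  shows "sup_min_param c \<noteq> \<infinity>"
proof -
  obtain r where r: "\<cc> = ereal r" using assms by (cases \<cc>) auto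
  then have "min_param c \<longlonglongrightarrow> r" using assms by simp
  then have "Bseq (min_param c)" by (intro convergent_imp_Bseq convergentI)
  then obtain K where K: "\<And>m. norm (min_param c m) \<le> K" unfolding Bseq_def by blast
  have "min_param c m \<le> K" for m using K[of m] by simp
  then have "sup_min_param c \<le> ereal K"
    unfolding sup_min_param_def by (intro SUP_least) simp
  then show ?thesis by auto
qed

lemma (in prob_space) indep_vars_reindex_inj:
  assumes indep: "indep_vars M' X (f ` I)" and inj: "inj_on f I"
  shows "indep_vars (\<lambda>i. M' (f i)) (\<lambda>i. X (f i)) I"
proof -
  have sets: "indep_sets (\<lambda>i. {X i -` A \<inter> space M |A. A \<in> sets (M' i)}) (f ` I)"
    and rv: "\<forall>i\<in>f ` I. random_variable (M' i) (X i)"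
    using indep unfolding indep_vars_def2 by auto
  have "prob (\<Inter>j\<in>J. A j) = (\<Prod>j\<in>J. prob (A j))"
    if J: "J \<subseteq> I" "J \<noteq> {}" "finite J" and A: "A \<in> Pi J (\<lambda>i. {X (f i) -` A \<inter> space M |A. A \<in> sets (M' (f i))})" for J A
  proof -
    have inj': "inj_on f J" using inj J(1) by (rule inj_on_subset)
    define B where "B k = A (inv_into J f k)" for k
    have Bf: "B (f j) = A j" if "j \<in> J" for j using that inj' by (simp add: B_def)
    have "prob (\<Inter>k\<in>f ` J. B k) = (\<Prod>k\<in>f ` J. prob (B k))"
    proof (rule indep_setsD[OF sets])
      show "\<forall>k\<in>f ` J. B k \<in> {X k -` A \<inter> space M |A. A \<in> sets (M' k)}"
      proof
        fix k assume "k \<in> f ` J"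
        then obtain j where j: "j \<in> J" "k = f j" by blast
        show "B k \<in> {X k -` A \<inter> space M |A. A \<in> sets (M' k)}"
          using Pi_mem[OF A j(1)] unfolding j(2) Bf[OF j(1)] .
      qed
    qed (use J in auto)
    then show ?thesis using Bf inj' by (simp add: prod.reindex)
  qed
  moreover have "\<forall>i\<in>I. {X (f i) -` A \<inter> space M |A. A \<in> sets (M' (f i))} \<subseteq> events"
    using sets unfolding indep_sets_def by blast
  ultimately show ?thesis using rv unfolding indep_vars_def2 indep_sets_def
    by (intro conjI allI impI ballI) simp_all
qed

context inhomogeneous_lpp
begin

text \<open>Exchanging the two coordinates of every site exchanges a with b; the parameter z of the
  stationary model changes sign.\<close>

lemma transposed: "inhomogeneous_lpp b a \<beta> \<alpha> \<bb> \<aa> (\<lambda>m n u. \<omega> n m (prod.swap u))"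
proof (rule inhomogeneous_lpp.intro)
  show "0 < b m i + a n j" if "1 \<le> m" "1 \<le> n" "i \<in> {1..m}" "j \<in> {1..n}" for m n i j
    using pos[OF that(2,1,4,3)] by simp
  show "P.indep_vars (\<lambda>_. borel) (\<lambda>u. \<omega> n m (prod.swap u)) ({1..m} \<times> {1..n})" if "1 \<le> m" "1 \<le> n" for m n
  proof -
    have "prod.swap ` ({1..m} \<times> {1..n}) = {1..n} \<times> {1..m}" by auto
    then show ?thesis
      using P.indep_vars_reindex_inj[of "\<lambda>_. borel" "\<omega> n m" prod.swap "{1..m} \<times> {1..n}"] indep[OF that(2,1)] by simp
  qed
  show "distributed exp_product_space lborel (\<omega> n m (prod.swap (i, j))) (exponential_density (b m i + a n j))"
    if "1 \<le> m" "1 \<le> n" "i \<in> {1..m}" "j \<in> {1..n}" for m n i j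
    using distr[OF that(2,1,4,3)] by (simp add: add.commute)
  show "0 < \<bb> + \<aa>" using pos_lim by (simp add: add.commute)
qed (fact sub_\<alpha> sub_\<beta> conv_\<alpha> conv_\<beta> \<aa> \<bb>)+

lemma G_transposed: "inhomogeneous_lpp.G (\<lambda>m n u. \<omega> n m (prod.swap u)) m n \<xi> = G n m \<xi>"
proof -
  interpret T: inhomogeneous_lpp b a \<beta> \<alpha> \<bb> \<aa> "\<lambda>m n u. \<omega> n m (prod.swap u)" by (rule transposed)
  have "(\<lambda>u. \<omega> n m (prod.swap u) \<xi>) = (\<lambda>(i, j). (\<lambda>u. \<omega> n m u \<xi>) (j, i))" by auto
  then show ?thesis unfolding T.G_def G_def
    using lpp_swap[where w="\<lambda>u. \<omega> n m u \<xi>" and n=m and m=n] by simp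
qed

section \<open>Reciprocal intercepts on the axes\<close>

definition rowc :: real where
  "rowc = recip_integral \<alpha> (sup_min_param b)"

definition colc :: real where
  "colc = recip_integral \<beta> (sup_min_param a)"

lemma neg_ereal_less_iff: "- \<aa> < ereal z \<longleftrightarrow> ereal (- z) < \<aa>" "- \<bb> < ereal z \<longleftrightarrow> ereal (- z) < \<bb>"
  by (metis ereal_uminus_less_reorder uminus_ereal.simps(1))+

text \<open>A convergent real sequence is bounded, so the supremum is infinite only if \<bb> is, and
  then \<open>rowc\<close> is 0 by convention. Otherwise it is a real v \<ge> \<bb>, and \<aa> +
  \<bb> > 0 makes the integral at v well behaved.\<close>

lemma sup_b_cases:
  obtains "sup_min_param b = \<infinity>" "\<bb> = \<infinity>" | v where "sup_min_param b = ereal v" "ereal (- v) < \<aa>"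
proof (cases "sup_min_param b")
  case (real v)
  have le: "\<bb> \<le> ereal v" using lim_le_sup_min_param[OF \<bb>(2)] real by simp
  then have "ereal (- v) < \<aa>" using pos_lim \<aa>(1) \<bb>(1) by (cases \<aa>; cases \<bb>) auto
  then show ?thesis using real that(2) by blast
next
  case PInf
  then have "\<bb> = \<infinity>" using sup_min_param_finite[OF \<bb>(2) _ \<bb>(1)] by blast
  then show ?thesis using PInf that(1) by simp
next
  case MInf
  then have False using min_param_le_sup[of 1 b] by simp
  then show ?thesis ..
qed

lemma rowc_nonneg: "0 \<le> rowc"
  using A.recip_nonneg unfolding rowc_def recip_integral_def by (cases rule: sup_b_cases) auto

lemma rowc_pos: "\<alpha> \<noteq> null_measure borel \<Longrightarrow> \<bb> \<noteq> \<infinity> \<Longrightarrow> 0 < rowc"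
  using A.recip_pos unfolding rowc_def recip_integral_def by (cases rule: sup_b_cases) auto

text \<open>Any admissible z is below \<bb>, hence below the supremum of the minima, and the
  integral decreases in its parameter.\<close>

lemma rowc_le:
  assumes "- \<aa> < ereal z" "ereal z < \<bb>"
  shows "rowc \<le> (LINT s|\<alpha>. 1 / (s + z))"
proof (cases rule: sup_b_cases)
  case 1
  then show ?thesis using A.recip_nonneg[of z] assms by (simp add: rowc_def recip_integral_def neg_ereal_less_iff)
next
  case (2 v)
  have "ereal z < ereal v" using assms(2) lim_le_sup_min_param[OF \<bb>(2)] 2(1) by (metis less_le_trans)
  then show ?thesis using A.recip_antimono[of z v] assms 2(1) by (simp add: rowc_def recip_integral_def neg_ereal_less_iff)
qed

lemma AE_row:
  assumes K: "0 < K" and \<epsilon>: "0 < \<epsilon>"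
  shows "AE \<xi> in exp_product_space. \<exists>N. \<forall>m n. 1 \<le> m \<longrightarrow> 1 \<le> n \<longrightarrow> N \<le> m + n \<longrightarrow> real n \<le> K * real m \<longrightarrow>
    real m * (rowc - \<epsilon>) \<le> G m n \<xi>"
proof (cases rule: sup_b_cases)
  case 1
  then have r: "rowc = 0" by (simp add: rowc_def recip_integral_def)
  have le: "real m * (rowc - \<epsilon>) \<le> 0" for m unfolding r using \<epsilon> by (intro mult_nonneg_nonpos) auto
  show ?thesis using AE_last_passage
  proof eventually_elim
    case (elim \<xi>)
    have "real m * (rowc - \<epsilon>) \<le> G m n \<xi>" if "1 \<le> m" "1 \<le> n" for m n
    proof -
      have "0 \<le> G m n \<xi>" using elim that by blast
      then show ?thesis using le[of m] by linarith
    qed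
    then show ?case by blast
  qed
next
  case (2 v)
  have "min_param b n \<le> v" if "1 \<le> n" for n
    using min_param_le_sup[OF that, of b] 2(1) by simp
  from AE_lower_row[OF this 2(2) K \<epsilon>] show ?thesis
    using 2(1) by (simp add: rowc_def recip_integral_def)
qed

text \<open>There is a z strictly below the supremum of the minima that still gives a value below 1;
  the supremum then supplies a \<open>k\<close> whose minimum exceeds z.\<close>

lemma AE_up_row:
  assumes x: "0 < x" "x * rowc < 1"
  shows "\<exists>k\<ge>1. AE \<xi> in exp_product_space. \<forall>\<^sub>F t in at_top. G (nat \<lceil>x * t\<rceil>) k \<xi> \<le> t"
proof -
  have "\<exists>z. - \<aa> < ereal z \<and> ereal z < sup_min_param b \<and> x * (LINT s|\<alpha>. 1 / (s + z)) < 1"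
  proof (cases rule: sup_b_cases)
    case 1
    obtain t where t: "ereal t < \<aa>" using \<aa>(1) ereal_dense2[of "-\<infinity>" \<aa>] by auto
    \<comment> \<open>With parameter x + 1 - t the integral is at most 1 / (x + 1), so x times it
      stays below 1.\<close>
    have "(LINT s|\<alpha>. 1 / (s + (x + 1 - t))) \<le> 1 / (t + (x + 1 - t))"
      by (rule A.recip_le[OF t]) (use x in simp)
    then have "x * (LINT s|\<alpha>. 1 / (s + (x + 1 - t))) \<le> x * (1 / (t + (x + 1 - t)))"
      using x by (intro mult_left_mono) auto
    also have "\<dots> < 1" using x by simp
    finally show ?thesis using 1 t x
      by (intro exI[of _ "x + 1 - t"]) (auto simp: neg_ereal_less_iff intro: less_trans[of _ "ereal t"])
  next
    case (2 v)
    then have r: "rowc = (LINT s|\<alpha>. 1 / (s + v))" by (simp add: rowc_def recip_integral_def)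
    obtain t where t: "- v < t" "ereal t < \<aa>" using ereal_dense2[OF 2(2)] by auto
    define r where "r = (t + v) / 2"
    have r0: "0 < r" using t by (simp add: r_def)
    define h where "h = min r ((1 - x * rowc) * r\<^sup>2 / (2 * x))"
    have h: "0 < h" "h \<le> r" using r0 x by (auto simp: h_def)
    have "h \<le> (1 - x * rowc) * r\<^sup>2 / (2 * x)" by (simp add: h_def)
    then have hx: "x * (h / r\<^sup>2) \<le> (1 - x * rowc) / 2" using x r0 by (simp add: field_simps)
    have "(LINT s|\<alpha>. 1 / (s + (v - h))) \<le> (LINT s|\<alpha>. 1 / (s + v)) + (v - (v - h)) / r\<^sup>2"
      by (rule A.recip_lipschitz[OF t(2) r0]) (use h in \<open>auto simp: r_def field_simps\<close>)
    then have "x * (LINT s|\<alpha>. 1 / (s + (v - h))) \<le> x * (rowc + h / r\<^sup>2)"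
      using x r by (intro mult_left_mono) auto
    also have "\<dots> = x * rowc + x * (h / r\<^sup>2)" by (rule distrib_left)
    also have "\<dots> \<le> x * rowc + (1 - x * rowc) / 2" using hx by (rule add_left_mono)
    also have "\<dots> = (1 + x * rowc) / 2" by (simp add: field_simps)
    also have "\<dots> < 1" using x by simp
    finally have "x * (LINT s|\<alpha>. 1 / (s + (v - h))) < 1" .
    moreover have "ereal (- (v - h)) < \<aa>" using h t by (intro less_trans[OF _ t(2)]) (auto simp: r_def)
    ultimately show ?thesis using 2(1) h by (intro exI[of _ "v - h"]) (auto simp: neg_ereal_less_iff)
  qed
  then obtain z where z: "- \<aa> < ereal z" "ereal z < sup_min_param b" "x * (LINT s|\<alpha>. 1 / (s + z)) < 1" by blast
  then obtain k where k: "1 \<le> k" "z < min_param b k"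
    unfolding sup_min_param_def less_SUP_iff by auto
  show ?thesis using AE_upper_row[OF x(1) k(1) z(1) k(2) z(3)] k(1) by blast
qed

section \<open>Properties of the shape function\<close>

lemma shape_nonempty: "{z. - \<aa> < ereal z \<and> ereal z < \<bb>} \<noteq> {}"
proof -
  have "- \<aa> < \<bb>" using pos_lim \<aa>(1) \<bb>(1) by (cases \<aa>; cases \<bb>) auto
  then show ?thesis using ereal_dense2[of "- \<aa>" \<bb>] by auto
qed

lemma shape_le:
  assumes "0 \<le> x" "0 \<le> y" "- \<aa> < ereal z" "ereal z < \<bb>"
  shows "shape_fun \<alpha> \<beta> \<aa> \<bb> x y \<le> x * (LINT s|\<alpha>. 1 / (s + z)) + y * (LINT s|\<beta>. 1 / (s - z))"
  unfolding shape_fun_def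
proof (rule cINF_lower)
  show "bdd_below ((\<lambda>z. x * (LINT s|\<alpha>. 1 / (s + z)) + y * (LINT s|\<beta>. 1 / (s - z))) ` {z. - \<aa> < ereal z \<and> ereal z < \<bb>})"
  proof (rule bdd_belowI2)
    fix z assume "z \<in> {z. - \<aa> < ereal z \<and> ereal z < \<bb>}"
    then show "0 \<le> x * (LINT s|\<alpha>. 1 / (s + z)) + y * (LINT s|\<beta>. 1 / (s - z))"
      using A.recip_nonneg[of z] B.recip_nonneg[of "- z"] assms by (simp add: neg_ereal_less_iff)
  qed
qed (use assms in simp)

lemma le_shape:
  assumes "\<And>z. - \<aa> < ereal z \<Longrightarrow> ereal z < \<bb> \<Longrightarrow> c \<le> x * (LINT s|\<alpha>. 1 / (s + z)) + y * (LINT s|\<beta>. 1 / (s - z))"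
  shows "c \<le> shape_fun \<alpha> \<beta> \<aa> \<bb> x y"
  unfolding shape_fun_def by (rule cINF_greatest[OF shape_nonempty]) (use assms in auto)

lemma shape_hom_le:
  assumes "0 < l" "0 < x" "0 < y"
  shows "shape_fun \<alpha> \<beta> \<aa> \<bb> (l * x) (l * y) \<le> l * shape_fun \<alpha> \<beta> \<aa> \<bb> x y"
proof -
  have "shape_fun \<alpha> \<beta> \<aa> \<bb> (l * x) (l * y) / l \<le> shape_fun \<alpha> \<beta> \<aa> \<bb> x y"
  proof (rule le_shape)
    fix z assume z: "- \<aa> < ereal z" "ereal z < \<bb>"
    have "shape_fun \<alpha> \<beta> \<aa> \<bb> (l * x) (l * y) \<le> l * (x * (LINT s|\<alpha>. 1 / (s + z)) + y * (LINT s|\<beta>. 1 / (s - z)))"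
      using shape_le[of "l * x" "l * y" z] assms z by (simp add: distrib_left mult.assoc)
    then show "shape_fun \<alpha> \<beta> \<aa> \<bb> (l * x) (l * y) / l \<le> x * (LINT s|\<alpha>. 1 / (s + z)) + y * (LINT s|\<beta>. 1 / (s - z))"
      using assms(1) by (simp add: pos_divide_le_eq mult.commute)
  qed
  then show ?thesis using assms(1) by (simp add: pos_divide_le_eq mult.commute)
qed

lemma shape_hom:
  assumes "0 < l" "0 < x" "0 < y"
  shows "shape_fun \<alpha> \<beta> \<aa> \<bb> (l * x) (l * y) = l * shape_fun \<alpha> \<beta> \<aa> \<bb> x y"
proof (rule antisym[OF shape_hom_le[OF assms]])
  have "shape_fun \<alpha> \<beta> \<aa> \<bb> (1 / l * (l * x)) (1 / l * (l * y)) \<le> 1 / l * shape_fun \<alpha> \<beta> \<aa> \<bb> (l * x) (l * y)"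
    by (rule shape_hom_le) (use assms in auto)
  then show "l * shape_fun \<alpha> \<beta> \<aa> \<bb> x y \<le> shape_fun \<alpha> \<beta> \<aa> \<bb> (l * x) (l * y)"
    using assms by (simp add: field_simps)
qed

lemma shape_mono:
  assumes "0 < x" "x \<le> x'" "0 < y" "y \<le> y'"
  shows "shape_fun \<alpha> \<beta> \<aa> \<bb> x y \<le> shape_fun \<alpha> \<beta> \<aa> \<bb> x' y'"
proof (rule le_shape)
  fix z assume z: "- \<aa> < ereal z" "ereal z < \<bb>"
  have "shape_fun \<alpha> \<beta> \<aa> \<bb> x y \<le> x * (LINT s|\<alpha>. 1 / (s + z)) + y * (LINT s|\<beta>. 1 / (s - z))"
    by (rule shape_le) (use assms z in auto)
  also have "\<dots> \<le> x' * (LINT s|\<alpha>. 1 / (s + z)) + y' * (LINT s|\<beta>. 1 / (s - z))"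
    using A.recip_nonneg[of z] B.recip_nonneg[of "- z"] assms z by (intro add_mono mult_right_mono) (auto simp: neg_ereal_less_iff)
  finally show "shape_fun \<alpha> \<beta> \<aa> \<bb> x y \<le> x' * (LINT s|\<alpha>. 1 / (s + z)) + y' * (LINT s|\<beta>. 1 / (s - z))" .
qed

lemma shape_ge_row:
  assumes "0 < x" "0 < y"
  shows "x * rowc \<le> shape_fun \<alpha> \<beta> \<aa> \<bb> x y"
proof (rule le_shape)
  fix z assume z: "- \<aa> < ereal z" "ereal z < \<bb>"
  have "x * rowc \<le> x * (LINT s|\<alpha>. 1 / (s + z))" using rowc_le[OF z] assms by simp
  moreover have "0 \<le> y * (LINT s|\<beta>. 1 / (s - z))" using B.recip_nonneg[of "- z"] z assms by simp
  ultimately show "x * rowc \<le> x * (LINT s|\<alpha>. 1 / (s + z)) + y * (LINT s|\<beta>. 1 / (s - z))" by simp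
qed

lemma shape_less_oneD:
  assumes "shape_fun \<alpha> \<beta> \<aa> \<bb> x y < 1"
  shows "\<exists>z. - \<aa> < ereal z \<and> ereal z < \<bb> \<and> x * (LINT s|\<alpha>. 1 / (s + z)) + y * (LINT s|\<beta>. 1 / (s - z)) < 1"
  using assms le_shape[of 1 x y] by (meson not_le)

text \<open>For \<aa> = \<infinity> the measure \<alpha> is null and z may tend to -\<infinity>,
  where the \<beta> term vanishes.\<close>

lemma shape_nonpos:
  assumes "\<aa> = \<infinity>" "0 < x" "0 < y"
  shows "shape_fun \<alpha> \<beta> \<aa> \<bb> x y \<le> 0"
proof (rule field_le_epsilon)
  fix e :: real assume e: "0 < e"
  obtain t where t: "ereal t < \<bb>" using \<bb>(1) ereal_dense2[of "-\<infinity>" \<bb>] by auto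
  define z where "z = t - y / e"
  have "0 < y / e" using assms e by simp
  then have "(LINT s|\<beta>. 1 / (s + - z)) \<le> 1 / (t + - z)" by (intro B.recip_le[OF t]) (simp add: z_def)
  then have "y * (LINT s|\<beta>. 1 / (s - z)) \<le> y * (1 / (t + - z))" using assms by (intro mult_left_mono) auto
  also have "\<dots> = e" using assms e by (simp add: z_def)
  finally have "y * (LINT s|\<beta>. 1 / (s - z)) \<le> e" .
  moreover have "(LINT s|\<alpha>. 1 / (s + z)) = 0" using A.null_of_infinite[OF assms(1)] by (simp add: recip_null)
  moreover have "ereal z < \<bb>" using t \<open>0 < y / e\<close> by (intro le_less_trans[OF _ t]) (simp add: z_def)
  ultimately show "shape_fun \<alpha> \<beta> \<aa> \<bb> x y \<le> 0 + e"
    using shape_le[of x y z] assms by simp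
qed

lemma shape_transposed: "shape_fun \<beta> \<alpha> \<bb> \<aa> y x = shape_fun \<alpha> \<beta> \<aa> \<bb> x y"
proof -
  have "(\<lambda>z. x * (LINT s|\<alpha>. 1 / (s + z)) + y * (LINT s|\<beta>. 1 / (s - z))) ` {z. - \<aa> < ereal z \<and> ereal z < \<bb>} =
    (\<lambda>z. y * (LINT s|\<beta>. 1 / (s + z)) + x * (LINT s|\<alpha>. 1 / (s - z))) ` {z. - \<bb> < ereal z \<and> ereal z < \<aa>}"
    (is "?f ` ?A = ?g ` ?B")
  proof -
    have "?A = uminus ` ?B"
    proof (rule set_eqI)
      fix z
      have "z \<in> ?A \<longleftrightarrow> - z \<in> ?B" using neg_ereal_less_iff(1)[of z] neg_ereal_less_iff(2)[of "- z"] by auto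
      also have "\<dots> \<longleftrightarrow> z \<in> uminus ` ?B" by (metis (no_types, lifting) image_iff minus_minus)
      finally show "z \<in> ?A \<longleftrightarrow> z \<in> uminus ` ?B" .
    qed
    then have "?f ` ?A = (\<lambda>z. ?f (- z)) ` ?B" by (simp add: image_image)
    also have "\<dots> = ?g ` ?B" by (intro image_cong refl) (simp add: add.commute)
    finally show ?thesis .
  qed
  then show ?thesis unfolding shape_fun_def by simp
qed

text \<open>If one of the limits is infinite, the shape function is at most 0 and nonnegativity of
  passage times is enough; only the finite case needs the lower tail.\<close>

lemma AE_cone:
  assumes \<kappa>: "0 < \<kappa>" and \<epsilon>: "0 < \<epsilon>"
  shows "AE \<xi> in exp_product_space. \<exists>N. \<forall>m n. 1 \<le> m \<longrightarrow> 1 \<le> n \<longrightarrow> N \<le> m + n \<longrightarrow>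
    \<kappa> * real m \<le> real n \<longrightarrow> \<kappa> * real n \<le> real m \<longrightarrow>
    shape_fun \<alpha> \<beta> \<aa> \<bb> (real m) (real n) - \<epsilon> * real (m + n) \<le> G m n \<xi>"
proof (cases "\<aa> = \<infinity> \<or> \<bb> = \<infinity>")
  case True
  interpret T: inhomogeneous_lpp b a \<beta> \<alpha> \<bb> \<aa> "\<lambda>m n u. \<omega> n m (prod.swap u)" by (rule transposed)
  have "shape_fun \<alpha> \<beta> \<aa> \<bb> (real m) (real n) \<le> 0" if "1 \<le> m" "1 \<le> n" for m n
    using True
  proof
    assume "\<bb> = \<infinity>"
    then show ?thesis using T.shape_nonpos[of "real n" "real m"] that unfolding shape_transposed by simp
  qed (use shape_nonpos that in auto)
  note np = this
  have le: "shape_fun \<alpha> \<beta> \<aa> \<bb> (real m) (real n) - \<epsilon> * real (m + n) \<le> 0" if "1 \<le> m" "1 \<le> n" for m n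
  proof -
    have "shape_fun \<alpha> \<beta> \<aa> \<bb> (real m) (real n) \<le> 0" using np that by blast
    moreover have "0 \<le> \<epsilon> * real (m + n)" using \<epsilon> by simp
    ultimately show ?thesis by linarith
  qed
  show ?thesis using AE_last_passage
  proof eventually_elim
    case (elim \<xi>)
    have "shape_fun \<alpha> \<beta> \<aa> \<bb> (real m) (real n) - \<epsilon> * real (m + n) \<le> G m n \<xi>" if "1 \<le> m" "1 \<le> n" for m n
    proof -
      have "0 \<le> G m n \<xi>" using elim that by blast
      then show ?thesis using le[OF that] by linarith
    qed
    then show ?case by blast
  qed
next
  case False
  then obtain A0 B0 where "\<aa> = ereal A0" "\<bb> = ereal B0" using \<aa>(1) \<bb>(1) by (cases \<aa>; cases \<bb>) auto
  from AE_lower_cone[OF this \<kappa> \<epsilon>] show ?thesis .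
qed

lemma AE_column:
  assumes K: "0 < K" and \<epsilon>: "0 < \<epsilon>"
  shows "AE \<xi> in exp_product_space. \<exists>N. \<forall>m n. 1 \<le> m \<longrightarrow> 1 \<le> n \<longrightarrow> N \<le> m + n \<longrightarrow> real m \<le> K * real n \<longrightarrow>
    real n * (colc - \<epsilon>) \<le> G m n \<xi>"
proof -
  interpret T: inhomogeneous_lpp b a \<beta> \<alpha> \<bb> \<aa> "\<lambda>m n u. \<omega> n m (prod.swap u)" by (rule transposed)
  have "T.rowc = colc" by (simp add: T.rowc_def colc_def)
  then have "AE \<xi> in exp_product_space. \<exists>N. \<forall>m n. 1 \<le> m \<longrightarrow> 1 \<le> n \<longrightarrow> N \<le> m + n \<longrightarrow> real n \<le> K * real m \<longrightarrow>
    real m * (colc - \<epsilon>) \<le> G n m \<xi>"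
    using T.AE_row[OF assms] unfolding G_transposed by simp
  then show ?thesis
  proof eventually_elim
    case (elim \<xi>)
    then obtain N where "\<forall>m n. 1 \<le> m \<longrightarrow> 1 \<le> n \<longrightarrow> N \<le> m + n \<longrightarrow> real n \<le> K * real m \<longrightarrow> real m * (colc - \<epsilon>) \<le> G n m \<xi>" ..
    then show ?case by (intro exI[of _ N]) (simp add: add.commute)
  qed
qed

lemma AE_up_column:
  assumes y: "0 < y" "y * colc < 1"
  shows "\<exists>k\<ge>1. AE \<xi> in exp_product_space. \<forall>\<^sub>F t in at_top. G k (nat \<lceil>y * t\<rceil>) \<xi> \<le> t"
proof -
  interpret T: inhomogeneous_lpp b a \<beta> \<alpha> \<bb> \<aa> "\<lambda>m n u. \<omega> n m (prod.swap u)" by (rule transposed)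
  have "T.rowc = colc" by (simp add: T.rowc_def colc_def)
  then show ?thesis using T.AE_up_row[of y] y unfolding G_transposed by simp
qed

lemma colc_facts:
  "0 \<le> colc" "\<beta> \<noteq> null_measure borel \<Longrightarrow> \<aa> \<noteq> \<infinity> \<Longrightarrow> 0 < colc"
  "0 < x \<Longrightarrow> 0 < y \<Longrightarrow> y * colc \<le> shape_fun \<alpha> \<beta> \<aa> \<bb> x y"
proof -
  interpret T: inhomogeneous_lpp b a \<beta> \<alpha> \<bb> \<aa> "\<lambda>m n u. \<omega> n m (prod.swap u)" by (rule transposed)
  have r: "T.rowc = colc" by (simp add: T.rowc_def colc_def)
  show "0 \<le> colc" "\<beta> \<noteq> null_measure borel \<Longrightarrow> \<aa> \<noteq> \<infinity> \<Longrightarrow> 0 < colc"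
    "0 < x \<Longrightarrow> 0 < y \<Longrightarrow> y * colc \<le> shape_fun \<alpha> \<beta> \<aa> \<bb> x y"
    using T.rowc_nonneg T.rowc_pos T.shape_ge_row[of y x] unfolding r shape_transposed by auto
qed

text \<open>Almost sure statements must be combined over countably many instances: K is replaced by
  k + 1, the tolerances \<kappa> and \<epsilon> by 1 / (k + 1), and the points of the upper bounds
  by rational ones. The flags record the cases excluded in \<open>rowc_pos\<close> and its column
  analogue.\<close>

theorem AE_shape_limit:
  assumes C: "0 < C"
  shows "AE \<xi> in exp_product_space. shape_limit (shape_fun \<alpha> \<beta> \<aa> \<bb>) rowc colc C
    (\<lambda>m n. last_passage (\<lambda>u. \<omega> m n u \<xi>) m n) (\<alpha> = null_measure borel \<or> \<bb> = \<infinity>) (\<beta> = null_measure borel \<or> \<aa> = \<infinity>)"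
proof -
  have pos: "0 < real (Suc k)" "0 < 1 / real (Suc k)" for k by auto
  have row: "AE \<xi> in exp_product_space. \<forall>k. \<exists>N. \<forall>m n. 1 \<le> m \<longrightarrow> 1 \<le> n \<longrightarrow> N \<le> m + n \<longrightarrow> real n \<le> real (Suc k) * real m \<longrightarrow>
    real m * (rowc - 1 / real (Suc k)) \<le> G m n \<xi>"
    unfolding AE_all_countable using AE_row[OF pos] by blast
  have col: "AE \<xi> in exp_product_space. \<forall>k. \<exists>N. \<forall>m n. 1 \<le> m \<longrightarrow> 1 \<le> n \<longrightarrow> N \<le> m + n \<longrightarrow> real m \<le> real (Suc k) * real n \<longrightarrow>
    real n * (colc - 1 / real (Suc k)) \<le> G m n \<xi>"
    unfolding AE_all_countable using AE_column[OF pos] by blast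
  have cone: "AE \<xi> in exp_product_space. \<forall>k. \<exists>N. \<forall>m n. 1 \<le> m \<longrightarrow> 1 \<le> n \<longrightarrow> N \<le> m + n \<longrightarrow>
    1 / real (Suc k) * real m \<le> real n \<longrightarrow> 1 / real (Suc k) * real n \<le> real m \<longrightarrow>
    shape_fun \<alpha> \<beta> \<aa> \<bb> (real m) (real n) - 1 / real (Suc k) * real (m + n) \<le> G m n \<xi>"
    unfolding AE_all_countable using AE_cone[OF pos(2) pos(2)] by blast
  have up: "AE \<xi> in exp_product_space. \<forall>xy\<in>{(x, y). x \<in> \<rat> \<and> y \<in> \<rat> \<and> 0 < x \<and> 0 < y \<and> shape_fun \<alpha> \<beta> \<aa> \<bb> x y < 1}.
    \<forall>\<^sub>F t in at_top. G (nat \<lceil>fst xy * t\<rceil>) (nat \<lceil>snd xy * t\<rceil>) \<xi> \<le> t"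
  proof (subst AE_ball_countable)
    show "countable {(x, y). x \<in> \<rat> \<and> y \<in> \<rat> \<and> 0 < x \<and> 0 < y \<and> shape_fun \<alpha> \<beta> \<aa> \<bb> x y < 1}"
      by (rule countable_subset[of _ "\<rat> \<times> \<rat>"]) (auto simp: countable_rat)
    show "\<forall>xy\<in>{(x, y). x \<in> \<rat> \<and> y \<in> \<rat> \<and> 0 < x \<and> 0 < y \<and> shape_fun \<alpha> \<beta> \<aa> \<bb> x y < 1}.
      AE \<xi> in exp_product_space. \<forall>\<^sub>F t in at_top. G (nat \<lceil>fst xy * t\<rceil>) (nat \<lceil>snd xy * t\<rceil>) \<xi> \<le> t"
      using shape_less_oneD AE_upper_interior by fastforce
  qed
  have upr: "AE \<xi> in exp_product_space. \<forall>x\<in>{x. x \<in> \<rat> \<and> 0 < x \<and> x * rowc < 1}. \<exists>k\<ge>1. \<forall>\<^sub>F t in at_top. G (nat \<lceil>x * t\<rceil>) k \<xi> \<le> t"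
  proof (subst AE_ball_countable)
    show "countable {x. x \<in> \<rat> \<and> 0 < x \<and> x * rowc < 1}"
      by (rule countable_subset[of _ "\<rat>"]) (auto simp: countable_rat)
    show "\<forall>x\<in>{x. x \<in> \<rat> \<and> 0 < x \<and> x * rowc < 1}. AE \<xi> in exp_product_space. \<exists>k\<ge>1. \<forall>\<^sub>F t in at_top. G (nat \<lceil>x * t\<rceil>) k \<xi> \<le> t"
    proof
      fix x assume "x \<in> {x. x \<in> \<rat> \<and> 0 < x \<and> x * rowc < 1}"
      then obtain k where k: "k \<ge> 1" "AE \<xi> in exp_product_space. \<forall>\<^sub>F t in at_top. G (nat \<lceil>x * t\<rceil>) k \<xi> \<le> t"
        using AE_up_row by blast
      from k(2) show "AE \<xi> in exp_product_space. \<exists>k\<ge>1. \<forall>\<^sub>F t in at_top. G (nat \<lceil>x * t\<rceil>) k \<xi> \<le> t"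
        by eventually_elim (use k(1) in blast)
    qed
  qed
  have upc: "AE \<xi> in exp_product_space. \<forall>x\<in>{x. x \<in> \<rat> \<and> 0 < x \<and> x * colc < 1}. \<exists>k\<ge>1. \<forall>\<^sub>F t in at_top. G k (nat \<lceil>x * t\<rceil>) \<xi> \<le> t"
  proof (subst AE_ball_countable)
    show "countable {x. x \<in> \<rat> \<and> 0 < x \<and> x * colc < 1}"
      by (rule countable_subset[of _ "\<rat>"]) (auto simp: countable_rat)
    show "\<forall>x\<in>{x. x \<in> \<rat> \<and> 0 < x \<and> x * colc < 1}. AE \<xi> in exp_product_space. \<exists>k\<ge>1. \<forall>\<^sub>F t in at_top. G k (nat \<lceil>x * t\<rceil>) \<xi> \<le> t"
    proof
      fix x assume "x \<in> {x. x \<in> \<rat> \<and> 0 < x \<and> x * colc < 1}"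
      then obtain k where k: "k \<ge> 1" "AE \<xi> in exp_product_space. \<forall>\<^sub>F t in at_top. G k (nat \<lceil>x * t\<rceil>) \<xi> \<le> t"
        using AE_up_column by blast
      from k(2) show "AE \<xi> in exp_product_space. \<exists>k\<ge>1. \<forall>\<^sub>F t in at_top. G k (nat \<lceil>x * t\<rceil>) \<xi> \<le> t"
        by eventually_elim (use k(1) in blast)
    qed
  qed
  show ?thesis
    using row col cone up upr upc AE_last_passage
  proof eventually_elim
    case (elim \<xi>)
    define g where "g m n = last_passage (\<lambda>u. \<omega> m n u \<xi>) m n" for m n
    have gG: "g m n = G m n \<xi>" if "1 \<le> m" "1 \<le> n" for m n using elim(7) that by (simp add: g_def)
    have ceil1: "1 \<le> nat \<lceil>x\<rceil>" if "0 < x" for x :: real using that by (simp add: nat_le_iff) linarith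
    have arch: "\<exists>k. K \<le> real (Suc k) \<and> 1 / real (Suc k) \<le> \<epsilon>" if "0 < \<epsilon>" for K \<epsilon> :: real
    proof -
      obtain k where k: "max K (1 / \<epsilon>) < real k" using reals_Archimedean2 by blast
      have "0 < 1 / \<epsilon>" using that by simp
      then have "1 / \<epsilon> \<le> real (Suc k)" "K \<le> real (Suc k)" using k by auto
      then show ?thesis using that by (intro exI[of _ k]) (simp add: field_simps)
    qed
    show "shape_limit (shape_fun \<alpha> \<beta> \<aa> \<bb>) rowc colc C
      (\<lambda>m n. last_passage (\<lambda>u. \<omega> m n u \<xi>) m n) (\<alpha> = null_measure borel \<or> \<bb> = \<infinity>) (\<beta> = null_measure borel \<or> \<aa> = \<infinity>)"
      unfolding g_def[symmetric]
    proof (unfold_locales, goal_cases)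
      case (1 l x y) then show ?case by (rule shape_hom)
    next
      case (2 x y x' y') then show ?case by (rule shape_mono)
    next
      case (3 x y) then show ?case by (rule shape_ge_row)
    next
      case (4 x y) then show ?case by (rule colc_facts(3))
    next
      case 5 then show ?case by (rule rowc_nonneg)
    next
      case 6 then show ?case by (rule colc_facts(1))
    next
      case 7 then show ?case using rowc_pos by blast
    next
      case 8 then show ?case using colc_facts(2) by blast
    next
      case 9 then show ?case by (rule C)
    next
      case (10 K \<epsilon>)
      obtain k where k: "K \<le> real (Suc k)" "1 / real (Suc k) \<le> \<epsilon>" using arch[OF 10(2)] by blast
      obtain N where N: "\<forall>m n. 1 \<le> m \<longrightarrow> 1 \<le> n \<longrightarrow> N \<le> m + n \<longrightarrow> real n \<le> real (Suc k) * real m \<longrightarrow>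
        real m * (rowc - 1 / real (Suc k)) \<le> G m n \<xi>" using elim(1) by blast
      have "real m * (rowc - \<epsilon>) \<le> g m n" if "1 \<le> m" "1 \<le> n" "N \<le> m + n" "real n \<le> K * real m" for m n
      proof -
        have "K * real m \<le> real (Suc k) * real m" using k by (intro mult_right_mono) auto
        then have "real m * (rowc - 1 / real (Suc k)) \<le> g m n"
          using N[rule_format, OF that(1,2,3)] that(4) gG[OF that(1,2)] by linarith
        moreover have "real m * (rowc - \<epsilon>) \<le> real m * (rowc - 1 / real (Suc k))" using k by (intro mult_left_mono) auto
        ultimately show ?thesis by linarith
      qed
      then show ?case by blast
    next
      case (11 K \<epsilon>)
      obtain k where k: "K \<le> real (Suc k)" "1 / real (Suc k) \<le> \<epsilon>" using arch[OF 11(2)] by blast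
      obtain N where N: "\<forall>m n. 1 \<le> m \<longrightarrow> 1 \<le> n \<longrightarrow> N \<le> m + n \<longrightarrow> real m \<le> real (Suc k) * real n \<longrightarrow>
        real n * (colc - 1 / real (Suc k)) \<le> G m n \<xi>" using elim(2) by blast
      have "real n * (colc - \<epsilon>) \<le> g m n" if "1 \<le> m" "1 \<le> n" "N \<le> m + n" "real m \<le> K * real n" for m n
      proof -
        have "K * real n \<le> real (Suc k) * real n" using k by (intro mult_right_mono) auto
        then have "real n * (colc - 1 / real (Suc k)) \<le> g m n"
          using N[rule_format, OF that(1,2,3)] that(4) gG[OF that(1,2)] by linarith
        moreover have "real n * (colc - \<epsilon>) \<le> real n * (colc - 1 / real (Suc k))" using k by (intro mult_left_mono) auto
        ultimately show ?thesis by linarith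
      qed
      then show ?case by blast
    next
      case (12 \<kappa> \<epsilon>)
      have "0 < min \<kappa> \<epsilon>" using 12 by simp
      from arch[OF this, of 0] obtain k where k: "1 / real (Suc k) \<le> \<kappa>" "1 / real (Suc k) \<le> \<epsilon>" by auto
      obtain N where N: "\<forall>m n. 1 \<le> m \<longrightarrow> 1 \<le> n \<longrightarrow> N \<le> m + n \<longrightarrow>
        1 / real (Suc k) * real m \<le> real n \<longrightarrow> 1 / real (Suc k) * real n \<le> real m \<longrightarrow>
        shape_fun \<alpha> \<beta> \<aa> \<bb> (real m) (real n) - 1 / real (Suc k) * real (m + n) \<le> G m n \<xi>" using elim(3) by blast
      have "shape_fun \<alpha> \<beta> \<aa> \<bb> (real m) (real n) - \<epsilon> * real (m + n) \<le> g m n"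
        if "1 \<le> m" "1 \<le> n" "N \<le> m + n" "\<kappa> * real m \<le> real n" "\<kappa> * real n \<le> real m" for m n
      proof -
        have "1 / real (Suc k) * real m \<le> \<kappa> * real m" "1 / real (Suc k) * real n \<le> \<kappa> * real n"
          "1 / real (Suc k) * real (m + n) \<le> \<epsilon> * real (m + n)" using k by (intro mult_right_mono; simp)+
        moreover from this have "shape_fun \<alpha> \<beta> \<aa> \<bb> (real m) (real n) - 1 / real (Suc k) * real (m + n) \<le> G m n \<xi>"
          using N[rule_format, OF that(1,2,3)] that(4,5) by linarith
        ultimately show ?thesis using gG[OF that(1,2)] by linarith
      qed
      then show ?case by blast
    next
      case (13 x y)
      then have "\<forall>\<^sub>F t in at_top. G (nat \<lceil>x * t\<rceil>) (nat \<lceil>y * t\<rceil>) \<xi> \<le> t"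
        using elim(4) by (auto dest: bspec[of _ _ "(x, y)"])
      then show ?case using eventually_gt_at_top[of 0]
        by eventually_elim (use 13 ceil1 in \<open>simp add: gG\<close>)
    next
      case (14 x)
      then obtain k where k: "1 \<le> k" "\<forall>\<^sub>F t in at_top. G (nat \<lceil>x * t\<rceil>) k \<xi> \<le> t" using elim(5) by blast
      have "\<forall>\<^sub>F t in at_top. g (nat \<lceil>x * t\<rceil>) k \<le> t" using k(2) eventually_gt_at_top[of 0]
        by eventually_elim (use 14 k(1) ceil1 in \<open>simp add: gG\<close>)
      then show ?case using k(1) by blast
    next
      case (15 x)
      then obtain k where k: "1 \<le> k" "\<forall>\<^sub>F t in at_top. G k (nat \<lceil>x * t\<rceil>) \<xi> \<le> t" using elim(6) by blast
      have "\<forall>\<^sub>F t in at_top. g k (nat \<lceil>x * t\<rceil>) \<le> t" using k(2) eventually_gt_at_top[of 0]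
        by eventually_elim (use 15 k(1) ceil1 in \<open>simp add: gG\<close>)
      then show ?case using k(1) by blast
    qed
  qed
qed

end

theorem theorem3p9:
  fixes a b :: "nat \<Rightarrow> nat \<Rightarrow> real"
    and \<alpha> \<beta> :: "real measure"
    and \<aa> \<bb> :: ereal
    and C :: real
    and \<omega> :: "nat \<Rightarrow> nat \<Rightarrow> nat \<times> nat \<Rightarrow> (nat \<times> nat \<Rightarrow> real) \<Rightarrow> real"
  assumes pos: "\<And>m n i j. 1 \<le> m \<Longrightarrow> 1 \<le> n \<Longrightarrow> i \<in> {1..m} \<Longrightarrow> j \<in> {1..n} \<Longrightarrow> 0 < a m i + b n j"
    and indep: "\<And>m n. 1 \<le> m \<Longrightarrow> 1 \<le> n \<Longrightarrow>
      prob_space.indep_vars exp_product_space (\<lambda>_. borel) (\<omega> m n) ({1..m} \<times> {1..n})"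
    and distr: "\<And>m n i j. 1 \<le> m \<Longrightarrow> 1 \<le> n \<Longrightarrow> i \<in> {1..m} \<Longrightarrow> j \<in> {1..n} \<Longrightarrow>
      distributed exp_product_space lborel (\<omega> m n (i, j)) (exponential_density (a m i + b n j))"
    and sub_\<alpha>: "subprob_space \<alpha>" "sets \<alpha> = sets borel"
    and sub_\<beta>: "subprob_space \<beta>" "sets \<beta> = sets borel"
    and conv_\<alpha>: "vague_conv (empirical a) \<alpha>"
    and conv_\<beta>: "vague_conv (empirical b) \<beta>"
    and \<aa>: "\<aa> \<noteq> -\<infinity>" "(\<lambda>m. ereal (min_param a m)) \<longlonglongrightarrow> \<aa>"
    and \<bb>: "\<bb> \<noteq> -\<infinity>" "(\<lambda>n. ereal (min_param b n)) \<longlonglongrightarrow> \<bb>"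
    and pos_lim: "0 < \<aa> + \<bb>"
    and C: "0 < C"
  defines "S \<equiv> window \<alpha> \<beta> \<aa> \<bb> C"
    and "L \<equiv> limit_region \<alpha> \<beta> \<aa> \<bb> \<union> limit_axes \<alpha> \<beta> (sup_min_param a) (sup_min_param b)"
  shows "AE \<xi> in exp_product_space.
    (\<forall>\<^sub>F t in at_top.
       hausdorff_dom (S \<inter> closure ((\<lambda>u. u /\<^sub>R t) ` cluster (\<lambda>m n u. \<omega> m n u \<xi>) t)) \<and>
       hausdorff_dom (S \<inter> L)) \<and>
    ((\<lambda>t. hausdorff_dist (S \<inter> closure ((\<lambda>u. u /\<^sub>R t) ` cluster (\<lambda>m n u. \<omega> m n u \<xi>) t)) (S \<inter> L))
       \<longlongrightarrow> 0) at_top"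
proof -
  interpret I: inhomogeneous_lpp a b \<alpha> \<beta> \<aa> \<bb> \<omega>
    by (rule inhomogeneous_lpp.intro) (fact pos indep distr sub_\<alpha> sub_\<beta> conv_\<alpha> conv_\<beta> \<aa> \<bb> pos_lim)+
  show ?thesis
    using I.AE_shape_limit[OF C]
  proof eventually_elim
    case (elim \<xi>)
    interpret H: shape_limit "shape_fun \<alpha> \<beta> \<aa> \<bb>" I.rowc I.colc C "\<lambda>m n. last_passage (\<lambda>u. \<omega> m n u \<xi>) m n"
      "\<alpha> = null_measure borel \<or> \<bb> = \<infinity>" "\<beta> = null_measure borel \<or> \<aa> = \<infinity>"
      by (rule elim)
    have "H.S = S" unfolding H.S_def S_def window_def ..
    moreover have "H.L = L"
      unfolding H.L_def unfolding L_def limit_region_def limit_axes_def I.rowc_def I.colc_def ..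
    moreover have "H.Rs t = closure ((\<lambda>u. u /\<^sub>R t) ` cluster (\<lambda>m n u. \<omega> m n u \<xi>) t)" for t
      unfolding H.Rs_def H.R_def cluster_def ..
    ultimately show ?case using H.hausdorff_limit by simp
  qed
qed

end
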